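(* Let $\Sigma$ be a $d$-dimensional shifted complex with initial vertex $p$, let $\Delta=\mathrm{del}_p\Sigma$ and $\Lambda=\mathrm{link}_p\Sigma$, and for a face or multiset $F$ write $\tilde F=F\cup\{p\}$. Then $$\hat\tau_d(\Sigma)=\Big(\prod_{F\in\Lambda_{d-1}}X_{\tilde F}\Big)\Big(\prod_{(S,T)\in\mathrm{LSG}(\Delta_d)}\frac{z(S,\tilde T)}{X_{1,p}}\Big)=\Big(\prod_{F\in\Lambda_{d-1}}X_{\tilde F}\Big)\Big(\prod_{(S,T)\in\mathrm{LSG}(\Delta_d)}\frac{\sum_{j\in\tilde T}X_{S\cup j}}{X_{\tilde S}}\Big).$$
   Context: Shifted complex: simplicial complex $\Sigma$ on vertex set an integer interval $[p,q]$ ($p$ its initial vertex) such that whenever $i<j$, $F\in\Sigma$, $i\notin F$, $j\in F$, then $(F\setminus\{j\})\cup\{i\}\in\Sigma$. $\mathrm{del}_p\Sigma=\{F\in\Sigma:p\notin F\}$, $\mathrm{link}_p\Sigma=\{F:p\notin F,\ F\cup\{p\}\in\Sigma\}$; $\Omega_i$ = $i$-dimensional faces. Homology is reduced over $\mathbb Z$, $\beta_i$ its rank. A $d$-SST of $\Sigma$ is a $d$-dimensional subcomplex $\Upsilon$ with the same faces as $\Sigma$ in dimensions $<d$, $\tilde H_d(\Upsilon)=0$, $|\tilde H_{d-1}(\Upsilon)|<\infty$, $f_d(\Upsilon)=f_d(\Sigma)-\beta_d(\Sigma)+\beta_{d-1}(\Sigma)$; $\mathcal T(\Sigma)$ is the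 set of them. Indeterminates $x_{a,j}$, $X_{a,j}=x_{a,j}^2$; for a finite multiset of integers $S=\{i_1\le\cdots\le i_m\}$, $x_S=x_{1,i_1}\cdots x_{m,i_m}$, $X_S=x_S^2$. Combinatorial fine weighting: $\hat\tau_d(\Sigma)=\sum_{\Upsilon\in\mathcal T(\Sigma)}|\tilde H_{d-1}(\Upsilon;\mathbb Z)|^2\prod_{F\in\Upsilon_d}X_F$. The raising operator $\uparrow$ substitutes $x_{a,j}\mapsto x_{a+1,j}$. $z(S,T)=\frac{1}{\uparrow X_S}\sum_{j\in T}X_{S\cup j}$ (multiset unions). For a family $\mathcal F$ of $k$-sets of integers, $p_{\mathcal F}$ is the least integer in any member; a critical pair is $(A,B)$ with $A=\{a_1<\dots<a_k\}\in\mathcal F$, $B\notin\mathcal F$, $B$ the $k$-set obtained by replacing some $a_i$ by $a_i+1$; its long signature is $(\{a_1,\dots,a_{i-1}\},\{j:p_{\mathcal F}\le j\le a_i\})$, and $\mathrm{LSG}(\mathcal F)$ is the multiset of long signatures of all critical pairs ($\Delta_d$ viewed as a family of $(d+1)$-sets).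
   Formalization: The rank β_{d-1}(Σ) is assumed to be 0 and d ≥ 0; otherwise Σ has no d-SST, so the left side is 0 while the right side is nonzero (e.g. Σ with facets {1,2} and {3}, d = 1, where the right side is X_{12}). *)

theory Defs
  imports
    "HOL-Library.Multiset"
    "HOL-Library.Poly_Mapping"
    "HOL-Library.Product_Lexorder"
    "HOL-Algebra.Free_Abelian_Groups"
    "HOL-Computational_Algebra.Polynomial_Factorial"
begin

section \<open>Simplicial complexes\<close>

text \<open>Vertices are integers.  The empty face is required; singletons of the
  vertex set need not be faces.\<close>

definition simplicial_complex :: "int set \<Rightarrow> int set set \<Rightarrow> bool" where
  "simplicial_complex V K \<longleftrightarrow>
     finite V \<and> K \<subseteq> Pow V \<and> {} \<in> K \<and> (\<forall>F\<in>K. \<forall>G\<subseteq>F. G \<in> K)"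

definition shifted_complex :: "int \<Rightarrow> int \<Rightarrow> int set set \<Rightarrow> bool" where
  "shifted_complex p q K \<longleftrightarrow>
     simplicial_complex {p..q} K \<and>
     (\<forall>i\<in>{p..q}. \<forall>j\<in>{p..q}. \<forall>F\<in>K.
        i < j \<longrightarrow> i \<notin> F \<longrightarrow> j \<in> F \<longrightarrow> insert i (F - {j}) \<in> K)"

definition faces :: "int \<Rightarrow> int set set \<Rightarrow> int set set" where
  "faces i K = {F \<in> K. int (card F) - 1 = i}"

definition complex_dim :: "int set set \<Rightarrow> int" where
  "complex_dim K = Max ((\<lambda>F. int (card F) - 1) ` K)"

definition deletion :: "int \<Rightarrow> int set set \<Rightarrow> int set set" where
  "deletion p K = {F \<in> K. p \<notin> F}"

definition link :: "int \<Rightarrow> int set set \<Rightarrow> int set set" where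
  "link p K = {F. p \<notin> F \<and> insert p F \<in> K}"


section \<open>Reduced simplicial homology over the integers\<close>

text \<open>Each face is oriented by the order of its vertices.  The boundary of a
  vertex is the empty face, which lives in degree \<open>-1\<close>, so the homology below
  is reduced.\<close>

definition chain_group :: "int \<Rightarrow> int set set \<Rightarrow> (int set \<Rightarrow>\<^sub>0 int) monoid" where
  "chain_group i K = free_Abelian_group (faces i K)"

definition boundary :: "(int set \<Rightarrow>\<^sub>0 int) \<Rightarrow> (int set \<Rightarrow>\<^sub>0 int)" where
  "boundary =
     frag_extend (\<lambda>F. \<Sum>v\<in>F. frag_cmul ((-1) ^ card {u \<in> F. u < v}) (frag_of (F - {v})))"

definition cycles :: "int \<Rightarrow> int set set \<Rightarrow> (int set \<Rightarrow>\<^sub>0 int) set" where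
  "cycles i K = {c \<in> carrier (chain_group i K). boundary c = 0}"

definition boundaries :: "int \<Rightarrow> int set set \<Rightarrow> (int set \<Rightarrow>\<^sub>0 int) set" where
  "boundaries i K = boundary ` carrier (chain_group (i + 1) K)"

definition reduced_homology :: "int \<Rightarrow> int set set \<Rightarrow> (int set \<Rightarrow>\<^sub>0 int) set monoid" where
  "reduced_homology i K =
     subgroup_generated (chain_group i K) (cycles i K) Mod boundaries i K"

text \<open>The rank of an abelian group is the largest size of a finite
  \<open>\<int>\<close>-linearly independent subset.\<close>

definition int_independent :: "('a, 'b) monoid_scheme \<Rightarrow> 'a set \<Rightarrow> bool" where
  "int_independent G B \<longleftrightarrow>
     (\<forall>c :: 'a \<Rightarrow> int.
        finprod G (\<lambda>b. b [^]\<^bsub>G\<^esub> c b) B = \<one>\<^bsub>G\<^esub> \<longrightarrow> (\<forall>b\<in>B. c b = 0))"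

definition abelian_rank :: "('a, 'b) monoid_scheme \<Rightarrow> nat" where
  "abelian_rank G =
     (GREATEST n. \<exists>B\<subseteq>carrier G. finite B \<and> card B = n \<and> int_independent G B)"

definition betti :: "int \<Rightarrow> int set set \<Rightarrow> nat" where
  "betti i K = abelian_rank (reduced_homology i K)"


section \<open>Simplicial spanning trees\<close>

text \<open>If \<open>betti (d - 1) K\<close> is positive, then there are none, because the homology of
  any candidate \<open>U\<close> in degree \<open>d - 1\<close> surjects onto that of \<open>K\<close>.\<close>

definition spanning_trees :: "int \<Rightarrow> int set set \<Rightarrow> int set set set" where
  "spanning_trees d K =
     {U. U \<subseteq> K \<and> (\<exists>V. simplicial_complex V U) \<and> complex_dim U = d \<and>
         (\<forall>i<d. faces i U = faces i K) \<and>
         trivial_group (reduced_homology d U) \<and>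
         finite (carrier (reduced_homology (d - 1) U)) \<and>
         int (card (faces d U)) =
           int (card (faces d K)) - int (betti d K) + int (betti (d - 1) K)}"


section \<open>Indeterminates and the combinatorial fine weighting\<close>

text \<open>The key \<open>(a, j)\<close> is the name of the indeterminate \<open>x\<^sub>a\<^sub>,\<^sub>j\<close>;
  exponent vectors and polynomials are both finitely supported functions.
  The lexicographic order on \<open>nat \<times> int\<close> only serves to make the polynomial ring
  an instance of the class \<open>idom\<close>, as its fraction field requires.\<close>

type_synonym indet_poly = "((nat \<times> int) \<Rightarrow>\<^sub>0 nat) \<Rightarrow>\<^sub>0 int"

definition indet :: "nat \<Rightarrow> int \<Rightarrow> indet_poly" where
  "indet a j = Poly_Mapping.single (Poly_Mapping.single (a, j) 1) 1"

definition x_mon :: "int multiset \<Rightarrow> indet_poly" where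
  "x_mon S = (\<Prod>k<size S. indet (k + 1) (sorted_list_of_multiset S ! k))"

definition X_mon :: "int multiset \<Rightarrow> indet_poly" where
  "X_mon S = (x_mon S)\<^sup>2"

definition raising :: "indet_poly \<Rightarrow> indet_poly" where
  "raising P =
     (\<Sum>m\<in>Poly_Mapping.keys P. of_int (Poly_Mapping.lookup P m) *
        (\<Prod>(a, j)\<in>Poly_Mapping.keys m. indet (a + 1) j ^ Poly_Mapping.lookup m (a, j)))"

definition fine_tau :: "int \<Rightarrow> int set set \<Rightarrow> indet_poly" where
  "fine_tau d K =
     (\<Sum>U\<in>spanning_trees d K.
        of_nat (Coset.order (reduced_homology (d - 1) U)) ^ 2 * (\<Prod>F\<in>faces d U. X_mon (mset_set F)))"

definition z_frac :: "int multiset \<Rightarrow> int multiset \<Rightarrow> indet_poly fract" where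
  "z_frac S T = (\<Sum>j\<in>#T. to_fract (X_mon (S + {#j#}))) / to_fract (raising (X_mon S))"


section \<open>Critical pairs and long signatures\<close>

definition least_vertex :: "int set set \<Rightarrow> int" where
  "least_vertex \<F> = Min (\<Union>\<F>)"

definition critical_pairs :: "int set set \<Rightarrow> (int set \<times> int set) set" where
  "critical_pairs \<F> =
     {(A, B). A \<in> \<F> \<and> B \<notin> \<F> \<and> (\<exists>a\<in>A. B = insert (a + 1) (A - {a}) \<and> card B = card A)}"

text \<open>In a critical pair \<open>(A, B)\<close> the replaced element is the only element of \<open>A - B\<close>.\<close>

definition long_signature :: "int set set \<Rightarrow> int set \<times> int set \<Rightarrow> int set \<times> int set" where
  "long_signature \<F> = (\<lambda>(A, B).
     let a = the_elem (A - B) in ({x \<in> A. x < a}, {least_vertex \<F>..a}))"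

definition LSG :: "int set set \<Rightarrow> (int set \<times> int set) multiset" where
  "LSG \<F> = image_mset (long_signature \<F>) (mset_set (critical_pairs \<F>))"

end

theory Submission
  imports Defs "Jordan_Normal_Form.Determinant"
begin

text \<open>Let \<open>\<Delta>\<close> be the deletion of \<open>p\<close>.  The hypothesis on \<open>betti (d - 1)\<close> says that every
  \<open>(d - 1)\<close>-face of \<open>\<Delta>\<close> can be coned off by \<open>p\<close>, so a \<open>(d - 1)\<close>-cycle is determined by its
  coordinates at these faces, and these coordinates are arbitrary.  Hence the square submatrix
  of the incidence matrix (rows: \<open>(d - 1)\<close>-faces of \<open>\<Delta>\<close>; columns: a set \<open>U\<close> of \<open>d\<close>-faces) has
  determinant \<open>\<plusminus>|H_(d-1)(U)|\<close>, or \<open>0\<close> if \<open>U\<close> is not a tree, and Cauchy-Binet turns the tree sum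
  into the determinant of a weighted Laplacian.

  This determinant is computed by adding the \<open>d\<close>-faces of \<open>\<Delta>\<close> to the cone one at a time, along
  a linear extension of the componentwise order.  Adding \<open>F = {a_1 < ... < a_k}\<close> is a rank one update.
  With \<open>a_0 = p\<close> there are functions \<open>\<alpha>_i\<close> supported on \<open>[a_(i-1), a_i]\<close> such that the cochain
  \<open>\<alpha>_1 \<and> ... \<and> \<alpha>_k\<close> has zero coboundary on \<open>p \<union> G\<close> for all earlier \<open>G\<close>, while its weighted
  version is a cycle; this inverts the Laplacian on the column of \<open>F\<close>.  The determinant grows by the factor
  \<open>\<Prod>_i N_i(a_i) / N_i(a_i - 1)\<close>, where \<open>N_i(m)\<close> is the sum of \<open>X_({a_1, ..., a_(i-1)} \<union> j)\<close> over \<open>p \<le> j \<le> m\<close>.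
  In the product over all \<open>F\<close> everything telescopes except for the critical pairs.\<close>

section \<open>Determinants and indices of lattices\<close>

text \<open>The Laplacian is never inverted as a matrix. It is \<open>D W D^T\<close>, with
  \<open>D\<close> the incidence matrix and \<open>W\<close> the diagonal matrix of weights, so the
  rank one update only needs a vector \<open>u\<close> for which \<open>D W D^T u\<close> is a
  multiple of the new column. For \<open>u\<close> take the values of the cochain \<phi> at the
  faces \<open>p \<union> H\<close>. The cocycle property says that \<open>D^T u\<close> equals
  \<phi> on the faces present, and the cycle property, whose sum includes the new face
  \<open>F\<close>, says that \<open>D W \<phi>\<close> over the faces present is minus the term of
  \<open>F\<close>. Both properties hold at once because \<phi> is given by determinants whose rows
  have supports meeting only at endpoints: only the diagonal survives, and weights that depend on
  the position of a vertex can be moved into the rows. The support of \<phi> consists of sets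
  componentwise below \<open>F\<close>; the order of insertion ensures that all of them are present.
  The denominators \<open>X_(p \<union> S)\<close> cancel in each factor and are introduced for the
  telescoping: without them the prefix sums at vertices \<open>v\<close> and \<open>v + 1\<close> of
  the same face do not match.\<close>

abbreviation detf :: "nat \<Rightarrow> (nat \<Rightarrow> nat \<Rightarrow> 'a) \<Rightarrow> 'a::comm_ring_1" where
  "detf n M \<equiv> det (mat n n (\<lambda>(i, j). M i j))"

lemma detf_def: "detf n M = (\<Sum>p | p permutes {0..<n}. signof p * (\<Prod>i = 0..<n. M i (p i)))"
  unfolding det_def dim_row_mat dim_col_mat by (auto intro!: sum.cong prod.cong)

lemma detf_cong:
  "(\<And>i j. i < n \<Longrightarrow> j < n \<Longrightarrow> M i j = N i j) \<Longrightarrow> detf n M = detf n N"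
  by (intro arg_cong[of _ _ det] eq_matI) auto

lemma detf_transpose: "detf n (\<lambda>i j. M j i) = detf n M"
proof -
  have "(mat n n (\<lambda>(i, j). M i j))\<^sup>T = mat n n (\<lambda>(i, j). M j i)"
    by (intro eq_matI) auto
  then show ?thesis
    using det_transpose[of "mat n n (\<lambda>(i, j). M i j)" n] by simp
qed

lemma detf_permute_rows:
  assumes p: "p permutes {0..<n}"
  shows "detf n (\<lambda>i j. M (p i) j) = signof p * detf n M"
proof -
  have "mat n n (\<lambda>(i, j). M (p i) j) = mat n n (\<lambda>(i, j). mat n n (\<lambda>(i, j). M i j) $$ (p i, j))"
    using permutes_in_image[OF p] by (intro eq_matI) auto
  then show ?thesis
    using det_permute_rows[of "mat n n (\<lambda>(i, j). M i j)" n p] p by simp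
qed

lemma detf_identical_rows:
  assumes "i \<noteq> j" "i < n" "j < n" "\<And>l. l < n \<Longrightarrow> M i l = M j l"
  shows "detf n M = 0"
  by (rule det_identical_rows[OF _ assms(1-3)]) (use assms in \<open>auto intro!: eq_vecI\<close>)

lemma detf_mult:
  "detf n (\<lambda>i j. \<Sum>k<n. A i k * B k j) = detf n A * detf n B"
proof -
  have "mat n n (\<lambda>(i, j). \<Sum>k<n. A i k * B k j) = mat n n (\<lambda>(i, j). A i j) * mat n n (\<lambda>(i, j). B i j)"
    by (intro eq_matI) (auto simp: scalar_prod_def lessThan_atLeast0)
  then show ?thesis
    by (simp add: det_mult[of _ n])
qed

text \<open>Multilinearity expands the left side over all functions \<open>f\<close> from the row
  indices to \<open>J\<close>. A function that is not injective repeats a row of \<open>B\<close>.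
  The injective ones are grouped by their image \<open>U\<close>, where they are the permutations of
  the fixed enumeration \<open>e U\<close>, and the signs reassemble the determinant of
  \<open>A\<close>.\<close>

theorem cauchy_binet:
  fixes A :: "nat \<Rightarrow> 'b \<Rightarrow> 'a::comm_ring_1"
  assumes J: "finite J"
    and e: "\<And>U. U \<subseteq> J \<Longrightarrow> card U = n \<Longrightarrow> bij_betw (e U) {0..<n} U"
  shows "detf n (\<lambda>i j. \<Sum>f\<in>J. A i f * B f j) =
    (\<Sum>U | U \<subseteq> J \<and> card U = n. detf n (\<lambda>i j. A i (e U j)) * detf n (\<lambda>i j. B (e U i) j))"
proof -
  let ?I = "{0..<n}" and ?F = "{0..<n} \<rightarrow>\<^sub>E J"
  let ?g = "\<lambda>f. (\<Prod>i\<in>?I. A i (f i)) * detf n (\<lambda>i j. B (f i) j)"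
  let ?Us = "{U. U \<subseteq> J \<and> card U = n}"
  have finF: "finite ?F" using J by (simp add: finite_PiE)
  have finU: "finite ?Us" using J by simp
  have "detf n (\<lambda>i j. \<Sum>f\<in>J. A i f * B f j) =
      (\<Sum>p | p permutes ?I. signof p * (\<Sum>f\<in>?F. \<Prod>i\<in>?I. A i (f i) * B (f i) (p i)))"
    unfolding detf_def by (simp add: prod_sum_PiE J)
  also have "\<dots> = (\<Sum>p | p permutes ?I. \<Sum>f\<in>?F. (\<Prod>i\<in>?I. A i (f i)) * (signof p * (\<Prod>i\<in>?I. B (f i) (p i))))"
    by (simp add: sum_distrib_left prod.distrib mult_ac)
  also have "\<dots> = (\<Sum>f\<in>?F. ?g f)"
    unfolding detf_def sum_distrib_left by (rule sum.swap)
  also have "\<dots> = (\<Sum>f\<in>{f \<in> ?F. inj_on f ?I}. ?g f)"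
  proof (rule sum.mono_neutral_right[OF finF])
    show "\<forall>f\<in>?F - {f \<in> ?F. inj_on f ?I}. ?g f = 0"
    proof
      fix f assume "f \<in> ?F - {f \<in> ?F. inj_on f ?I}"
      then obtain i j where "i \<noteq> j" "i < n" "j < n" "f i = f j"
        by (auto simp: inj_on_def)
      then show "?g f = 0"
        using detf_identical_rows[of i j n "\<lambda>i. B (f i)"] by simp
    qed
  qed auto
  also have "\<dots> = (\<Sum>U\<in>?Us. \<Sum>f | f \<in> {f \<in> ?F. inj_on f ?I} \<and> f ` ?I = U. ?g f)"
    by (rule sum.group[symmetric]) (use finF finU in \<open>auto simp: card_image\<close>)
  also have "\<dots> = (\<Sum>U\<in>?Us. detf n (\<lambda>i j. A i (e U j)) * detf n (\<lambda>i j. B (e U i) j))"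
  proof (rule sum.cong[OF refl])
    fix U assume "U \<in> ?Us"
    then have U: "U \<subseteq> J" and bij: "bij_betw (e U) ?I U" using e by auto
    let ?P = "{p. p permutes ?I}"
    let ?h = "\<lambda>p. restrict (e U \<circ> p) ?I"
    have "bij_betw ?h ?P {f \<in> {f \<in> ?F. inj_on f ?I}. f ` ?I = U}"
      unfolding bij_betw_def
    proof
      show "inj_on ?h ?P"
      proof (rule inj_onI)
        fix p q assume pq: "p \<in> ?P" "q \<in> ?P" and eq: "?h p = ?h q"
        show "p = q"
        proof
          fix i
          show "p i = q i"
          proof (cases "i \<in> ?I")
            case True
            then have "e U (p i) = e U (q i)" using fun_cong[OF eq, of i] by simp
            moreover have "p i \<in> ?I" "q i \<in> ?I"
              using pq permutes_in_image[of p ?I i] permutes_in_image[of q ?I i] True by auto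
            ultimately show ?thesis using bij by (auto simp: bij_betw_def inj_on_def)
          next
            case False
            then show ?thesis using pq by (metis mem_Collect_eq permutes_not_in)
          qed
        qed
      qed
      show "?h ` ?P = {f \<in> {f \<in> ?F. inj_on f ?I}. f ` ?I = U}"
      proof (intro equalityI subsetI)
        fix f assume "f \<in> ?h ` ?P"
        then obtain p where p: "p permutes ?I" and f: "f = ?h p" by auto
        have "bij_betw (e U \<circ> p) ?I U"
          using bij_betw_trans[OF permutes_imp_bij[OF p] bij] .
        then have "bij_betw f ?I U"
          unfolding f by (subst bij_betw_cong[of _ _ "e U \<circ> p"]) auto
        then show "f \<in> {f \<in> {f \<in> ?F. inj_on f ?I}. f ` ?I = U}"
          using U f by (auto simp: bij_betw_def)
      next
        fix f assume "f \<in> {f \<in> {f \<in> ?F. inj_on f ?I}. f ` ?I = U}"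
        then have f: "bij_betw f ?I U" and ext: "f \<in> extensional ?I"
          by (auto simp: bij_betw_def PiE_def)
        define q where "q i = (if i \<in> ?I then the_inv_into ?I (e U) (f i) else i)" for i
        have "bij_betw (the_inv_into ?I (e U) \<circ> f) ?I ?I"
          using bij_betw_trans[OF f bij_betw_the_inv_into[OF bij]] .
        then have "bij_betw q ?I ?I"
          by (subst bij_betw_cong[of _ _ "the_inv_into ?I (e U) \<circ> f"]) (auto simp: q_def)
        then have "q permutes ?I"
          by (rule bij_imp_permutes) (simp add: q_def)
        moreover have "f = ?h q"
        proof
          fix i
          show "f i = ?h q i"
            using ext bij f by (auto simp: q_def extensional_def bij_betw_def f_the_inv_into_f)
        qed
        ultimately show "f \<in> ?h ` ?P" by blast
      qed
    qed
    then have "(\<Sum>f | f \<in> {f \<in> ?F. inj_on f ?I} \<and> f ` ?I = U. ?g f) = (\<Sum>p\<in>?P. ?g (?h p))"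
      by (simp add: sum.reindex_bij_betw[of ?h ?P _ ?g, symmetric])
    also have "\<dots> = (\<Sum>p\<in>?P. signof p * (\<Prod>i\<in>?I. A i (e U (p i))) * detf n (\<lambda>i j. B (e U i) j))"
    proof (rule sum.cong[OF refl])
      fix p assume "p \<in> ?P"
      then have p: "p permutes ?I" by simp
      have "detf n (\<lambda>i j. B (?h p i) j) = detf n (\<lambda>i j. B (e U (p i)) j)"
        by (rule detf_cong) simp
      also have "\<dots> = signof p * detf n (\<lambda>i j. B (e U i) j)"
        using detf_permute_rows[OF p, of "\<lambda>i. B (e U i)"] .
      finally show "?g (?h p) = signof p * (\<Prod>i\<in>?I. A i (e U (p i))) * detf n (\<lambda>i j. B (e U i) j)"
        by simp
    qed
    also have "\<dots> = detf n (\<lambda>i j. A i (e U j)) * detf n (\<lambda>i j. B (e U i) j)"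
      by (simp add: detf_def[of n "\<lambda>i j. A i (e U j)"] sum_distrib_right)
    finally show "(\<Sum>f | f \<in> {f \<in> ?F. inj_on f ?I} \<and> f ` ?I = U. ?g f) =
      detf n (\<lambda>i j. A i (e U j)) * detf n (\<lambda>i j. B (e U i) j)" .
  qed
  finally show ?thesis .
qed

lemma det_one_plus_rank_one:
  fixes u v :: "nat \<Rightarrow> 'a::idom"
  shows "detf n (\<lambda>i j. (if i = j then 1 else 0) + u i * v j) = 1 + (\<Sum>i<n. v i * u i)"
proof -
  define U where "U = mat n 1 (\<lambda>(i, j). u i)"
  define V where "V = mat 1 n (\<lambda>(i, j). v j)"
  have U: "U \<in> carrier_mat n 1" and V: "V \<in> carrier_mat 1 n" by (auto simp: U_def V_def)
  let ?A = "mat n n (\<lambda>(i, j). (if i = j then 1 else 0) + u i * v j)"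
  have A: "?A = 1\<^sub>m n + U * V"
    by (intro eq_matI) (auto simp: U_def V_def scalar_prod_def)
  \<comment> \<open>Multiplying \<open>?M\<close> by unitriangular block matrices on both sides
    gives \<open>?N\<close>; comparing the two determinants stays within the ring.\<close>
  let ?L = "four_block_mat (1\<^sub>m n) (0\<^sub>m n 1) V (1\<^sub>m 1)"
  let ?M = "four_block_mat ?A U (0\<^sub>m 1 n) (1\<^sub>m 1)"
  let ?R = "four_block_mat (1\<^sub>m n) (0\<^sub>m n 1) (- V) (1\<^sub>m 1)"
  let ?N = "four_block_mat (1\<^sub>m n) U (0\<^sub>m 1 n) (1\<^sub>m 1 + V * U)"
  have LM: "?L * ?M = four_block_mat ?A U (V * ?A) (V * U + 1\<^sub>m 1)"
    using U V by (subst mult_four_block_mat[of _ n n _ 1 _ 1 _ _ n _ 1]) auto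
  have VA: "V * ?A = V + V * U * V"
    unfolding A using U V by (subst mult_add_distrib_mat[of _ 1 n _ n]) (auto simp: assoc_mult_mat[of _ 1 n _ 1 _ n])
  have "?L * ?M * ?R = four_block_mat (?A * 1\<^sub>m n + U * (- V)) (?A * 0\<^sub>m n 1 + U * 1\<^sub>m 1)
    (V * ?A * 1\<^sub>m n + (V * U + 1\<^sub>m 1) * (- V)) (V * ?A * 0\<^sub>m n 1 + (V * U + 1\<^sub>m 1) * 1\<^sub>m 1)"
    unfolding LM using U V by (subst mult_four_block_mat[of _ n n _ 1 _ 1 _ _ n _ 1]) auto
  also have "\<dots> = ?N"
  proof (rule arg_cong4[where f = four_block_mat])
    show "?A * 1\<^sub>m n + U * (- V) = 1\<^sub>m n"
      unfolding A using U V by (intro eq_matI) auto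
    show "?A * 0\<^sub>m n 1 + U * 1\<^sub>m 1 = U"
      using U right_mult_zero_mat[of ?A n n 1] by simp
    show "V * ?A * 1\<^sub>m n + (V * U + 1\<^sub>m 1) * (- V) = 0\<^sub>m 1 n"
      unfolding VA using U V by (subst add_mult_distrib_mat[of _ 1 1 _ _ n]) (auto intro!: eq_matI)
    show "V * ?A * 0\<^sub>m n 1 + (V * U + 1\<^sub>m 1) * 1\<^sub>m 1 = 1\<^sub>m 1 + V * U"
      using U V right_mult_zero_mat[of "V * ?A" 1 n 1] by (simp add: comm_add_mat[of _ 1 1])
  qed
  finally have prod: "?L * ?M * ?R = ?N" .
  have "det ?L = 1" "det ?R = 1"
    using V by (auto simp: det_four_block_mat_upper_right_zero[of _ n _ 1])
  moreover have "det ?M = det ?A"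
    using U by (simp add: det_four_block_mat_lower_left_zero[of _ n _ 1])
  moreover have "det ?N = 1 + (\<Sum>i<n. v i * u i)"
    using U V by (simp add: det_four_block_mat_lower_left_zero[of _ n _ 1] det_single)
      (auto simp: U_def V_def scalar_prod_def lessThan_atLeast0)
  moreover have "det (?L * ?M * ?R) = det ?L * det ?M * det ?R"
  proof -
    have L: "?L \<in> carrier_mat (n + 1) (n + 1)" and M: "?M \<in> carrier_mat (n + 1) (n + 1)"
      and R: "?R \<in> carrier_mat (n + 1) (n + 1)"
      by (rule four_block_carrier_mat; simp)+
    show ?thesis
      unfolding det_mult[OF mult_carrier_mat[OF L M] R] det_mult[OF L M] ..
  qed
  ultimately show ?thesis using prod by simp
qed

text \<open>Since \<open>A u = - c b\<close>, the updated matrix factors as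
  \<open>A (1 - (x / c) u v^T)\<close>. The factorisation holds for singular \<open>A\<close> as
  well.\<close>

lemma detf_rank_one_update:
  fixes A :: "nat \<Rightarrow> nat \<Rightarrow> 'a::field"
  assumes Au: "\<And>i. i < n \<Longrightarrow> (\<Sum>j<n. A i j * u j) = - c * b i" and c: "c \<noteq> 0"
  shows "detf n (\<lambda>i j. A i j + x * b i * v j) = detf n A * (1 - x / c * (\<Sum>j<n. v j * u j))"
proof -
  have "detf n (\<lambda>i j. A i j + x * b i * v j) =
      detf n (\<lambda>i j. \<Sum>k<n. A i k * ((if k = j then 1 else 0) + (- x / c * u k) * v j))"
  proof (rule detf_cong)
    fix i j assume i: "i < n" and j: "j < n"
    have "(\<Sum>k<n. A i k * ((if k = j then 1 else 0) + (- x / c * u k) * v j)) =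
        (\<Sum>k<n. A i k * (if k = j then 1 else 0)) + (- x / c * v j) * (\<Sum>k<n. A i k * u k)"
      by (simp add: algebra_simps sum.distrib sum_distrib_left sum_subtractf sum_divide_distrib sum_negf)
    also have "\<dots> = A i j + x * b i * v j"
      using c i j by (simp add: Au if_distrib[of "\<lambda>y. A i _ * y"] cong: if_cong)
    finally show "A i j + x * b i * v j = (\<Sum>k<n. A i k * ((if k = j then 1 else 0) + (- x / c * u k) * v j))"
      by simp
  qed
  also have "\<dots> = detf n A * (1 + (\<Sum>k<n. v k * (- x / c * u k)))"
    unfolding detf_mult by (subst det_one_plus_rank_one) simp
  also have "(\<Sum>k<n. v k * (- x / c * u k)) = - (x / c * (\<Sum>j<n. v j * u j))"
    by (simp add: sum_distrib_left sum_negf mult_ac)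
  finally show ?thesis by simp
qed

text \<open>Representatives of \<open>\<int>\<^sup>n\<close> modulo the column lattice of \<open>M\<close>; values at indices \<open>\<ge> n\<close> are irrelevant.\<close>

definition transversal :: "nat \<Rightarrow> (nat \<Rightarrow> nat \<Rightarrow> int) \<Rightarrow> (nat \<Rightarrow> int) set \<Rightarrow> bool" where
  "transversal n M R \<longleftrightarrow> (\<forall>v. \<exists>!r. r \<in> R \<and> (\<exists>t. \<forall>i<n. v i - r i = (\<Sum>j<n. M i j * t j)))"

lemma detf_addcol:
  assumes "l < n" "k < n" "k \<noteq> l"
  shows "detf n (\<lambda>i j. if j = k then M i j + a * M i l else M i j) = detf n M"
proof -
  have "mat n n (\<lambda>(i, j). if j = k then M i j + a * M i l else M i j) =
      addcol a k l (mat n n (\<lambda>(i, j). M i j))"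
    using assms by (intro eq_matI) (auto simp: mat_addcol_def)
  then show ?thesis using assms by simp
qed

text \<open>A column operation only changes coordinates: the new matrix at \<open>t\<close> equals
  \<open>M\<close> at \<open>t\<close> with \<open>t l + a * t k\<close> in place of
  \<open>t l\<close>, and this substitution is a bijection of integer vectors. So the column lattice
  stays the same.\<close>

lemma transversal_addcol:
  assumes "l < n" "k < n" "k \<noteq> l"
    and R: "transversal n (\<lambda>i j. if j = k then M i j + a * M i l else M i j) R"
  shows "transversal n M R"
proof -
  let ?M = "\<lambda>i j. if j = k then M i j + a * M i l else M i j"
  have shift: "(\<Sum>j<n. ?M i j * t j) = (\<Sum>j<n. M i j * (t(l := t l + a * t k)) j)" for i t
  proof -
    have "(\<Sum>j<n. ?M i j * t j) = (\<Sum>j<n. M i j * t j + (if j = k then a * M i l * t k else 0))"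
      by (rule sum.cong) (auto simp: algebra_simps)
    also have "\<dots> = (\<Sum>j<n. M i j * t j + (if j = l then M i l * (a * t k) else 0))"
      using assms by (simp add: sum.distrib)
    also have "\<dots> = (\<Sum>j<n. M i j * (t(l := t l + a * t k)) j)"
      by (rule sum.cong) (auto simp: algebra_simps)
    finally show ?thesis .
  qed
  have "(\<exists>t. \<forall>i<n. w i = (\<Sum>j<n. ?M i j * t j)) \<longleftrightarrow> (\<exists>t. \<forall>i<n. w i = (\<Sum>j<n. M i j * t j))" for w
  proof
    assume "\<exists>t. \<forall>i<n. w i = (\<Sum>j<n. ?M i j * t j)"
    then show "\<exists>t. \<forall>i<n. w i = (\<Sum>j<n. M i j * t j)" unfolding shift by blast
  next
    assume "\<exists>t. \<forall>i<n. w i = (\<Sum>j<n. M i j * t j)"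
    then obtain t where t: "\<forall>i<n. w i = (\<Sum>j<n. M i j * t j)" ..
    have "(t(l := t l - a * t k))(l := (t(l := t l - a * t k)) l + a * (t(l := t l - a * t k)) k) = t"
      using assms by auto
    then show "\<exists>t. \<forall>i<n. w i = (\<Sum>j<n. ?M i j * t j)"
      unfolding shift using t by (intro exI[of _ "t(l := t l - a * t k)"]) (simp only:)
  qed
  then show ?thesis
    using R[unfolded transversal_def] unfolding transversal_def by simp
qed

lemma det_first_row_single:
  assumes k: "k < Suc n" and zero: "\<And>j. j < Suc n \<Longrightarrow> j \<noteq> k \<Longrightarrow> M 0 j = 0"
  shows "detf (Suc n) M = M 0 k * ((- 1) ^ k * detf n (\<lambda>i j. M (Suc i) (insert_index k j)))"
proof -
  let ?M = "mat (Suc n) (Suc n) (\<lambda>(i, j). M i j)"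
  have "detf (Suc n) M = (\<Sum>j<Suc n. ?M $$ (0, j) * cofactor ?M 0 j)"
    by (rule laplace_expansion_row) auto
  also have "\<dots> = ?M $$ (0, k) * cofactor ?M 0 k"
    using k zero by (subst sum.remove[of _ k]) (auto intro!: sum.neutral)
  also have "mat_delete ?M 0 k = mat n n (\<lambda>(i, j). M (Suc i) (insert_index k j))"
    unfolding mat_delete_def insert_index_def by (intro eq_matI) auto
  then have "cofactor ?M 0 k = (- 1) ^ k * detf n (\<lambda>i j. M (Suc i) (insert_index k j))"
    by (simp add: cofactor_def)
  finally show ?thesis using k by simp
qed

lemma sum_insert_index:
  assumes "k < Suc n"
  shows "(\<Sum>j<Suc n. f j) = f k + (\<Sum>j<n. f (insert_index k j))"
proof -
  have "(\<Sum>j\<in>{..<Suc n} - {k}. f j) = (\<Sum>j\<in>insert_index k ` {0..<n}. f j)"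
    using insert_index_image[OF assms] by (simp add: lessThan_atLeast0)
  also have "\<dots> = (\<Sum>j<n. f (insert_index k j))"
    by (subst sum.reindex) (auto simp: insert_index_inj_on lessThan_atLeast0)
  finally show ?thesis using assms by (subst sum.remove[of _ k]) auto
qed

text \<open>A vector lies in the column lattice iff its first entry is \<open>M 0 k * a\<close> for
  some \<open>a\<close> and the rest minus \<open>a\<close> times column \<open>k\<close> lies in
  the lattice of the minor. So a representative is a residue modulo \<open>\<bar>M 0 k\<bar>\<close>
  followed by a member of \<open>R\<close>.\<close>

lemma transversal_first_row_single:
  fixes M :: "nat \<Rightarrow> nat \<Rightarrow> int"
  assumes k: "k < Suc n" and zero: "\<And>j. j < Suc n \<Longrightarrow> j \<noteq> k \<Longrightarrow> M 0 j = 0" and g: "M 0 k \<noteq> 0"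
    and R: "transversal n (\<lambda>i j. M (Suc i) (insert_index k j)) R" "finite R"
  shows "\<exists>R'. finite R' \<and> card R' = nat \<bar>M 0 k\<bar> * card R \<and> transversal (Suc n) M R'"
proof -
  define N where "N i j = M (Suc i) (insert_index k j)" for i j
  define f where "f = (\<lambda>(s::int, r::nat \<Rightarrow> int). case_nat s r)"
  define R' where "R' = f ` ({0..<\<bar>M 0 k\<bar>} \<times> R)"
  have inj: "inj f"
  proof (rule injI)
    fix x y assume eq: "f x = f y"
    have "fst x = fst y" using fun_cong[OF eq, of 0] by (simp add: f_def split: prod.splits)
    moreover have "snd x = snd y"
    proof
      fix i show "snd x i = snd y i"
        using fun_cong[OF eq, of "Suc i"] by (simp add: f_def split: prod.splits)
    qed
    ultimately show "x = y" by (simp add: prod_eq_iff)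
  qed
  have "finite R'" using R by (simp add: R'_def)
  moreover have "card R' = nat \<bar>M 0 k\<bar> * card R"
    unfolding R'_def by (simp add: card_image inj_on_subset[OF inj] card_cartesian_product)
  moreover have "transversal (Suc n) M R'"
    unfolding transversal_def
  proof
    fix v :: "nat \<Rightarrow> int"
    let ?in = "\<lambda>n M w. \<exists>t. \<forall>i<n. w i = (\<Sum>j<n. M i j * t j :: int)"
    have split: "(\<forall>i<Suc n. w i = (\<Sum>j<Suc n. M i j * t j)) \<longleftrightarrow>
      w 0 = M 0 k * t k \<and> (\<forall>i<n. w (Suc i) - M (Suc i) k * t k = (\<Sum>j<n. N i j * t (insert_index k j)))" for w t
    proof -
      have "(\<Sum>j<Suc n. M 0 j * t j) = M 0 k * t k"
        using k zero by (subst sum.remove[of _ k]) (auto intro!: sum.neutral)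
      moreover have "w (Suc i) = (\<Sum>j<Suc n. M (Suc i) j * t j) \<longleftrightarrow>
          w (Suc i) - M (Suc i) k * t k = (\<Sum>j<n. N i j * t (insert_index k j))" for i
        unfolding N_def sum_insert_index[OF k, of "\<lambda>j. M (Suc i) j * t j"] by linarith
      ultimately show ?thesis
        unfolding All_less_Suc2 by (simp only:)
    qed
    have mem: "?in (Suc n) M w \<longleftrightarrow> (\<exists>a. w 0 = M 0 k * a \<and> ?in n N (\<lambda>i. w (Suc i) - M (Suc i) k * a))" for w
    proof
      assume "?in (Suc n) M w"
      then obtain t where "\<forall>i<Suc n. w i = (\<Sum>j<Suc n. M i j * t j)" ..
      then have "w 0 = M 0 k * t k"
        "\<forall>i<n. w (Suc i) - M (Suc i) k * t k = (\<Sum>j<n. N i j * t (insert_index k j))"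
        using split by blast+
      then show "\<exists>a. w 0 = M 0 k * a \<and> ?in n N (\<lambda>i. w (Suc i) - M (Suc i) k * a)"
        by (intro exI[of _ "t k"] conjI exI[of _ "\<lambda>j. t (insert_index k j)"]) auto
    next
      assume "\<exists>a. w 0 = M 0 k * a \<and> ?in n N (\<lambda>i. w (Suc i) - M (Suc i) k * a)"
      then obtain a t where a: "w 0 = M 0 k * a"
        and t: "\<forall>i<n. w (Suc i) - M (Suc i) k * a = (\<Sum>j<n. N i j * t j)" by blast
      define t' where "t' j = (if j = k then a else t (delete_index k j))" for j
      have "t' k = a" "\<And>j. t' (insert_index k j) = t j"
        by (auto simp: t'_def insert_index_def delete_index_def)
      then have "\<forall>i<Suc n. w i = (\<Sum>j<Suc n. M i j * t' j)"
        using split[of w t'] a t by simp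
      then show "?in (Suc n) M w" by (intro exI[of _ t'])
    qed
    \<comment> \<open>The residue is taken modulo the absolute value, to lie in the range of
      \<open>s\<close>; the division is by \<open>M 0 k\<close> with its sign, since
      \<open>q\<close> is the coefficient of column \<open>k\<close>.\<close>
    define q where "q = (v 0 - v 0 mod \<bar>M 0 k\<bar>) div M 0 k"
    have "M 0 k dvd v 0 - v 0 mod \<bar>M 0 k\<bar>"
      using dvd_minus_mod[of "\<bar>M 0 k\<bar>" "v 0"] by (simp only: abs_dvd_iff)
    then have q: "v 0 - v 0 mod \<bar>M 0 k\<bar> = M 0 k * q" by (simp add: q_def)
    have ex: "\<exists>!r. r \<in> R \<and> ?in n N (\<lambda>i. v (Suc i) - M (Suc i) k * q - r i)"
      using R(1)[unfolded transversal_def, rule_format, of "\<lambda>i. v (Suc i) - M (Suc i) k * q"]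
      by (simp add: N_def)
    have key: "?in (Suc n) M (\<lambda>i. v i - f (s, r) i) \<longleftrightarrow>
      s = v 0 mod \<bar>M 0 k\<bar> \<and> ?in n N (\<lambda>i. v (Suc i) - M (Suc i) k * q - r i)"
      if "s \<in> {0..<\<bar>M 0 k\<bar>}" for s r
    proof
      assume "?in (Suc n) M (\<lambda>i. v i - f (s, r) i)"
      then obtain a where a: "v 0 - s = M 0 k * a"
        and inn: "?in n N (\<lambda>i. v (Suc i) - r i - M (Suc i) k * a)"
        unfolding mem by (auto simp: f_def)
      have "\<bar>M 0 k\<bar> dvd v 0 - s" using a by simp
      then have "s = v 0 mod \<bar>M 0 k\<bar>"
        using that by (metis atLeastLessThan_iff mod_eq_dvd_iff mod_pos_pos_trivial)
      moreover from this have "M 0 k * a = M 0 k * q" using a q by argo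
      then have "a = q" using g by simp
      ultimately show "s = v 0 mod \<bar>M 0 k\<bar> \<and> ?in n N (\<lambda>i. v (Suc i) - M (Suc i) k * q - r i)"
        using inn by (simp only: cancel_ab_semigroup_add_class.diff_right_commute[of _ "r _"])
    next
      assume "s = v 0 mod \<bar>M 0 k\<bar> \<and> ?in n N (\<lambda>i. v (Suc i) - M (Suc i) k * q - r i)"
      then show "?in (Suc n) M (\<lambda>i. v i - f (s, r) i)"
        unfolding mem using q
        by (intro exI[of _ q]) (simp only: f_def prod.case nat.case cancel_ab_semigroup_add_class.diff_right_commute[of _ "r _"])
    qed
    obtain r where r: "r \<in> R" "?in n N (\<lambda>i. v (Suc i) - M (Suc i) k * q - r i)"
      and uniq: "\<And>r'. r' \<in> R \<Longrightarrow> ?in n N (\<lambda>i. v (Suc i) - M (Suc i) k * q - r' i) \<Longrightarrow> r' = r"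
      using ex by blast
    show "\<exists>!r'. r' \<in> R' \<and> ?in (Suc n) M (\<lambda>i. v i - r' i)"
    proof (rule ex1I[of _ "f (v 0 mod \<bar>M 0 k\<bar>, r)"])
      show "f (v 0 mod \<bar>M 0 k\<bar>, r) \<in> R' \<and> ?in (Suc n) M (\<lambda>i. v i - f (v 0 mod \<bar>M 0 k\<bar>, r) i)"
        using r g key[of "v 0 mod \<bar>M 0 k\<bar>" r] by (auto simp: R'_def)
    next
      fix r' assume r': "r' \<in> R' \<and> ?in (Suc n) M (\<lambda>i. v i - r' i)"
      then obtain s r0 where "r' = f (s, r0)" "s \<in> {0..<\<bar>M 0 k\<bar>}" "r0 \<in> R"
        by (auto simp: R'_def)
      then show "r' = f (v 0 mod \<bar>M 0 k\<bar>, r)"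
        using r' key[of s r0] uniq[of r0] by auto
    qed
  qed
  ultimately show ?thesis by blast
qed

text \<open>Column operations run the Euclidean algorithm on the first row until it has a single nonzero entry.\<close>

theorem ex_transversal:
  fixes M :: "nat \<Rightarrow> nat \<Rightarrow> int"
  assumes "detf n M \<noteq> 0"
  shows "\<exists>R. finite R \<and> int (card R) = \<bar>detf n M\<bar> \<and> transversal n M R"
  using assms
proof (induction n arbitrary: M)
  case 0
  have "transversal 0 M {\<lambda>_. 0}" by (auto simp: transversal_def)
  then show ?case by (intro exI[of _ "{\<lambda>_. 0}"]) simp
next
  case (Suc n)
  note outer = Suc.IH
  from Suc.prems show ?case
  proof (induction "\<Sum>j<Suc n. nat \<bar>M 0 j\<bar>" arbitrary: M rule: less_induct)
    case less
    show ?case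
    proof (cases "\<exists>k l. k < Suc n \<and> l < Suc n \<and> k \<noteq> l \<and> M 0 k \<noteq> 0 \<and> M 0 l \<noteq> 0")
      case True
      then obtain k l where kl: "k < Suc n" "l < Suc n" "k \<noteq> l" "M 0 k \<noteq> 0" "M 0 l \<noteq> 0"
        and le: "\<bar>M 0 l\<bar> \<le> \<bar>M 0 k\<bar>"
        by (metis linear)
      \<comment> \<open>One subtraction or addition, according to the signs, instead of a division
        with remainder. As the other entry is nonzero and no larger in absolute value, this already
        lowers the sum of absolute values in the first row.\<close>
      define a where "a = - sgn (M 0 k * M 0 l)"
      let ?M = "\<lambda>i j. if j = k then M i j + a * M i l else M i j"
      have "\<bar>M 0 k + a * M 0 l\<bar> < \<bar>M 0 k\<bar>"
        using kl le by (auto simp: a_def sgn_if mult_less_0_iff zero_less_mult_iff split: if_splits)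
      then have "(\<Sum>j<Suc n. nat \<bar>?M 0 j\<bar>) < (\<Sum>j<Suc n. nat \<bar>M 0 j\<bar>)"
        using kl by (intro sum_strict_mono_ex1) auto
      moreover have "detf (Suc n) ?M = detf (Suc n) M"
        using kl by (intro detf_addcol) auto
      ultimately obtain R where "finite R" "int (card R) = \<bar>detf (Suc n) M\<bar>" "transversal (Suc n) ?M R"
        using less.hyps[of ?M] less.prems by auto
      then show ?thesis using transversal_addcol[of l "Suc n" k M a R] kl by blast
    next
      case False
      have "\<exists>k<Suc n. M 0 k \<noteq> 0"
      proof (rule ccontr)
        assume "\<not> ?thesis"
        then have "detf (Suc n) M = 0"
          using det_first_row_single[of 0 n M] by simp
        then show False using less.prems by simp
      qed
      then obtain k where k: "k < Suc n" "M 0 k \<noteq> 0" by blast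
      have zero: "M 0 j = 0" if "j < Suc n" "j \<noteq> k" for j
        using False k that by blast
      let ?N = "\<lambda>i j. M (Suc i) (insert_index k j)"
      have det: "detf (Suc n) M = M 0 k * ((- 1) ^ k * detf n ?N)"
        using det_first_row_single[of k n M] k zero by simp
      then have "detf n ?N \<noteq> 0" using less.prems by auto
      from outer[OF this] obtain R where R: "finite R" "int (card R) = \<bar>detf n ?N\<bar>" "transversal n ?N R"
        by blast
      obtain R' where "finite R'" "card R' = nat \<bar>M 0 k\<bar> * card R" "transversal (Suc n) M R'"
        using transversal_first_row_single[of k n M R] k zero R by blast
      moreover have "int (nat \<bar>M 0 k\<bar> * card R) = \<bar>detf (Suc n) M\<bar>"
        unfolding det by (simp add: R abs_mult power_abs)
      ultimately show ?thesis by metis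
    qed
  qed
qed

section \<open>Increasing enumerations and interlacing determinants\<close>

lemma sorted_list_eq_iff_set:
  "sorted_wrt (<) xs \<Longrightarrow> set xs = A \<Longrightarrow> sorted_list_of_set A = (xs :: int list)"
  by (metis sorted_list_of_set.idem_if_sorted_distinct strict_sorted_iff)

definition el :: "int set \<Rightarrow> nat \<Rightarrow> int" where
  "el G i = sorted_list_of_set G ! i"

lemma el_in: "i < card G \<Longrightarrow> el G i \<in> G"
  using card.infinite[of G] nth_mem[of i "sorted_list_of_set G"]
  by (cases "finite G") (auto simp: el_def)

lemma el_less: "i < j \<Longrightarrow> j < card G \<Longrightarrow> el G i < el G j"
  using sorted_wrt_nth_less[OF strict_sorted_list_of_set, of i j G] by (simp add: el_def)

lemma el_le: "i \<le> j \<Longrightarrow> j < card G \<Longrightarrow> el G i \<le> el G j"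
  using el_less[of i j G] by (cases "i = j") auto

lemma el_bij: "finite G \<Longrightarrow> bij_betw (el G) {..<card G} G"
  using bij_betw_nth[of "sorted_list_of_set G" "{..<card G}" G] unfolding el_def[abs_def] by simp

lemma el_eqI:
  assumes "finite G" "card G = n" "\<And>i j. i < j \<Longrightarrow> j < n \<Longrightarrow> f i < f j" "f ` {..<n} = G" "i < n"
  shows "el G i = f i"
proof -
  have "sorted_list_of_set G = map f [0..<n]"
    by (rule sorted_list_eq_iff_set)
      (use assms in \<open>auto simp: sorted_wrt_iff_nth_less lessThan_atLeast0\<close>)
  then show ?thesis using assms by (simp add: el_def)
qed

lemma card_less_el:
  assumes "finite G" "l < card G"
  shows "card {u \<in> G. u < el G l} = l"
proof -
  have "{u \<in> G. u < el G l} = el G ` {..<l}"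
  proof (intro equalityI subsetI)
    fix u assume u: "u \<in> {u \<in> G. u < el G l}"
    then obtain i where "i < card G" "u = el G i"
      using bij_betw_imp_surj_on[OF el_bij[OF assms(1)]] by blast
    then show "u \<in> el G ` {..<l}"
      using u el_le[of l i G] by (cases "i < l") auto
  qed (use assms el_in el_less in auto)
  moreover have "inj_on (el G) {..<l}"
    using bij_betw_imp_inj_on[OF el_bij[OF assms(1)]] assms(2) by (auto simp: inj_on_def)
  ultimately show ?thesis by (simp add: card_image)
qed

lemma el_card_less:
  assumes "finite G" "g \<in> G"
  shows "card {u \<in> G. u < g} < card G" "el G (card {u \<in> G. u < g}) = g"
proof -
  obtain i where "i < card G" "g = el G i"
    using bij_betw_imp_surj_on[OF el_bij[OF assms(1)]] assms(2) by blast
  then show "card {u \<in> G. u < g} < card G" "el G (card {u \<in> G. u < g}) = g"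
    using card_less_el[OF assms(1)] by auto
qed

lemma el_remove:
  assumes G: "finite G" and l: "l < card G" and j: "Suc j < card G"
  shows "el (G - {el G l}) j = el G (insert_index l j)"
proof (rule el_eqI[where n = "card G - 1"])
  show "card (G - {el G l}) = card G - 1" using el_in[OF l] by simp
  show "el G (insert_index l i) < el G (insert_index l j)" if "i < j" "j < card G - 1" for i j
    by (rule el_less) (use that in \<open>auto simp: insert_index_def\<close>)
  obtain m where m: "card G = Suc m" using l by (cases "card G") auto
  have "(\<lambda>i. el G (insert_index l i)) ` {..<m} = el G ` ({..<Suc m} - {l})"
    using insert_index_image[of l m] l m by (metis image_image lessThan_atLeast0)
  also have "\<dots> = el G ` {..<Suc m} - {el G l}"
    using inj_on_image_set_diff[of "el G" "{..<Suc m}" "{..<Suc m}" "{l}"] el_bij[OF G] l m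
    by (auto simp: bij_betw_def)
  finally show "(\<lambda>i. el G (insert_index l i)) ` {..<card G - 1} = G - {el G l}"
    using el_bij[OF G] m by (simp add: bij_betw_def)
qed (use G j in auto)

lemma sum_sign_by_index:
  fixes f :: "int \<Rightarrow> 'a::comm_ring_1"
  assumes "finite G"
  shows "(\<Sum>v\<in>G. (- 1) ^ card {u \<in> G. u < v} * f v) = (\<Sum>l<card G. (- 1) ^ l * f (el G l))"
  using sum.reindex_bij_betw[OF el_bij[OF assms], of "\<lambda>v. (- 1) ^ card {u \<in> G. u < v} * f v"]
  by (simp add: card_less_el[OF assms])

text \<open>Put a row of ones above the first \<open>k\<close> functions. Expansion along it gives
  the alternating sum. On \<open>P\<close> the row of ones is also the sum of all
  \<open>Suc k\<close> rows, so subtracting the others leaves \<alpha> \<open>k\<close> on top, and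
  moving it to the bottom costs \<open>(- 1) ^ k\<close>.\<close>

lemma detf_ones_row:
  fixes \<alpha> :: "nat \<Rightarrow> int \<Rightarrow> 'a::comm_ring_1"
  assumes P: "finite P" "card P = Suc k" and one: "\<And>g. g \<in> P \<Longrightarrow> (\<Sum>i\<le>k. \<alpha> i g) = 1"
  shows "(\<Sum>v\<in>P. (- 1) ^ card {u \<in> P. u < v} * detf k (\<lambda>i j. \<alpha> i (el (P - {v}) j))) =
    (- 1) ^ k * detf (Suc k) (\<lambda>i j. \<alpha> i (el P j))"
proof -
  let ?M = "\<lambda>i j. case i of 0 \<Rightarrow> 1 | Suc i \<Rightarrow> \<alpha> i (el P j)"
  \<comment> \<open>\<open>?T\<close> expresses the bordered matrix through the rows \<alpha>
    \<open>0\<close>, ..., \<alpha> \<open>k\<close>: ones in the first row, then a shifted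
    identity.\<close>
  let ?T = "\<lambda>i j. case i of 0 \<Rightarrow> 1 | Suc i \<Rightarrow> if i = j then 1 else (0::'a)"
  let ?mM = "mat (Suc k) (Suc k) (\<lambda>(i, j). ?M i j)" and ?mT = "mat (Suc k) (Suc k) (\<lambda>(i, j). ?T i j)"
  have "detf (Suc k) ?M = (\<Sum>j<Suc k. ?mM $$ (0, j) * cofactor ?mM 0 j)"
    by (rule laplace_expansion_row) auto
  also have "\<dots> = (\<Sum>l<Suc k. (- 1) ^ l * detf k (\<lambda>i j. \<alpha> i (el (P - {el P l}) j)))"
  proof (rule sum.cong[OF refl])
    fix l assume l: "l \<in> {..<Suc k}"
    have "mat_delete ?mM 0 l = mat k k (\<lambda>(i, j). \<alpha> i (el (P - {el P l}) j))"
      using l P el_remove[OF P(1), of l]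
      unfolding mat_delete_def by (intro eq_matI) (auto simp: insert_index_def)
    then show "?mM $$ (0, l) * cofactor ?mM 0 l = (- 1) ^ l * detf k (\<lambda>i j. \<alpha> i (el (P - {el P l}) j))"
      using l by (simp add: cofactor_def)
  qed
  also have "\<dots> = (\<Sum>v\<in>P. (- 1) ^ card {u \<in> P. u < v} * detf k (\<lambda>i j. \<alpha> i (el (P - {v}) j)))"
    using sum_sign_by_index[OF P(1), of "\<lambda>v. detf k (\<lambda>i j. \<alpha> i (el (P - {v}) j))"] P(2) by simp
  finally have "(\<Sum>v\<in>P. (- 1) ^ card {u \<in> P. u < v} * detf k (\<lambda>i j. \<alpha> i (el (P - {v}) j))) =
    detf (Suc k) ?M" ..
  also have "\<dots> = detf (Suc k) (\<lambda>i j. \<Sum>l<Suc k. ?T i l * \<alpha> l (el P j))"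
  proof (rule detf_cong)
    fix i j assume ij: "i < Suc k" "j < Suc k"
    show "?M i j = (\<Sum>l<Suc k. ?T i l * \<alpha> l (el P j))"
    proof (cases i)
      case 0
      then show ?thesis
        using one[OF el_in, of j] ij P by (simp add: lessThan_Suc_atMost)
    next
      case (Suc i')
      have "(\<Sum>l<Suc k. ?T i l * \<alpha> l (el P j)) = (\<Sum>l<Suc k. if l = i' then \<alpha> l (el P j) else 0)"
        using Suc by (intro sum.cong) auto
      also have "\<dots> = \<alpha> i' (el P j)"
        using Suc ij by (simp del: sum.lessThan_Suc)
      finally show ?thesis using Suc by simp
    qed
  qed
  also have "\<dots> = detf (Suc k) ?T * detf (Suc k) (\<lambda>i j. \<alpha> i (el P j))"
    by (rule detf_mult)
  also have "detf (Suc k) ?T = (- 1) ^ k"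
  proof -
    have "detf (Suc k) ?T = (\<Sum>i<Suc k. ?mT $$ (i, k) * cofactor ?mT i k)"
      by (rule laplace_expansion_column) auto
    also have "\<dots> = ?mT $$ (0, k) * cofactor ?mT 0 k"
      by (subst sum.remove[of _ 0]) (auto intro!: sum.neutral split: nat.splits)
    also have "mat_delete ?mT 0 k = 1\<^sub>m k"
      unfolding mat_delete_def by (intro eq_matI) auto
    then have "cofactor ?mT 0 k = (- 1) ^ k" by (simp add: cofactor_def)
    finally show ?thesis by simp
  qed
  finally show ?thesis .
qed

text \<open>Only the column of \<open>g\<close> varies, so by linearity the sum over
  \<open>Q\<close> has a zero column there. The \<open>g\<close> in \<open>H\<close> can be included
  because they repeat a column, and the sign moves the column of \<open>g\<close> to the
  front.\<close>

lemma det_zero_sum_cycle: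
  fixes \<gamma> :: "nat \<Rightarrow> int \<Rightarrow> 'a::comm_ring_1"
  assumes Q: "finite Q" and zero: "\<And>i. i \<le> m \<Longrightarrow> (\<Sum>g\<in>Q. \<gamma> i g) = 0"
    and H: "finite H" "card H = m"
  shows "(\<Sum>g\<in>Q - H. (- 1) ^ card {u \<in> H. u < g} * detf (Suc m) (\<lambda>i j. \<gamma> i (el (insert g H) j))) = 0"
proof -
  define d where "d i = detf m (\<lambda>i' j. \<gamma> (insert_index i i') (el H j))" for i
  let ?s = "\<lambda>g. \<Sum>i<Suc m. (- 1) ^ i * \<gamma> i g * d i"
  have expand: "detf (Suc m) (\<lambda>i j. \<gamma> i (e j)) = (\<Sum>i<Suc m. (- 1) ^ (i + l) * \<gamma> i (e l) * d i)"
    if l: "l < Suc m" and e: "\<And>j. j < m \<Longrightarrow> e (insert_index l j) = el H j" for e l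
  proof -
    let ?M = "mat (Suc m) (Suc m) (\<lambda>(i, j). \<gamma> i (e j))"
    have "detf (Suc m) (\<lambda>i j. \<gamma> i (e j)) = (\<Sum>i<Suc m. ?M $$ (i, l) * cofactor ?M i l)"
      by (rule laplace_expansion_column) (use l in auto)
    also have "\<dots> = (\<Sum>i<Suc m. (- 1) ^ (i + l) * \<gamma> i (e l) * d i)"
    proof (rule sum.cong[OF refl])
      fix i assume i: "i \<in> {..<Suc m}"
      have "mat_delete ?M i l = mat m m (\<lambda>(i', j). \<gamma> (insert_index i i') (el H j))"
        unfolding mat_delete_def by (intro eq_matI) (use i e l in \<open>auto simp: insert_index_def\<close>)
      then show "?M $$ (i, l) * cofactor ?M i l = (- 1) ^ (i + l) * \<gamma> i (e l) * d i"
        using i l by (simp add: cofactor_def d_def mult_ac)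
    qed
    finally show ?thesis .
  qed
  have ins: "(- 1) ^ card {u \<in> H. u < g} * detf (Suc m) (\<lambda>i j. \<gamma> i (el (insert g H) j)) = ?s g"
    if "g \<notin> H" for g
  proof -
    let ?G = "insert g H" and ?l = "card {u \<in> H. u < g}"
    have G: "finite ?G" "card ?G = Suc m" using H that by auto
    have "{u \<in> ?G. u < g} = {u \<in> H. u < g}" by auto
    then have l: "?l < Suc m" "el ?G ?l = g"
      using el_card_less[OF G(1), of g] G(2) by auto
    have "el ?G (insert_index ?l j) = el H j" if "j < m" for j
      using el_remove[OF G(1), of ?l j] l G(2) that \<open>g \<notin> H\<close> by simp
    from expand[OF l(1) this]
    have "detf (Suc m) (\<lambda>i j. \<gamma> i (el ?G j)) = (\<Sum>i<Suc m. (- 1) ^ (i + ?l) * \<gamma> i g * d i)"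
      unfolding l(2) .
    also have "\<dots> = (- 1) ^ ?l * ?s g"
      unfolding sum_distrib_left by (simp only: power_add mult_ac)
    finally show ?thesis by (simp add: mult.assoc[symmetric])
  qed
  have dup: "?s g = 0" if "g \<in> H" for g
  proof -
    let ?e = "case_nat g (el H)"
    obtain j where j: "j < m" "el H j = g"
      using el_card_less[OF H(1) \<open>g \<in> H\<close>] H(2) by blast
    have "detf (Suc m) (\<lambda>i j. \<gamma> i (?e j)) = 0"
    proof (rule det_identical_columns[of _ "Suc m" 0 "Suc j"])
      show "col (mat (Suc m) (Suc m) (\<lambda>(i, j). \<gamma> i (?e j))) 0 =
          col (mat (Suc m) (Suc m) (\<lambda>(i, j). \<gamma> i (?e j))) (Suc j)"
        using j by (intro eq_vecI) auto
    qed (use j in auto)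
    moreover have "detf (Suc m) (\<lambda>i j. \<gamma> i (?e j)) = (\<Sum>i<Suc m. (- 1) ^ (i + 0) * \<gamma> i (?e 0) * d i)"
      by (rule expand) (auto simp: insert_index_def)
    ultimately show ?thesis by simp
  qed
  have "(\<Sum>g\<in>Q - H. (- 1) ^ card {u \<in> H. u < g} * detf (Suc m) (\<lambda>i j. \<gamma> i (el (insert g H) j))) =
      (\<Sum>g\<in>Q - H. ?s g)"
    using ins by (intro sum.cong) auto
  also have "\<dots> = (\<Sum>g\<in>Q. ?s g)"
    by (rule sum.mono_neutral_left) (use Q dup in auto)
  also have "\<dots> = (\<Sum>i<Suc m. \<Sum>g\<in>Q. (- 1) ^ i * \<gamma> i g * d i)"
    by (rule sum.swap)
  also have "\<dots> = (\<Sum>i<Suc m. (- 1) ^ i * (\<Sum>g\<in>Q. \<gamma> i g) * d i)"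
    by (simp add: sum_distrib_left sum_distrib_right)
  also have "\<dots> = 0"
    using zero by (intro sum.neutral) auto
  finally show ?thesis .
qed

text \<open>A nonzero term of the Leibniz formula belongs to an increasing permutation: for
  \<open>i < j\<close> the points \<open>g (p i)\<close> and \<open>g (p j)\<close> lie in supports
  that come in this order, and \<open>g\<close> is strictly increasing. Only the identity is
  increasing.\<close>

lemma detf_interlacing:
  fixes \<alpha> :: "nat \<Rightarrow> int \<Rightarrow> 'a::idom"
  assumes sep: "\<And>i j x y. i < j \<Longrightarrow> j < n \<Longrightarrow> \<alpha> i x \<noteq> 0 \<Longrightarrow> \<alpha> j y \<noteq> 0 \<Longrightarrow> x \<le> y"
    and g: "\<And>i j. i < j \<Longrightarrow> j < n \<Longrightarrow> g i < g j"
  shows "detf n (\<lambda>i j. \<alpha> i (g j)) = (\<Prod>i<n. \<alpha> i (g i))"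
proof -
  have "detf n (\<lambda>i j. \<alpha> i (g j)) = (\<Sum>p\<in>{id}. signof p * (\<Prod>i = 0..<n. \<alpha> i (g (p i))))"
    unfolding detf_def
  proof (rule sum.mono_neutral_right)
    show "\<forall>p\<in>{p. p permutes {0..<n}} - {id}. signof p * (\<Prod>i = 0..<n. \<alpha> i (g (p i))) = 0"
    proof
      fix p assume "p \<in> {p. p permutes {0..<n}} - {id}"
      then have p: "p permutes {0..<n}" "p \<noteq> id" by auto
      have "(\<Prod>i = 0..<n. \<alpha> i (g (p i))) = 0"
      proof (rule ccontr)
        assume "(\<Prod>i = 0..<n. \<alpha> i (g (p i))) \<noteq> 0"
        then have nz: "\<alpha> i (g (p i)) \<noteq> 0" if "i < n" for i using that by simp
        have mono: "p i < p j" if ij: "i < j" "j < n" for i j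
        proof (rule ccontr)
          assume "\<not> p i < p j"
          moreover have "p i \<noteq> p j" using permutes_inj[OF p(1)] ij by (auto dest: injD)
          moreover have "p i < n" using permutes_in_image[OF p(1), of i] ij by simp
          ultimately have "g (p j) < g (p i)" using g by simp
          then show False using sep[of i j "g (p i)" "g (p j)"] nz ij by fastforce
        qed
        have "i \<le> p i" if "i < n" for i
          using that
        proof (induction i)
          case (Suc i)
          then show ?case using mono[of i "Suc i"] by simp
        qed simp
        then have "p = id" using p(1) by (intro permutes_natset_ge) auto
        with p(2) show False ..
      qed
      then show "signof p * (\<Prod>i = 0..<n. \<alpha> i (g (p i))) = 0" by simp
    qed
  qed (auto simp: permutes_id finite_permutations)
  then show ?thesis by (simp add: lessThan_atLeast0)
qed

text \<open>The points \<open>a 0 < \<dots> < a (k - 1)\<close> are the vertices of the face to be added.  The point \<open>a k\<close> beyond \<open>q\<close>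
  is artificial: its function \<open>\<alpha> k\<close> completes the others to a partition of unity on \<open>{p..q}\<close>.  The numbers \<open>r\<close>
  are chosen such that each \<open>x i g * \<alpha> i g\<close> sums to zero over \<open>g\<close>, which makes the weighted cochain a cycle.\<close>

locale shifted_cochain =
  fixes p q :: int and k :: nat and a :: "nat \<Rightarrow> int" and r :: "nat \<Rightarrow> 'a::field"
    and x :: "nat \<Rightarrow> int \<Rightarrow> 'a"
  assumes a_less: "i < k \<Longrightarrow> a i < a (Suc i)"
    and p_le: "p \<le> q"
    and p_less: "p < a 0"
    and a_le: "i < k \<Longrightarrow> a i \<le> q"
    and less_a: "q < a k"
    and r_0: "r 0 = 1"
    and balance: "i < k \<Longrightarrow>
      r i * x i (case_nat p a i) + (\<Sum>g\<in>{case_nat p a i<..<a i}. x i g) + x i (a i) = r (Suc i) * x i (a i)"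
begin

abbreviation "prev \<equiv> case_nat p a"

text \<open>Consecutive functions share the endpoint \<open>a i\<close>, where their values
  \<open>1 - r (Suc i)\<close> and \<open>r (Suc i)\<close> add up to one; strictly inside its
  interval each function is one by itself. So the later values of \<open>r\<close> stay free for the
  weighted sums.\<close>

definition \<alpha> :: "nat \<Rightarrow> int \<Rightarrow> 'a" where
  "\<alpha> i g = (if g < prev i \<or> a i < g then 0 else if g = prev i then r i
     else if g = a i then 1 - r (Suc i) else 1)"

text \<open>The coordinate at \<open>G\<close> of the wedge of the \<alpha> \<open>i\<close>,
  written as the diagonal product to which the minor collapses (\<open>\<phi>_det\<close>).\<close>

definition \<phi> :: "int set \<Rightarrow> 'a" where
  "\<phi> G = (\<Prod>i<k. \<alpha> i (el G i))"

lemma prev_less: "i \<le> k \<Longrightarrow> prev i < a i"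
  using a_less p_less by (cases i) auto

lemma a_mono: "i \<le> j \<Longrightarrow> j \<le> k \<Longrightarrow> a i \<le> a j"
proof (induction j)
  case (Suc j)
  then show ?case using a_less[of j] by (cases "i = Suc j") auto
qed simp

text \<open>The partial sums are step functions that drop to zero at \<open>a m\<close>, and this
  form survives the induction. All of \<open>{p..q}\<close> lies before the last drop at
  \<open>a k\<close>.\<close>

lemma sum_\<alpha>_upto:
  assumes "p \<le> g" "m \<le> k"
  shows "(\<Sum>i\<le>m. \<alpha> i g) = (if g < a m then 1 else if g = a m then 1 - r (Suc m) else 0)"
  using assms(2)
proof (induction m)
  case 0
  show ?case using assms(1) p_less r_0 by (auto simp: \<alpha>_def)
next
  case (Suc m)
  then show ?case using a_less[of m] by (auto simp: \<alpha>_def)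
qed

lemma sum_\<alpha>: "g \<in> {p..q} \<Longrightarrow> (\<Sum>i\<le>k. \<alpha> i g) = 1"
  using less_a by (subst sum_\<alpha>_upto) auto

lemma \<alpha>_separated:
  assumes "i < j" "j \<le> k" "\<alpha> i y \<noteq> 0" "\<alpha> j z \<noteq> 0"
  shows "y \<le> z"
proof -
  obtain j' where j': "j = Suc j'" using assms(1) by (cases j) auto
  have "y \<le> a i" "a j' \<le> z"
    using assms j' by (auto simp: \<alpha>_def not_less split: if_splits)
  moreover have "a i \<le> a j'" using assms j' by (intro a_mono) auto
  ultimately show ?thesis by linarith
qed

lemma \<phi>_det: "card G = k \<Longrightarrow> detf k (\<lambda>i j. \<alpha> i (el G j)) = \<phi> G"
  unfolding \<phi>_def by (rule detf_interlacing) (use \<alpha>_separated el_less in auto)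

text \<open>The weight of a vertex depends on its position in \<open>G\<close>, so weighting is not
  a rescaling of the vertices. But only the diagonal survives, where position and row index agree,
  so the weights can be placed in the rows.\<close>

lemma weighted_\<phi>_det:
  "card G = k \<Longrightarrow> detf k (\<lambda>i j. x i (el G j) * \<alpha> i (el G j)) = (\<Prod>i<k. x i (el G i)) * \<phi> G"
  unfolding \<phi>_def prod.distrib[symmetric]
  by (rule detf_interlacing[of k "\<lambda>i g. x i g * \<alpha> i g"]) (use \<alpha>_separated el_less in auto)

lemma \<phi>_support:
  assumes "\<phi> G \<noteq> 0" "i < k"
  shows "el G i \<le> a i"
proof -
  have "\<alpha> i (el G i) \<noteq> 0" using assms by (auto simp: \<phi>_def)
  then show ?thesis by (auto simp: \<alpha>_def not_less split: if_splits)
qed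

text \<open>The weighted rows sum to zero over \<open>{p..q}\<close>: this is \<open>balance\<close>
  with both terms at \<open>a i\<close> on one side. \<open>det_zero_sum_cycle\<close> turns it into
  the cycle equation at \<open>H\<close>.\<close>

lemma \<phi>_weighted_cycle:
  assumes k: "k = Suc m" and H: "finite H" "card H = m"
  shows "(\<Sum>g\<in>{p..q} - H. (- 1) ^ card {u \<in> H. u < g} *
    ((\<Prod>i<k. x i (el (insert g H) i)) * \<phi> (insert g H))) = 0"
proof -
  have "(\<Sum>g\<in>{p..q} - H. (- 1) ^ card {u \<in> H. u < g} *
      ((\<Prod>i<k. x i (el (insert g H) i)) * \<phi> (insert g H))) =
    (\<Sum>g\<in>{p..q} - H. (- 1) ^ card {u \<in> H. u < g} *
      detf (Suc m) (\<lambda>i j. x i (el (insert g H) j) * \<alpha> i (el (insert g H) j)))"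
    using H k weighted_\<phi>_det by (intro sum.cong) auto
  also have "\<dots> = 0"
  proof (rule det_zero_sum_cycle[of _ m "\<lambda>i g. x i g * \<alpha> i g", OF _ _ H])
    fix i assume "i \<le> m"
    then have i: "i < k" using k by simp
    have le: "p \<le> prev i" "a i \<le> q"
      using p_less a_mono[of 0] i a_le by (auto split: nat.splits intro: less_imp_le order.trans)
    have split: "{prev i..a i} = insert (prev i) (insert (a i) {prev i<..<a i})"
      using prev_less[of i] i by auto
    have "(\<Sum>g\<in>{p..q}. x i g * \<alpha> i g) = (\<Sum>g\<in>{prev i..a i}. x i g * \<alpha> i g)"
      by (rule sum.mono_neutral_right) (use le in \<open>auto simp: \<alpha>_def\<close>)
    also have "\<dots> = x i (prev i) * \<alpha> i (prev i) + (x i (a i) * \<alpha> i (a i) + (\<Sum>g\<in>{prev i<..<a i}. x i g * \<alpha> i g))"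
      unfolding split using prev_less[of i] i by simp
    also have "\<alpha> i (prev i) = r i"
      using prev_less[of i] i by (simp add: \<alpha>_def)
    also have "\<alpha> i (a i) = 1 - r (Suc i)"
      using prev_less[of i] i by (simp add: \<alpha>_def)
    also have "(\<Sum>g\<in>{prev i<..<a i}. x i g * \<alpha> i g) = (\<Sum>g\<in>{prev i<..<a i}. x i g)"
      by (rule sum.cong) (auto simp: \<alpha>_def)
    finally show "(\<Sum>g\<in>{p..q}. x i g * \<alpha> i g) = 0"
      using balance[OF i] by (simp add: algebra_simps)
  qed simp
  finally show ?thesis .
qed

lemma el_insert_least:
  assumes F: "finite F" "\<And>v. v \<in> F \<Longrightarrow> p < v" and i: "i \<le> card F"
  shows "el (insert p F) i = case_nat p (el F) i"
proof (rule el_eqI[where n = "Suc (card F)"])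
  show "case_nat p (el F) i < case_nat p (el F) j" if "i < j" "j < Suc (card F)" for i j
    using that F(2)[OF el_in, of "j - 1"] el_less[of "i - 1" "j - 1" F] by (auto split: nat.splits)
  have "p \<notin> F" using F(2) by blast
  then show "card (insert p F) = Suc (card F)" using F(1) by simp
  show "case_nat p (el F) ` {..<Suc (card F)} = insert p F"
    using el_bij[OF F(1)] by (auto simp: bij_betw_def lessThan_Suc_eq_insert_0 image_image)
qed (use F i in auto)

text \<open>The left side is the coboundary of the wedge at \<open>p \<union> F\<close>. By
  \<open>detf_ones_row\<close> it is the wedge with the complementary function \<alpha>
  \<open>k\<close>, up to sign, and interlacing reduces that to a product. The face opposite
  \<open>p\<close> gives \<phi> \<open>F\<close>; for every other removed vertex, \<open>p\<close>
  precedes it and flips the sign.\<close>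

lemma \<phi>_coboundary:
  assumes F: "F \<subseteq> {p<..q}" "card F = k"
  shows "\<phi> F - (\<Sum>v\<in>F. (- 1) ^ card {u \<in> F. u < v} * \<phi> (insert p (F - {v}))) =
    (- 1) ^ k * (\<Prod>i\<le>k. \<alpha> i (case_nat p (el F) i))"
proof -
  let ?P = "insert p F"
  have fin: "finite F" and pF: "p \<notin> F" using F(1) finite_subset[of F] by auto
  have pless: "p < v" if "v \<in> F" for v using F(1) that by auto
  have P: "finite ?P" "card ?P = Suc k" "?P \<subseteq> {p..q}"
    using F fin pF p_le by auto
  have "(\<Sum>v\<in>?P. (- 1) ^ card {u \<in> ?P. u < v} * detf k (\<lambda>i j. \<alpha> i (el (?P - {v}) j))) =
      (- 1) ^ k * detf (Suc k) (\<lambda>i j. \<alpha> i (el ?P j))"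
    by (rule detf_ones_row) (use P sum_\<alpha> in auto)
  also have "detf (Suc k) (\<lambda>i j. \<alpha> i (el ?P j)) = (\<Prod>i<Suc k. \<alpha> i (el ?P i))"
    by (rule detf_interlacing) (use P \<alpha>_separated el_less in auto)
  also have "\<dots> = (\<Prod>i\<le>k. \<alpha> i (case_nat p (el F) i))"
    using el_insert_least[OF fin pless] F(2) by (intro prod.cong) auto
  also have "(\<Sum>v\<in>?P. (- 1) ^ card {u \<in> ?P. u < v} * detf k (\<lambda>i j. \<alpha> i (el (?P - {v}) j))) =
      (\<Sum>v\<in>?P. (- 1) ^ card {u \<in> ?P. u < v} * \<phi> (?P - {v}))"
    using P by (intro sum.cong refl) (simp add: \<phi>_det)
  also have "\<dots> = \<phi> F + (\<Sum>v\<in>F. (- 1) ^ card {u \<in> ?P. u < v} * \<phi> (?P - {v}))"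
  proof -
    have "{u \<in> ?P. u < p} = {}" using pless by fastforce
    moreover have "?P - {p} = F" using pF by auto
    ultimately show ?thesis
      unfolding sum.insert[OF fin pF] by (simp only: card.empty power_0 mult_1)
  qed
  also have "(\<Sum>v\<in>F. (- 1) ^ card {u \<in> ?P. u < v} * \<phi> (?P - {v})) =
      - (\<Sum>v\<in>F. (- 1) ^ card {u \<in> F. u < v} * \<phi> (insert p (F - {v})))"
    unfolding sum_negf[symmetric]
  proof (rule sum.cong[OF refl])
    fix v assume v: "v \<in> F"
    have "{u \<in> ?P. u < v} = insert p {u \<in> F. u < v}" using pless[OF v] by auto
    moreover have "?P - {v} = insert p (F - {v})" using v pF by auto
    ultimately show "(- 1) ^ card {u \<in> ?P. u < v} * \<phi> (?P - {v}) =
        - ((- 1) ^ card {u \<in> F. u < v} * \<phi> (insert p (F - {v})))"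
      using fin pF by simp
  qed
  finally show ?thesis by simp
qed

text \<open>The support of \<alpha> \<open>(Suc i)\<close> starts at \<open>a i\<close>, beyond
  \<open>el F i\<close>, so one factor of the product in \<open>\<phi>_coboundary\<close>
  vanishes.\<close>

lemma \<phi>_cocycle:
  assumes F: "F \<subseteq> {p<..q}" "card F = k" and i: "i < k" "el F i < a i"
  shows "(\<Sum>v\<in>F. (- 1) ^ card {u \<in> F. u < v} * \<phi> (insert p (F - {v}))) = \<phi> F"
proof -
  have "\<alpha> (Suc i) (case_nat p (el F) (Suc i)) = 0"
    using i by (simp add: \<alpha>_def)
  then have "(\<Prod>i\<le>k. \<alpha> i (case_nat p (el F) i)) = 0"
    using i by (intro prod_zero) (auto intro!: bexI[of _ "Suc i"])
  with \<phi>_coboundary[OF F] show ?thesis by (simp only: mult_zero_right right_minus_eq)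
qed

text \<open>Here every function is evaluated at its left endpoint \<open>prev i\<close>, where its
  value is \<open>r i\<close>.\<close>

lemma \<phi>_coboundary_top:
  assumes F: "F \<subseteq> {p<..q}" "card F = k" and eq: "\<And>i. i < k \<Longrightarrow> el F i = a i"
  shows "(\<Sum>v\<in>F. (- 1) ^ card {u \<in> F. u < v} * \<phi> (insert p (F - {v}))) =
    \<phi> F - (- 1) ^ k * (\<Prod>i<k. r (Suc i))"
proof -
  have "(\<Prod>i\<le>k. \<alpha> i (case_nat p (el F) i)) = (\<Prod>i\<le>k. r i)"
  proof (rule prod.cong[OF refl])
    fix i assume "i \<in> {..k}"
    then have i: "i \<le> k" by simp
    have "case_nat p (el F) i = prev i" using eq i by (cases i) auto
    then show "\<alpha> i (case_nat p (el F) i) = r i" using prev_less[OF i] by (simp add: \<alpha>_def)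
  qed
  also have "\<dots> = (\<Prod>i<k. r (Suc i))"
    by (simp add: prod.atMost_shift r_0)
  finally show ?thesis using \<phi>_coboundary[OF F] by (simp add: algebra_simps)
qed

lemma \<phi>_top: "(\<And>i. i < k \<Longrightarrow> el F i = a i) \<Longrightarrow> \<phi> F = (\<Prod>i<k. 1 - r (Suc i))"
  unfolding \<phi>_def
proof (rule prod.cong[OF refl])
  fix i assume "\<And>i. i < k \<Longrightarrow> el F i = a i" "i \<in> {..<k}"
  then show "\<alpha> i (el F i) = 1 - r (Suc i)"
    using prev_less[of i] by (simp add: \<alpha>_def)
qed

end

section \<open>Weighted Laplacians of order ideals\<close>

text \<open>Defined on lists because a multiset \<open>S \<union> j\<close> may have a repeated
  entry. Positions count from 0.\<close>

definition list_weight :: "(nat \<Rightarrow> int \<Rightarrow> 'a::comm_ring_1) \<Rightarrow> int list \<Rightarrow> 'a" where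
  "list_weight x xs = (\<Prod>i<length xs. x i (xs ! i))"

abbreviation weight :: "(nat \<Rightarrow> int \<Rightarrow> 'a::comm_ring_1) \<Rightarrow> int set \<Rightarrow> 'a" where
  "weight x G \<equiv> list_weight x (sorted_list_of_set G)"

lemma weight_el: "weight x G = (\<Prod>i<card G. x i (el G i))"
  by (simp add: list_weight_def el_def)

lemma list_weight_snoc: "list_weight x (xs @ [y]) = list_weight x xs * x (length xs) y"
  unfolding list_weight_def by (simp add: nth_append)

definition incidence :: "int set \<Rightarrow> int set \<Rightarrow> int" where
  "incidence H G = (\<Sum>v\<in>G. if G - {v} = H then (- 1) ^ card {u \<in> G. u < v} else 0)"

text \<open>An entry of \<open>D W D^T\<close>, where the incidence matrix \<open>D\<close> has one
  column for each member of \<open>C\<close>.\<close>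

definition laplacian :: "(nat \<Rightarrow> int \<Rightarrow> 'a::comm_ring_1) \<Rightarrow> int set set \<Rightarrow> int set \<Rightarrow> int set \<Rightarrow> 'a" where
  "laplacian x C H H' = (\<Sum>G\<in>C. weight x G * of_int (incidence H G) * of_int (incidence H' G))"

text \<open>The coboundary of \<open>f\<close> at \<open>G\<close>, with \<open>f\<close> taken as
  zero outside \<open>R\<close>. \<open>sum_incidence_cols\<close> is the dual formula for
  boundaries.\<close>

lemma sum_incidence_rows:
  fixes f :: "int set \<Rightarrow> 'a::comm_ring_1"
  assumes "finite R" "finite G"
  shows "(\<Sum>H\<in>R. of_int (incidence H G) * f H) =
    (\<Sum>v\<in>G. if G - {v} \<in> R then (- 1) ^ card {u \<in> G. u < v} * f (G - {v}) else 0)"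
proof -
  have "(\<Sum>H\<in>R. of_int (incidence H G) * f H) =
      (\<Sum>H\<in>R. \<Sum>v\<in>G. if H = G - {v} then (- 1) ^ card {u \<in> G. u < v} * f (G - {v}) else 0)"
    unfolding incidence_def of_int_sum sum_distrib_right by (intro sum.cong) auto
  also have "\<dots> = (\<Sum>v\<in>G. \<Sum>H\<in>R. if H = G - {v} then (- 1) ^ card {u \<in> G. u < v} * f (G - {v}) else 0)"
    by (rule sum.swap)
  finally show ?thesis using assms by simp
qed

lemma incidence_insert:
  assumes "finite H" "g \<notin> H"
  shows "incidence H (insert g H) = (- 1) ^ card {u \<in> H. u < g}"
proof -
  have "(insert g H - {v} = H) = (v = g)" if "v \<in> insert g H" for v using that assms by blast
  then have "incidence H (insert g H) = (\<Sum>v\<in>insert g H. if v = g then (- 1) ^ card {u \<in> insert g H. u < g} else 0)"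
    unfolding incidence_def by (intro sum.cong) auto
  also have "\<dots> = (- 1) ^ card {u \<in> insert g H. u < g}" using assms by simp
  also have "{u \<in> insert g H. u < g} = {u \<in> H. u < g}" by auto
  finally show ?thesis .
qed

lemma incidence_nonzeroE:
  assumes "incidence H G \<noteq> 0"
  obtains g where "g \<notin> H" "G = insert g H"
proof -
  from assms obtain v where "v \<in> G" "G - {v} = H"
    unfolding incidence_def by (rule sum.not_neutral_contains_not_neutral) (auto split: if_splits)
  then show thesis by (intro that[of v]) auto
qed

text \<open>All codimension one faces of the cone over \<open>H'\<close> except its base contain
  \<open>p\<close>, and the base has sign plus. So the cone faces contribute an identity block to
  the rows without \<open>p\<close>.\<close>

lemma incidence_insert_least:
  assumes "finite H'" "\<And>v. v \<in> H' \<Longrightarrow> p < v" "p \<notin> H"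
  shows "incidence H (insert p H') = (if H = H' then 1 else 0)"
proof (cases "H = H'")
  case True
  have "incidence H' (insert p H') = (- 1) ^ card {u \<in> H'. u < p}"
    by (rule incidence_insert) (use assms in auto)
  also have "{u \<in> H'. u < p} = {}"
  proof (rule equals0I)
    fix u assume "u \<in> {u \<in> H'. u < p}"
    then show False using assms(2)[of u] by simp
  qed
  finally show ?thesis using True by simp
next
  case False
  have "incidence H (insert p H') = 0"
  proof (rule ccontr)
    assume "incidence H (insert p H') \<noteq> 0"
    then obtain g where g: "insert p H' = insert g H" by (rule incidence_nonzeroE)
    have "g = p"
    proof (rule ccontr)
      assume "g \<noteq> p"
      then have "p \<in> H" using equalityD1[OF g] by simp
      with assms(3) show False ..
    qed
    moreover have "p \<notin> H'" using assms(2) by blast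
    ultimately show False using g insert_ident[of p H H'] False assms(3) by simp
  qed
  then show ?thesis using False by simp
qed

lemma sum_incidence_cols:
  fixes f :: "int set \<Rightarrow> 'a::comm_ring_1"
  assumes C: "finite C" "\<And>G. G \<in> C \<Longrightarrow> G \<subseteq> Q" and H: "finite H" and Q: "finite Q"
  shows "(\<Sum>G\<in>C. of_int (incidence H G) * f G) =
    (\<Sum>g\<in>Q - H. if insert g H \<in> C then (- 1) ^ card {u \<in> H. u < g} * f (insert g H) else 0)"
proof -
  let ?g = "{g \<in> Q - H. insert g H \<in> C}"
  have "(\<Sum>G\<in>C. of_int (incidence H G) * f G) = (\<Sum>G\<in>(\<lambda>g. insert g H) ` ?g. of_int (incidence H G) * f G)"
  proof (rule sum.mono_neutral_right[OF C(1)])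
    show "\<forall>G\<in>C - (\<lambda>g. insert g H) ` ?g. of_int (incidence H G) * f G = 0"
    proof
      fix G assume G: "G \<in> C - (\<lambda>g. insert g H) ` ?g"
      have "incidence H G = 0"
      proof (rule ccontr)
        assume "incidence H G \<noteq> 0"
        then obtain g where "g \<notin> H" "G = insert g H" by (rule incidence_nonzeroE)
        with G C(2)[of G] show False by auto
      qed
      then show "of_int (incidence H G) * f G = 0" by simp
    qed
  qed auto
  also have "\<dots> = (\<Sum>g\<in>?g. of_int (incidence H (insert g H)) * f (insert g H))"
    by (rule sum.reindex[unfolded o_def]) (auto simp: inj_on_def)
  also have "\<dots> = (\<Sum>g\<in>?g. (- 1) ^ card {u \<in> H. u < g} * f (insert g H))"
    by (rule sum.cong) (auto simp: incidence_insert H)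
  also have "\<dots> = (\<Sum>g\<in>Q - H. if insert g H \<in> C then (- 1) ^ card {u \<in> H. u < g} * f (insert g H) else 0)"
    by (subst sum.inter_filter[symmetric]) (auto simp: Q intro!: sum.cong)
  finally show ?thesis .
qed

context shifted_cochain
begin

text \<open>The rank one update is applied with \<open>c = weight x F * \<phi> F\<close>. The
  potential \<open>?u\<close> has coboundary \<phi> on the faces already present, so the Laplacian
  sends it to the boundary of the weighted chain of \<phi> on them. Adding \<open>F\<close>
  completes this chain to a cycle, hence the result is minus the term of \<open>F\<close>.\<close>

lemma laplacian_step:
  assumes k: "k = Suc m"
    and R: "finite R" "\<And>H. H \<in> R \<Longrightarrow> H \<subseteq> {p<..q} \<and> card H = m"
    and fam: "finite \<F>" "F \<notin> \<F>"
    and face: "\<And>G. G \<in> insert F \<F> \<Longrightarrow> G \<subseteq> {p<..q} \<and> card G = k \<and> (\<forall>v\<in>G. G - {v} \<in> R)"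
    and top: "\<And>i. i < k \<Longrightarrow> el F i = a i"
    and below: "\<And>G. G \<in> \<F> \<Longrightarrow> \<exists>i<k. el G i < a i"
    and closed: "\<And>G. G \<subseteq> {p..q} \<Longrightarrow> card G = k \<Longrightarrow> (\<And>i. i < k \<Longrightarrow> el G i \<le> a i) \<Longrightarrow>
      G \<in> insert p ` R \<union> insert F \<F>"
    and nz: "\<And>i. i < k \<Longrightarrow> r (Suc i) \<noteq> 1" "weight x F \<noteq> 0"
    and h: "bij_betw h {..<n} R"
  shows "detf n (\<lambda>i j. laplacian x (insert p ` R \<union> insert F \<F>) (h i) (h j)) =
    detf n (\<lambda>i j. laplacian x (insert p ` R \<union> \<F>) (h i) (h j)) * (\<Prod>i<k. r (Suc i) / (r (Suc i) - 1))"
proof -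
  let ?C = "insert p ` R \<union> \<F>"
  let ?incidence = "\<lambda>H G. of_int (incidence H G) :: 'a"
  let ?u = "\<lambda>H. \<phi> (insert p H)"
  have finG: "finite G" if "G \<subseteq> {p<..q}" for G using finite_subset[OF that] by simp
  have pR: "p \<notin> H" if "H \<in> R" for H using R(2)[OF that] by auto
  have C: "finite ?C" "F \<notin> ?C" "insert F ?C = insert p ` R \<union> insert F \<F>"
    using R(1) fam face[of F] by auto
  have Csub: "G \<subseteq> {p..q}" if "G \<in> insert F ?C" for G
  proof (cases "G \<in> insert F \<F>")
    case True
    then show ?thesis using face[of G] by force
  next
    case False
    then show ?thesis using that R(2) p_le by force
  qed
  have pot: "(\<Sum>H\<in>R. ?incidence H G * ?u H) = (\<Sum>v\<in>G. (- 1) ^ card {u \<in> G. u < v} * \<phi> (insert p (G - {v})))"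
    if "G \<in> insert F \<F>" for G
    using face[OF that] by (subst sum_incidence_rows) (auto simp: R finG intro!: sum.cong)
  \<comment> \<open>For a face of the deletion this is the cocycle property; for a cone face the
    incidences with \<open>R\<close> form a unit vector.\<close>
  have potC: "(\<Sum>H\<in>R. ?incidence H G * ?u H) = \<phi> G" if "G \<in> ?C" for G
  proof (cases "G \<in> \<F>")
    case True
    then obtain i where "i < k" "el G i < a i" using below by blast
    then show ?thesis using True face[of G] pot[of G] \<phi>_cocycle[of G i] by auto
  next
    case False
    then obtain H0 where H0: "H0 \<in> R" "G = insert p H0" using \<open>G \<in> ?C\<close> by auto
    have "finite H0" using R(2)[OF H0(1)] by (intro finG) simp
    then have incidence: "incidence H G = (if H = H0 then 1 else 0)" if "H \<in> R" for H
      unfolding H0(2) by (rule incidence_insert_least) (use R(2)[OF H0(1)] pR[OF that] in auto)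
    have "(\<Sum>H\<in>R. ?incidence H G * ?u H) = (\<Sum>H\<in>R. if H = H0 then ?u H else 0)"
    proof (rule sum.cong[OF refl])
      fix H assume "H \<in> R"
      then show "?incidence H G * ?u H = (if H = H0 then ?u H else 0)" by (simp add: incidence)
    qed
    also have "\<dots> = ?u H0" using R(1) H0(1) by simp
    finally show ?thesis by (simp only: H0(2))
  qed
  have cyc: "(\<Sum>G\<in>insert F ?C. ?incidence H G * (weight x G * \<phi> G)) = 0" if H: "H \<in> R" for H
  proof -
    have finH: "finite H" "card H = m" using R(2)[OF H] finG by auto
    have "(\<Sum>G\<in>insert F ?C. ?incidence H G * (weight x G * \<phi> G)) =
      (\<Sum>g\<in>{p..q} - H. if insert g H \<in> insert F ?C
        then (- 1) ^ card {u \<in> H. u < g} * (weight x (insert g H) * \<phi> (insert g H)) else 0)"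
    proof (rule sum_incidence_cols)
      show "finite (insert F ?C)" using C(1) by simp
    qed (use Csub finH(1) in auto)
    also have "\<dots> = (\<Sum>g\<in>{p..q} - H. (- 1) ^ card {u \<in> H. u < g} *
      ((\<Prod>i<k. x i (el (insert g H) i)) * \<phi> (insert g H)))"
    proof (rule sum.cong[OF refl])
      fix g assume g: "g \<in> {p..q} - H"
      let ?G = "insert g H"
      have card: "card ?G = k" using finH g k by simp
      \<comment> \<open>\<phi> lives on sets componentwise below \<open>F\<close>, and
        \<open>closed\<close> says that all of these are present. So the sum over the complex agrees
        with the sum over all \<open>g\<close> in \<open>\<phi>_weighted_cycle\<close>.\<close>
      have "\<phi> ?G = 0" if "?G \<notin> insert F ?C"
      proof (rule ccontr)
        assume "\<phi> ?G \<noteq> 0"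
        then have "?G \<in> insert p ` R \<union> insert F \<F>"
        proof (intro closed)
          show "?G \<subseteq> {p..q}" using g R(2)[OF H] by auto
        qed (use card \<phi>_support in auto)
        with that show False unfolding C(3) ..
      qed
      then show "(if ?G \<in> insert F ?C then (- 1) ^ card {u \<in> H. u < g} * (weight x ?G * \<phi> ?G) else 0) =
        (- 1) ^ card {u \<in> H. u < g} * ((\<Prod>i<k. x i (el ?G i)) * \<phi> ?G)"
        by (simp add: weight_el card)
    qed
    also have "\<dots> = 0" by (rule \<phi>_weighted_cycle[OF k finH])
    finally show ?thesis .
  qed
  have \<phi>F: "\<phi> F = (\<Prod>i<k. 1 - r (Suc i))" by (rule \<phi>_top) (rule top)
  have nz\<phi>: "\<phi> F \<noteq> 0" unfolding \<phi>F using nz(1) by auto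
  have bij: "(\<Sum>j<n. f (h j)) = (\<Sum>H\<in>R. f H)" for f :: "int set \<Rightarrow> 'a"
    by (rule sum.reindex_bij_betw[OF h])
  have "detf n (\<lambda>i j. laplacian x (insert p ` R \<union> insert F \<F>) (h i) (h j)) =
      detf n (\<lambda>i j. laplacian x ?C (h i) (h j) + weight x F * ?incidence (h i) F * ?incidence (h j) F)"
    unfolding laplacian_def C(3)[symmetric] using C by (simp add: add.commute)
  also have "\<dots> = detf n (\<lambda>i j. laplacian x ?C (h i) (h j)) *
      (1 - weight x F / (weight x F * \<phi> F) * (\<Sum>j<n. ?incidence (h j) F * ?u (h j)))"
  proof (rule detf_rank_one_update)
    fix i assume "i < n"
    then have H: "h i \<in> R" using h by (auto simp: bij_betw_def)
    have "(\<Sum>j<n. laplacian x ?C (h i) (h j) * ?u (h j)) = (\<Sum>H\<in>R. laplacian x ?C (h i) H * ?u H)"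
      by (rule bij)
    also have "\<dots> = (\<Sum>G\<in>?C. \<Sum>H\<in>R. weight x G * ?incidence (h i) G * ?incidence H G * ?u H)"
      unfolding laplacian_def sum_distrib_right by (rule sum.swap)
    also have "\<dots> = (\<Sum>G\<in>?C. weight x G * ?incidence (h i) G * (\<Sum>H\<in>R. ?incidence H G * ?u H))"
      by (simp add: sum_distrib_left mult.assoc)
    also have "\<dots> = (\<Sum>G\<in>?C. ?incidence (h i) G * (weight x G * \<phi> G))"
      using potC by (intro sum.cong) auto
    also have "\<dots> = - (weight x F * \<phi> F) * ?incidence (h i) F"
      using cyc[OF H] unfolding sum.insert[OF C(1,2)]
      by (simp add: eq_neg_iff_add_eq_0 add.commute mult_ac del: Un_insert_right)
    finally show "(\<Sum>j<n. laplacian x ?C (h i) (h j) * ?u (h j)) = - (weight x F * \<phi> F) * ?incidence (h i) F" .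
  qed (use nz nz\<phi> in auto)
  also have "(\<Sum>j<n. ?incidence (h j) F * ?u (h j)) = \<phi> F - (- 1) ^ k * (\<Prod>i<k. r (Suc i))"
    unfolding bij[of "\<lambda>H. ?incidence H F * ?u H"]
    using pot[of F] face[of F] \<phi>_coboundary_top[of F] top by simp
  \<comment> \<open>The two terms \<phi> \<open>F\<close> cancel; the sign \<open>(- 1) ^ k\<close>
    is then used up in turning the denominators \<open>1 - r (Suc i)\<close> into
    \<open>r (Suc i) - 1\<close>.\<close>
  also have "1 - weight x F / (weight x F * \<phi> F) * (\<phi> F - (- 1) ^ k * (\<Prod>i<k. r (Suc i))) =
      (- 1) ^ k * (\<Prod>i<k. r (Suc i)) / \<phi> F"
    using nz nz\<phi> by (simp add: field_simps)
  also have "\<dots> = (\<Prod>i<k. - r (Suc i) / (1 - r (Suc i)))"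
  proof -
    have "(\<Prod>i<k. - r (Suc i)) = (\<Prod>i<k. (- 1) * r (Suc i))" by simp
    also have "\<dots> = (- 1) ^ k * (\<Prod>i<k. r (Suc i))"
      unfolding prod.distrib prod_constant card_lessThan ..
    finally show ?thesis unfolding \<phi>F prod_dividef by simp
  qed
  also have "\<dots> = (\<Prod>i<k. r (Suc i) / (r (Suc i) - 1))"
  proof (rule prod.cong[OF refl])
    fix i
    show "- r (Suc i) / (1 - r (Suc i)) = r (Suc i) / (r (Suc i) - 1)"
      using minus_divide_divide[of "r (Suc i)" "r (Suc i) - 1"] by (simp only: minus_diff_eq)
  qed
  finally show ?thesis .
qed

end

text \<open>The sum \<open>N_i(m)\<close> of the overview for
  \<open>S = {a_1, ..., a_(i-1)}\<close>. \<open>insort\<close> realises the multiset union, with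
  \<open>j\<close> in \<open>S\<close> allowed.\<close>

definition prefix_sum :: "(nat \<Rightarrow> int \<Rightarrow> 'a::comm_ring_1) \<Rightarrow> int \<Rightarrow> int set \<Rightarrow> int \<Rightarrow> 'a" where
  "prefix_sum x p S m = (\<Sum>j\<in>{p..m}. list_weight x (insort j (sorted_list_of_set S)))"

lemma el_initial:
  assumes F: "finite F" and i: "i < card F"
  shows "{v \<in> F. v < el F i} = el F ` {..<i}" "sorted_list_of_set {v \<in> F. v < el F i} = map (el F) [0..<i]"
proof -
  show eq: "{v \<in> F. v < el F i} = el F ` {..<i}"
  proof (intro equalityI subsetI)
    fix v assume v: "v \<in> {v \<in> F. v < el F i}"
    then obtain j where j: "j < card F" "v = el F j"
      using bij_betw_imp_surj_on[OF el_bij[OF F]] by blast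
    then show "v \<in> el F ` {..<i}"
      using v el_le[of i j F] by (cases "j < i") auto
  qed (use i el_in el_less in auto)
  show "sorted_list_of_set {v \<in> F. v < el F i} = map (el F) [0..<i]"
    by (rule sorted_list_eq_iff_set)
      (use i el_less in \<open>auto simp: eq sorted_wrt_iff_nth_less lessThan_atLeast0\<close>)
qed

lemma insort_snoc_less: "\<forall>y\<in>set ys. y < j \<Longrightarrow> insort j ys = ys @ [j :: int]"
  by (induction ys) auto

lemma insort_snoc_le: "j \<le> y \<Longrightarrow> insort j (ys @ [y]) = insort j ys @ [y :: int]"
  by (induction ys) auto

lemma prefix_sum_diff:
  "p \<le> m \<Longrightarrow> prefix_sum x p S m = prefix_sum x p S (m - 1) + list_weight x (insort m (sorted_list_of_set S))"
proof -
  assume "p \<le> m"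
  then have "{p..m} = insert m {p..m - 1}" by auto
  then show ?thesis by (simp add: prefix_sum_def add.commute)
qed

text \<open>\<open>balance\<close> determines \<open>r (Suc i)\<close> from \<open>r i\<close>.
  Multiplied by \<open>weight x (S i)\<close> it says that the prefix sum up to \<open>a i\<close>
  splits at the preceding vertex, so the solution is this prefix sum divided by its last
  term.\<close>

lemma prefix_sum_recursion:
  fixes x :: "nat \<Rightarrow> int \<Rightarrow> 'a::field"
  assumes F: "finite F" "F \<subseteq> {p<..}" and i: "i < card F"
    and nz: "\<And>i j. x i j \<noteq> 0"
  defines "a \<equiv> el F" and "S \<equiv> \<lambda>i. {v \<in> F. v < el F i}"
  defines "r \<equiv> case_nat 1 (\<lambda>i. prefix_sum x p (S i) (a i) / (weight x (S i) * x i (a i)))"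
  shows "r i * x i (case_nat p a i) + (\<Sum>g\<in>{case_nat p a i<..<a i}. x i g) + x i (a i) = r (Suc i) * x i (a i)"
    and "r (Suc i) / (r (Suc i) - 1) = prefix_sum x p (S i) (a i) / prefix_sum x p (S i) (a i - 1)"
    and "prefix_sum x p (S i) (a i - 1) \<noteq> 0 \<Longrightarrow> r (Suc i) \<noteq> 1"
proof -
  have S: "sorted_list_of_set (S i) = map a [0..<i]" if "i < card F" for i
    unfolding S_def a_def by (rule el_initial(2)[OF F(1) that])
  have less: "p < a i" if "i < card F" for i
    using F(2) el_in[OF that] by (auto simp: a_def)
  have nzw: "weight x (S i) * x i (a i) \<noteq> 0" unfolding list_weight_def using nz by auto
  \<comment> \<open>A \<open>j\<close> beyond the preceding vertex is inserted at the end, at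
    position \<open>i\<close>.\<close>
  have above: "list_weight x (insort j (sorted_list_of_set (S i))) = weight x (S i) * x i j"
    if "case_nat p a i < j" for j
  proof -
    have "y < j" if y: "y \<in> set (map a [0..<i])" for y
    proof -
      obtain l where "l < i" "y = a l" using y by auto
      then have "y \<le> a (i - 1)" "i \<noteq> 0" using el_le[of l "i - 1" F] i by (auto simp: a_def)
      then show ?thesis using \<open>case_nat p a i < j\<close> by (cases i) auto
    qed
    then have "insort j (sorted_list_of_set (S i)) = sorted_list_of_set (S i) @ [j]"
      unfolding S[OF i] by (intro insort_snoc_less) auto
    then show ?thesis by (simp add: list_weight_snoc S[OF i])
  qed
  have prev: "p \<le> case_nat p a i" "case_nat p a i < a i"
    using less[OF i] i less[of "i - 1"] el_less[of "i - 1" i F] by (auto simp: a_def split: nat.splits)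
  \<comment> \<open>Inserting a \<open>j\<close> up to the preceding vertex keeps that vertex last
    and moves it to position \<open>i\<close>, so the prefix sum is the previous one times a single
    factor. For \<open>i = 0\<close> only \<open>j = p\<close> occurs.\<close>
  have low: "prefix_sum x p (S i) (case_nat p a i) = weight x (S i) * (r i * x i (case_nat p a i))"
  proof (cases i)
    case 0
    have "S 0 = {}" using S[of 0] i 0 F(1) by (auto simp: S_def)
    then show ?thesis using 0 by (simp add: prefix_sum_def r_def list_weight_def)
  next
    case (Suc l)
    have l: "l < card F" using Suc i by simp
    have snoc: "sorted_list_of_set (S (Suc l)) = sorted_list_of_set (S l) @ [a l]"
      using S[of l] S[of "Suc l"] Suc i by simp
    have len: "length (sorted_list_of_set (S l)) = l" using S[OF l] by simp
    have "prefix_sum x p (S (Suc l)) (a l) = (\<Sum>j\<in>{p..a l}. list_weight x (insort j (sorted_list_of_set (S l))) * x (Suc l) (a l))"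
      unfolding prefix_sum_def snoc
    proof (rule sum.cong[OF refl])
      fix j assume "j \<in> {p..a l}"
      then show "list_weight x (insort j (sorted_list_of_set (S l) @ [a l])) =
          list_weight x (insort j (sorted_list_of_set (S l))) * x (Suc l) (a l)"
        by (simp add: insort_snoc_le list_weight_snoc len del: sorted_list_of_set.length_sorted_key_list_of_set)
    qed
    also have "\<dots> = prefix_sum x p (S l) (a l) * x (Suc l) (a l)"
      by (simp add: prefix_sum_def sum_distrib_right)
    finally have *: "prefix_sum x p (S (Suc l)) (a l) = prefix_sum x p (S l) (a l) * x (Suc l) (a l)" .
    have "weight x (S (Suc l)) = weight x (S l) * x l (a l)"
      unfolding snoc list_weight_snoc len ..
    moreover have "weight x (S l) * x l (a l) \<noteq> 0" unfolding list_weight_def using nz by auto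
    ultimately show ?thesis unfolding Suc using * by (simp add: r_def)
  qed
  have disj: "{p..a i} = {p..case_nat p a i} \<union> insert (a i) {case_nat p a i<..<a i}"
    using prev by auto
  have "prefix_sum x p (S i) (a i) = prefix_sum x p (S i) (case_nat p a i) +
      ((\<Sum>j\<in>{case_nat p a i<..<a i}. weight x (S i) * x i j) + weight x (S i) * x i (a i))"
    unfolding prefix_sum_def disj using prev
    by (subst sum.union_disjoint) (auto simp: above add.commute)
  also have "\<dots> = weight x (S i) * (r i * x i (case_nat p a i) + (\<Sum>j\<in>{case_nat p a i<..<a i}. x i j) + x i (a i))"
    unfolding low by (simp add: algebra_simps sum_distrib_left)
  finally show "r i * x i (case_nat p a i) + (\<Sum>g\<in>{case_nat p a i<..<a i}. x i g) + x i (a i) = r (Suc i) * x i (a i)"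
    using nzw by (simp add: r_def)
  \<comment> \<open>Subtracting 1 removes the last term of the prefix sum.\<close>
  have *: "r (Suc i) - 1 = prefix_sum x p (S i) (a i - 1) / (weight x (S i) * x i (a i))"
    using nzw prefix_sum_diff[of p "a i" x "S i"] less[OF i] above[of "a i"] prev
    by (simp add: r_def field_simps)
  then show "r (Suc i) / (r (Suc i) - 1) = prefix_sum x p (S i) (a i) / prefix_sum x p (S i) (a i - 1)"
    using nzw by (simp add: r_def)
  show "r (Suc i) \<noteq> 1" if "prefix_sum x p (S i) (a i - 1) \<noteq> 0"
    using * that nzw by auto
qed

lemma prod_el: "finite F \<Longrightarrow> (\<Prod>i<card F. f (el F i)) = (\<Prod>v\<in>F. f v)"
  by (rule prod.reindex_bij_betw) (rule el_bij)

theorem det_laplacian_order_ideal: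
  fixes x :: "nat \<Rightarrow> int \<Rightarrow> 'a::field"
  assumes pq: "p \<le> q"
    and R: "finite R" "\<And>H. H \<in> R \<Longrightarrow> H \<subseteq> {p<..q} \<and> card H = m"
    and h: "bij_betw h {..<n} R"
    and nz: "\<And>i j. x i j \<noteq> 0" "\<And>S m. finite S \<Longrightarrow> p \<le> m \<Longrightarrow> prefix_sum x p S m \<noteq> 0"
    and fin: "finite \<F>"
    and face: "\<And>G. G \<in> \<F> \<Longrightarrow> G \<subseteq> {p<..q} \<and> card G = Suc m \<and> (\<forall>v\<in>G. G - {v} \<in> R)"
    and closed: "\<And>F G. F \<in> \<F> \<Longrightarrow> G \<subseteq> {p..q} \<Longrightarrow> card G = Suc m \<Longrightarrow> (\<And>i. i < Suc m \<Longrightarrow> el G i \<le> el F i) \<Longrightarrow>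
      G \<in> insert p ` R \<union> \<F>"
  shows "detf n (\<lambda>i j. laplacian x (insert p ` R \<union> \<F>) (h i) (h j)) =
    (\<Prod>H\<in>R. weight x (insert p H)) *
    (\<Prod>F\<in>\<F>. \<Prod>v\<in>F. prefix_sum x p {u \<in> F. u < v} v / prefix_sum x p {u \<in> F. u < v} (v - 1))"
  using fin face closed
proof (induction "card \<F>" arbitrary: \<F>)
  case 0
  then have "\<F> = {}" by simp
  have fin: "finite H" "p \<notin> H" if "H \<in> R" for H
    using R(2)[OF that] finite_subset[of H "{p<..q}"] by auto
  have inj: "inj_on (insert p) R"
    using fin by (intro inj_onI) (metis Diff_insert_absorb)
  have incidence: "incidence H (insert p H') = (if H = H' then 1 else 0)" if "H \<in> R" "H' \<in> R" for H H'
  proof (rule incidence_insert_least)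
    show "p < v" if "v \<in> H'" for v using R(2)[OF \<open>H' \<in> R\<close>] that by auto
  qed (use fin that in auto)
  \<comment> \<open>For the cone alone the incidence matrix is the identity, so the Laplacian is
    diagonal.\<close>
  have "laplacian x (insert p ` R) H H' = (if H = H' then weight x (insert p H) else 0)"
    if "H \<in> R" "H' \<in> R" for H H'
  proof -
    have "laplacian x (insert p ` R) H H' =
        (\<Sum>H''\<in>R. if H = H'' then (if H = H' then weight x (insert p H) else 0) else 0)"
      unfolding laplacian_def sum.reindex[OF inj] o_def
      using that by (intro sum.cong) (auto simp: incidence)
    then show ?thesis using that R(1) by simp
  qed
  moreover have "h i \<in> R" if "i < n" for i using h that by (auto simp: bij_betw_def)
  moreover have "h i = h j \<longleftrightarrow> i = j" if "i < n" "j < n" for i j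
    using h that by (auto simp: bij_betw_def inj_on_def)
  ultimately have "detf n (\<lambda>i j. laplacian x (insert p ` R) (h i) (h j)) =
      detf n (\<lambda>i j. if i = j then weight x (insert p (h i)) else 0)"
    by (intro detf_cong) simp
  also have "\<dots> = (\<Prod>i<n. weight x (insert p (h i)))"
    by (subst det_upper_triangular[of _ n])
      (auto simp: diag_mat_def prod.list_conv_set_nth lessThan_atLeast0 intro!: prod.cong)
  also have "\<dots> = (\<Prod>H\<in>R. weight x (insert p H))"
    by (rule prod.reindex_bij_betw[OF h])
  finally show ?case using \<open>\<F> = {}\<close> by simp
next
  case (Suc c)
  let ?k = "Suc m"
  \<comment> \<open>\<open>s\<close> is strictly increasing in the componentwise order. So a face
    with the largest \<open>s\<close> is maximal, and removing it leaves an order ideal.\<close>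
  define s where "s G = (\<Sum>i<?k. el G i)" for G
  have ne: "\<F> \<noteq> {}" using Suc.hyps(2) by auto
  then have "Max (s ` \<F>) \<in> s ` \<F>" using Suc.prems(1) by (intro Max_in) auto
  then obtain F where F: "F \<in> \<F>" "s F = Max (s ` \<F>)" by auto
  then have smax: "s G \<le> s F" if "G \<in> \<F>" for G
    using that Suc.prems(1) by simp
  note F = F(1)
  define \<E> where "\<E> = \<F> - {F}"
  have fams: "finite \<E>" "F \<notin> \<E>" "insert F \<E> = \<F>" "c = card \<E>"
    using Suc.prems(1) Suc.hyps(2) F by (auto simp: \<E>_def)
  have faceF: "F \<subseteq> {p<..q}" "card F = ?k" using Suc.prems(2)[OF F] by auto
  have finF: "finite F" using faceF(1) finite_subset by blast
  have eq: "G = F" if G: "G \<in> \<F>" and le: "\<And>i. i < ?k \<Longrightarrow> el F i \<le> el G i" for G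
  proof -
    have "s G \<le> s F" by (rule smax[OF G])
    then have "el F i = el G i" if "i < ?k" for i
      using sum_mono_inv[of "el F" "{..<?k}" "el G" i] that le
        sum_mono[of "{..<?k}" "el F" "el G"] unfolding s_def by force
    moreover have "finite G" "card G = ?k" using Suc.prems(2)[OF G] finite_subset[of G "{p<..q}"] by auto
    ultimately show ?thesis
      using bij_betw_imp_surj_on[OF el_bij[of G]] bij_betw_imp_surj_on[OF el_bij[OF finF]] faceF(2)
      by (metis (no_types, lifting) image_cong lessThan_iff)
  qed
  have IH: "detf n (\<lambda>i j. laplacian x (insert p ` R \<union> \<E>) (h i) (h j)) =
    (\<Prod>H\<in>R. weight x (insert p H)) *
    (\<Prod>F\<in>\<E>. \<Prod>v\<in>F. prefix_sum x p {u \<in> F. u < v} v / prefix_sum x p {u \<in> F. u < v} (v - 1))"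
  proof (rule Suc.hyps(1)[OF fams(4)])
    show "finite \<E>" by (rule fams)
    show "G \<subseteq> {p<..q} \<and> card G = Suc m \<and> (\<forall>v\<in>G. G - {v} \<in> R)" if "G \<in> \<E>" for G
      using Suc.prems(2)[of G] that by (simp add: \<E>_def)
    show "G \<in> insert p ` R \<union> \<E>"
      if "F' \<in> \<E>" "G \<subseteq> {p..q}" "card G = Suc m" "\<And>i. i < Suc m \<Longrightarrow> el G i \<le> el F' i" for F' G
    proof -
      have "G \<noteq> F" using eq[of F'] that by (auto simp: \<E>_def)
      then show ?thesis using Suc.prems(3)[of F' G] that by (auto simp: \<E>_def)
    qed
  qed
  let ?S = "\<lambda>v. {u \<in> F. u < v}"
  \<comment> \<open>The value \<open>q + 1\<close> supplies the artificial point
    \<open>a k\<close>.\<close>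
  define a where "a i = (if i < ?k then el F i else q + 1)" for i
  define r where "r = case_nat 1 (\<lambda>i. prefix_sum x p (?S (el F i)) (el F i) / (weight x (?S (el F i)) * x i (el F i)))"
  have el_pq: "p < el F i" "el F i \<le> q" if "i < ?k" for i
    using el_in[of i F] faceF that by auto
  have sub: "F \<subseteq> {p<..}" using faceF(1) by auto
  note rec = prefix_sum_recursion[where x = x and p = p, OF finF sub _ nz(1), folded r_def]
  have a_el: "a i = el F i" "case_nat p a i = case_nat p (el F) i" if "i < ?k" for i
    using that by (auto simp: a_def split: nat.splits)
  interpret shifted_cochain p q ?k a r x
  proof
    show "a i < a (Suc i)" if "i < ?k" for i
      using that el_less[of i "Suc i" F] el_pq(2)[of i] faceF by (auto simp: a_def)
    show "p < a 0" "p \<le> q" "q < a ?k" "r 0 = 1" using el_pq pq by (auto simp: a_def r_def)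
    show "a i \<le> q" if "i < ?k" for i using that el_pq by (auto simp: a_def)
    show "r i * x i (case_nat p a i) + sum (x i) {case_nat p a i<..<a i} + x i (a i) = r (Suc i) * x i (a i)"
      if "i < ?k" for i
      unfolding a_el[OF that] by (rule rec(1)) (simp add: faceF that)
  qed
  have "detf n (\<lambda>i j. laplacian x (insert p ` R \<union> insert F \<E>) (h i) (h j)) =
    detf n (\<lambda>i j. laplacian x (insert p ` R \<union> \<E>) (h i) (h j)) * (\<Prod>i<?k. r (Suc i) / (r (Suc i) - 1))"
  proof (rule laplacian_step[OF refl R fams(1,2) _ _ _ _ _ _ h])
    show "G \<subseteq> {p<..q} \<and> card G = ?k \<and> (\<forall>v\<in>G. G - {v} \<in> R)" if "G \<in> insert F \<E>" for G
      using Suc.prems(2)[of G] that fams(3) by simp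
    show "el F i = a i" if "i < ?k" for i using a_el that by simp
    show "\<exists>i<?k. el G i < a i" if "G \<in> \<E>" for G
    proof (rule ccontr)
      assume neg: "\<not> ?thesis"
      have "el F i \<le> el G i" if "i < ?k" for i
        using neg that a_el(1)[OF that] by (metis not_less)
      then have "G = F" using eq[of G] \<open>G \<in> \<E>\<close> by (simp add: \<E>_def)
      then show False using \<open>G \<in> \<E>\<close> fams(2) by simp
    qed
    show "G \<in> insert p ` R \<union> insert F \<E>"
      if "G \<subseteq> {p..q}" "card G = ?k" "\<And>i. i < ?k \<Longrightarrow> el G i \<le> a i" for G
      unfolding fams(3) using that(1,2) by (rule Suc.prems(3)[OF F]) (use that(3) a_el(1) in fastforce)
    show "r (Suc i) \<noteq> 1" if "i < ?k" for i
      using that faceF finF el_pq[OF that] by (intro rec(3) nz(2)) auto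
    show "weight x F \<noteq> 0" using nz(1) by (simp add: list_weight_def)
  qed
  also have "(\<Prod>i<?k. r (Suc i) / (r (Suc i) - 1)) =
      (\<Prod>i<card F. prefix_sum x p (?S (el F i)) (el F i) / prefix_sum x p (?S (el F i)) (el F i - 1))"
    using faceF by (intro prod.cong rec(2)) auto
  also have "\<dots> = (\<Prod>v\<in>F. prefix_sum x p (?S v) v / prefix_sum x p (?S v) (v - 1))"
    by (rule prod_el[OF finF])
  finally have "detf n (\<lambda>i j. laplacian x (insert p ` R \<union> \<F>) (h i) (h j)) =
    (\<Prod>H\<in>R. weight x (insert p H)) *
    (\<Prod>F\<in>\<E>. \<Prod>v\<in>F. prefix_sum x p {u \<in> F. u < v} v / prefix_sum x p {u \<in> F. u < v} (v - 1)) *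
    (\<Prod>v\<in>F. prefix_sum x p (?S v) v / prefix_sum x p (?S v) (v - 1))"
    unfolding fams(3) IH .
  also have "\<dots> = (\<Prod>H\<in>R. weight x (insert p H)) *
    (\<Prod>F\<in>insert F \<E>. \<Prod>v\<in>F. prefix_sum x p {u \<in> F. u < v} v / prefix_sum x p {u \<in> F. u < v} (v - 1))"
    unfolding prod.insert[OF fams(1,2)] by (simp only: mult_ac)
  finally show ?case unfolding fams(3) .
qed

section \<open>Telescoping to critical pairs\<close>

text \<open>The numerator at \<open>(F, v)\<close> cancels the denominator at \<open>(F, v + 1)\<close> if \<open>v + 1 \<in> F\<close>, and otherwise the one at
  \<open>(insert (v + 1) (F - {v}), v + 1)\<close> if that set lies in \<open>\<F>\<close>.\<close>

lemma prod_telescope_critical: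
  fixes f :: "int set \<Rightarrow> int \<Rightarrow> 'a::field"
  assumes fin: "finite \<F>" "\<And>F. F \<in> \<F> \<Longrightarrow> finite F \<and> F \<subseteq> {p<..}"
    and shift: "\<And>F b. F \<in> \<F> \<Longrightarrow> b \<in> F \<Longrightarrow> b - 1 \<notin> F \<Longrightarrow> b \<noteq> p + 1 \<Longrightarrow> insert (b - 1) (F - {b}) \<in> \<F>"
    and nz: "\<And>S c. finite S \<Longrightarrow> p \<le> c \<Longrightarrow> f S c \<noteq> 0"
    and ext: "\<And>S c. finite S \<Longrightarrow> S \<subseteq> {p<..<c} \<Longrightarrow> p < c \<Longrightarrow> f (insert c S) c = f S c"
    and base: "f {} p = 1"
  shows "(\<Prod>F\<in>\<F>. \<Prod>v\<in>F. f {u \<in> F. u < v} v / f {u \<in> F. u < v} (v - 1)) =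
    (\<Prod>(F, v)\<in>{(F, v). F \<in> \<F> \<and> v \<in> F \<and> v + 1 \<notin> F \<and> insert (v + 1) (F - {v}) \<notin> \<F>}. f {u \<in> F. u < v} v)"
    (is "_ = (\<Prod>(F, v)\<in>?C. _)")
proof -
  let ?A = "Sigma \<F> (\<lambda>F. F)"
  let ?n = "\<lambda>(F, v). f {u \<in> F. u < v} v" and ?m = "\<lambda>(F, v). f {u \<in> F. u < v} (v - 1)"
  let ?N1 = "{(F, v) \<in> ?A. v + 1 \<in> F}"
  let ?N2 = "{(F, v) \<in> ?A. v + 1 \<notin> F \<and> insert (v + 1) (F - {v}) \<in> \<F>}"
  let ?M1 = "{(F, v) \<in> ?A. v - 1 \<in> F}"
  let ?M2 = "{(F, v) \<in> ?A. v - 1 \<notin> F \<and> v \<noteq> p + 1}"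
  let ?M3 = "{(F, v) \<in> ?A. v = p + 1}"
  have finA: "finite ?A" using fin by auto
  have pF: "p < v" if "F \<in> \<F>" "v \<in> F" for F v using fin(2)[OF that(1)] that(2) by auto
  have finS: "finite {u \<in> F. u < v}" if "F \<in> \<F>" for F v using fin(2)[OF that] by simp
  have n_split: "prod ?n ?A = prod ?n ?N1 * (prod ?n ?N2 * prod ?n ?C)"
  proof -
    have "?A = ?N1 \<union> (?N2 \<union> ?C)" by blast
    moreover have "prod ?n (?N1 \<union> (?N2 \<union> ?C)) = prod ?n ?N1 * prod ?n (?N2 \<union> ?C)"
      by (rule prod.union_disjoint) (auto intro: finite_subset[OF _ finA])
    moreover have "prod ?n (?N2 \<union> ?C) = prod ?n ?N2 * prod ?n ?C"
      by (rule prod.union_disjoint) (auto intro: finite_subset[OF _ finA])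
    ultimately show ?thesis by (simp only:)
  qed
  have m_split: "prod ?m ?A = prod ?m ?M1 * (prod ?m ?M2 * prod ?m ?M3)"
  proof -
    have "?A = ?M1 \<union> (?M2 \<union> ?M3)" by blast
    moreover have "prod ?m (?M1 \<union> (?M2 \<union> ?M3)) = prod ?m ?M1 * prod ?m (?M2 \<union> ?M3)"
      by (rule prod.union_disjoint) (auto intro: finite_subset[OF _ finA] dest: pF)
    moreover have "prod ?m (?M2 \<union> ?M3) = prod ?m ?M2 * prod ?m ?M3"
      by (rule prod.union_disjoint) (auto intro: finite_subset[OF _ finA])
    ultimately show ?thesis by (simp only:)
  qed
  \<comment> \<open>The set below \<open>v + 1\<close> is the set below \<open>v\<close> with
    \<open>v\<close> added, and by \<open>ext\<close> this addition leaves the value of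
    \<open>f\<close> at \<open>v\<close> unchanged.\<close>
  have 1: "prod ?n ?N1 = prod ?m ?M1"
  proof (rule prod.reindex_bij_witness[of _ "\<lambda>(F, v). (F, v - 1)" "\<lambda>(F, v). (F, v + 1)"])
    fix Fv assume "Fv \<in> ?N1"
    then obtain F v where Fv: "Fv = (F, v)" "F \<in> \<F>" "v \<in> F" "v + 1 \<in> F" by auto
    have "{u \<in> F. u < v + 1} = insert v {u \<in> F. u < v}" using Fv by auto
    moreover have "f (insert v {u \<in> F. u < v}) v = f {u \<in> F. u < v} v"
      using pF[OF Fv(2)] Fv finS by (intro ext) auto
    ultimately show "?m ((\<lambda>(F, v). (F, v + 1)) Fv) = ?n Fv" using Fv by simp
  qed auto
  have 2: "prod ?n ?N2 = prod ?m ?M2"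
  proof (rule prod.reindex_bij_witness[of _ "\<lambda>(F, v). (insert (v - 1) (F - {v}), v - 1)"
        "\<lambda>(F, v). (insert (v + 1) (F - {v}), v + 1)"])
    fix Fv assume "Fv \<in> ?N2"
    then obtain F v where Fv: "Fv = (F, v)" "F \<in> \<F>" "v \<in> F" "v + 1 \<notin> F" "insert (v + 1) (F - {v}) \<in> \<F>"
      by auto
    show "(\<lambda>(F, v). (insert (v - 1) (F - {v}), v - 1)) ((\<lambda>(F, v). (insert (v + 1) (F - {v}), v + 1)) Fv) = Fv"
      using Fv by auto
    show "(\<lambda>(F, v). (insert (v + 1) (F - {v}), v + 1)) Fv \<in> ?M2"
      using Fv pF[of F v] by auto
    have "{u \<in> insert (v + 1) (F - {v}). u < v + 1} = {u \<in> F. u < v}" using Fv by auto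
    then show "?m ((\<lambda>(F, v). (insert (v + 1) (F - {v}), v + 1)) Fv) = ?n Fv" using Fv by simp
  next
    fix Fv assume "Fv \<in> ?M2"
    then obtain F v where Fv: "Fv = (F, v)" "F \<in> \<F>" "v \<in> F" "v - 1 \<notin> F" "v \<noteq> p + 1"
      by auto
    show "(\<lambda>(F, v). (insert (v + 1) (F - {v}), v + 1)) ((\<lambda>(F, v). (insert (v - 1) (F - {v}), v - 1)) Fv) = Fv"
      using Fv by auto
    have "insert v (insert (v - 1) (F - {v}) - {v - 1}) = F" using Fv by auto
    then show "(\<lambda>(F, v). (insert (v - 1) (F - {v}), v - 1)) Fv \<in> ?N2"
      using Fv shift[of F v] by simp
  qed
  \<comment> \<open>\<open>p + 1\<close> is the smallest possible vertex, so the set below it is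
    empty and \<open>base\<close> applies.\<close>
  have 3: "prod ?m ?M3 = 1"
  proof (rule prod.neutral, rule ballI)
    fix Fv assume "Fv \<in> ?M3"
    then obtain F where F: "Fv = (F, p + 1)" "F \<in> \<F>" by auto
    have "{u \<in> F. u \<le> p} = {}" using pF[OF F(2)] by fastforce
    note this [simp]
    show "?m Fv = 1" using F base by simp
  qed
  have "(\<Prod>F\<in>\<F>. \<Prod>v\<in>F. f {u \<in> F. u < v} v / f {u \<in> F. u < v} (v - 1)) = (\<Prod>Fv\<in>?A. ?n Fv / ?m Fv)"
    using fin by (subst prod.Sigma) (auto intro!: prod.cong)
  also have "\<dots> = prod ?n ?A / prod ?m ?A" by (rule prod_dividef)
  also have "\<dots> = prod ?n ?C"
  proof -
    have "prod ?m ?A \<noteq> 0"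
      unfolding prod_zero_iff[OF finA] using nz[OF finS] pF by fastforce
    then show ?thesis unfolding n_split m_split 1 2 3 by simp
  qed
  finally show ?thesis by (simp add: case_prod_unfold)
qed

section \<open>Weights as polynomials and the raising operator\<close>

lemma list_weight_Cons: "list_weight x (y # xs) = x 0 y * list_weight (\<lambda>i. x (Suc i)) xs"
  unfolding list_weight_def by (simp add: prod.lessThan_Suc_shift del: prod.lessThan_Suc)

text \<open>Positions count from 0, but the first index of the indeterminates counts from 1.\<close>

abbreviation y_poly :: "nat \<Rightarrow> int \<Rightarrow> indet_poly" where
  "y_poly i j \<equiv> (indet (Suc i) j)\<^sup>2"

abbreviation x_frac :: "nat \<Rightarrow> int \<Rightarrow> indet_poly fract" where
  "x_frac i j \<equiv> to_fract (y_poly i j)"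

lemma X_mon_list_weight: "X_mon S = list_weight y_poly (sorted_list_of_multiset S)"
proof -
  have "size S = length (sorted_list_of_multiset S)"
    by (metis mset_sorted_list_of_multiset size_mset)
  then show ?thesis by (simp add: X_mon_def x_mon_def list_weight_def prod_power_distrib)
qed

lemma to_fract_prod: "to_fract (prod f A) = (\<Prod>a\<in>A. to_fract (f a))"
  by (induction A rule: infinite_finite_induct) auto

lemma to_fract_list_weight: "to_fract (list_weight y_poly xs) = list_weight x_frac xs"
  by (simp add: list_weight_def to_fract_prod del: power2_eq_square)

lemma to_fract_X_mon: "to_fract (X_mon S) = list_weight x_frac (sorted_list_of_multiset S)"
  by (simp only: X_mon_list_weight to_fract_list_weight)

lemma indet_power: "indet a j ^ n = Poly_Mapping.single (Poly_Mapping.single (a, j) n) 1"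
  by (induction n) (simp_all add: indet_def mult_single single_add[symmetric] flip: single_one)

lemma raising_single:
  "raising (Poly_Mapping.single m 1) = (\<Prod>(a, j)\<in>Poly_Mapping.keys m. indet (a + 1) j ^ Poly_Mapping.lookup m (a, j))"
  by (simp add: raising_def)

text \<open>\<open>raising\<close> is defined term by term. Multiplicativity on monomials is enough,
  since \<open>z_frac\<close> applies it only to \<open>X_mon\<close>.\<close>

lemma raising_single_add:
  "raising (Poly_Mapping.single (m + m') 1) = raising (Poly_Mapping.single m 1) * raising (Poly_Mapping.single m' 1)"
proof -
  let ?K = "Poly_Mapping.keys m \<union> Poly_Mapping.keys m'"
  let ?f = "\<lambda>m (a, j). indet (a + 1) j ^ Poly_Mapping.lookup m (a, j)"
  have extend: "raising (Poly_Mapping.single m'' 1) = prod (?f m'') ?K"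
    if "Poly_Mapping.keys m'' \<subseteq> ?K" for m''
    unfolding raising_single using that
    by (intro prod.mono_neutral_left) (auto simp: in_keys_iff)
  have "prod (?f (m + m')) ?K = prod (?f m) ?K * prod (?f m') ?K"
    unfolding prod.distrib[symmetric]
    by (rule prod.cong) (auto simp: lookup_add power_add)
  then show ?thesis
    using extend[of m] extend[of m'] extend[of "m + m'"] keys_add[of m m'] by simp
qed

text \<open>The coefficient 1 serves twice: it reduces \<open>raising\<close> to monomials, and it
  excludes cancellation in sums of weights. The induction appends at the end because there the
  position is the length of the list.\<close>

lemma list_weight_y_poly_monomial:
  "\<exists>m. list_weight y_poly xs = Poly_Mapping.single m 1 \<and>
    raising (Poly_Mapping.single m 1) = list_weight (\<lambda>i. y_poly (Suc i)) xs"
proof (induction xs rule: rev_induct)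
  case Nil
  have "list_weight y_poly [] = Poly_Mapping.single 0 1" by (simp add: list_weight_def)
  moreover have "raising (Poly_Mapping.single 0 1) = list_weight (\<lambda>i. y_poly (Suc i)) []"
    by (simp only: raising_single) (simp add: list_weight_def)
  ultimately show ?case by blast
next
  case (snoc z xs)
  then obtain m where m: "list_weight y_poly xs = Poly_Mapping.single m 1"
    "raising (Poly_Mapping.single m 1) = list_weight (\<lambda>i. y_poly (Suc i)) xs" by blast
  let ?m = "Poly_Mapping.single (Suc (length xs), z) (2::nat)"
  have "list_weight y_poly (xs @ [z]) = Poly_Mapping.single (m + ?m) 1"
    by (simp only: list_weight_snoc m(1)) (simp add: indet_power mult_single)
  moreover have "raising (Poly_Mapping.single (m + ?m) 1) = list_weight (\<lambda>i. y_poly (Suc i)) (xs @ [z])"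
    unfolding raising_single_add m list_weight_snoc by (simp add: raising_single)
  ultimately show ?case by blast
qed

lemma raising_list_weight: "raising (list_weight y_poly xs) = list_weight (\<lambda>i. y_poly (Suc i)) xs"
  using list_weight_y_poly_monomial by metis

text \<open>All coefficients are nonnegative, so the monomial of one summand cannot cancel.\<close>

lemma sum_list_weight_nonzero:
  assumes "finite A" "A \<noteq> {}"
  shows "(\<Sum>j\<in>A. list_weight y_poly (g j)) \<noteq> 0"
proof -
  have nonneg: "Poly_Mapping.lookup (list_weight y_poly (g j)) m \<ge> 0" for j m
    using list_weight_y_poly_monomial[of "g j"] by (auto simp: lookup_single when_def)
  obtain j m where j: "j \<in> A" "list_weight y_poly (g j) = Poly_Mapping.single m 1"
    using assms(2) list_weight_y_poly_monomial by blast
  have "0 < Poly_Mapping.lookup (list_weight y_poly (g j)) m" unfolding j(2) by simp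
  also have "\<dots> \<le> (\<Sum>j\<in>A. Poly_Mapping.lookup (list_weight y_poly (g j)) m)"
    using assms(1) j(1) nonneg by (intro member_le_sum) auto
  finally have "Poly_Mapping.lookup (\<Sum>j\<in>A. list_weight y_poly (g j)) m \<noteq> 0" by (simp add: lookup_sum)
  then show ?thesis by (metis lookup_zero)
qed

lemma x_frac_nonzero: "x_frac i j \<noteq> 0"
proof -
  have "indet (Suc i) j \<noteq> 0" by (simp add: indet_def)
  then show ?thesis by simp
qed

lemma prefix_sum_x_frac_nonzero: "p \<le> m \<Longrightarrow> prefix_sum x_frac p S m \<noteq> 0"
  unfolding prefix_sum_def to_fract_list_weight[symmetric] to_fract_sum[symmetric] to_fract_eq_0_iff
  by (rule sum_list_weight_nonzero) auto

lemma prefix_sum_eq_sum_X_mon: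
  assumes "finite S"
  shows "prefix_sum x_frac p S m = (\<Sum>j\<in>{p..m}. to_fract (X_mon (mset_set S + {#j#})))"
  unfolding prefix_sum_def to_fract_X_mon by (simp add: sorted_list_of_multiset_insert)

lemma sorted_list_insert_least:
  fixes p :: int
  assumes "finite S" "\<And>v. v \<in> S \<Longrightarrow> p < v"
  shows "sorted_list_of_set (insert p S) = p # sorted_list_of_set S"
  by (rule sorted_list_eq_iff_set) (use assms in auto)

text \<open>Raising frees the first position, and \<open>p\<close>, smaller than all of
  \<open>S\<close>, takes it. This identifies the two forms of the product in the theorem.\<close>

lemma to_fract_raising_X_mon:
  assumes "finite S" "\<And>v. v \<in> S \<Longrightarrow> p < v"
  shows "to_fract (raising (X_mon (mset_set S))) * to_fract (X_mon {#p#}) = to_fract (X_mon (mset_set (insert p S)))"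
proof -
  have "X_mon {#p#} = y_poly 0 p"
    by (simp add: X_mon_def x_mon_def)
  then show ?thesis
    unfolding to_fract_mult[symmetric] X_mon_list_weight[of "mset_set _"]
    by (simp add: raising_list_weight sorted_list_insert_least[OF assms] list_weight_Cons sorted_list_of_mset_set)
qed

text \<open>A critical pair determines \<open>v\<close> as the only element of \<open>F - B\<close>,
  and the condition on cardinalities says that \<open>v + 1\<close> is not in
  \<open>F\<close>.\<close>

lemma critical_pairs_eq:
  assumes fin: "\<And>F. F \<in> \<F> \<Longrightarrow> finite F"
  defines "C \<equiv> {(F, v). F \<in> \<F> \<and> v \<in> F \<and> v + 1 \<notin> F \<and> insert (v + 1) (F - {v}) \<notin> \<F>}"
  shows "bij_betw (\<lambda>(F, v). (F, insert (v + 1) (F - {v}))) C (critical_pairs \<F>)"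
    and "(F, v) \<in> C \<Longrightarrow> long_signature \<F> (F, insert (v + 1) (F - {v})) = ({u \<in> F. u < v}, {least_vertex \<F>..v})"
proof -
  let ?B = "\<lambda>F v. insert (v + 1) (F - {v})"
  have diff: "F - ?B F v = {v}" if "(F, v) \<in> C" for F v using that by (auto simp: C_def)
  have card_iff: "card (?B F v) = card F \<longleftrightarrow> v + 1 \<notin> F" if "finite F" "v \<in> F" for F :: "int set" and v
  proof (cases "v + 1 \<in> F")
    case True
    then have "?B F v = F - {v}" by auto
    then show ?thesis using that True by (metis card_Diff1_less less_irrefl)
  next
    case False
    then show ?thesis using that card_Suc_Diff1[of F v] by simp
  qed
  show "bij_betw (\<lambda>(F, v). (F, ?B F v)) C (critical_pairs \<F>)"
    unfolding bij_betw_def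
  proof
    show "inj_on (\<lambda>(F, v). (F, ?B F v)) C"
    proof (rule inj_onI)
      fix Fv Gw
      assume C: "Fv \<in> C" "Gw \<in> C"
        and eq: "(\<lambda>(F, v). (F, ?B F v)) Fv = (\<lambda>(F, v). (F, ?B F v)) Gw"
      obtain F v where Fv: "Fv = (F, v)" by (cases Fv)
      obtain G w where Gw: "Gw = (G, w)" by (cases Gw)
      have G: "G = F" and B: "?B F v = ?B F w" using eq Fv Gw by auto
      have "F - ?B F v = {v}" "F - ?B F w = {w}"
        using C diff[of F v] diff[of F w] unfolding Fv Gw G by auto
      then show "Fv = Gw" unfolding Fv Gw G B by simp
    qed
    show "(\<lambda>(F, v). (F, ?B F v)) ` C = critical_pairs \<F>"
    proof (intro equalityI subsetI)
      fix AB assume "AB \<in> (\<lambda>(F, v). (F, ?B F v)) ` C"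
      then obtain F v where "AB = (F, ?B F v)" "(F, v) \<in> C" by auto
      then show "AB \<in> critical_pairs \<F>"
        using card_iff fin unfolding critical_pairs_def C_def by blast
    next
      fix AB assume "AB \<in> critical_pairs \<F>"
      then obtain F v where "AB = (F, ?B F v)" "F \<in> \<F>" "?B F v \<notin> \<F>" "v \<in> F" "card (?B F v) = card F"
        unfolding critical_pairs_def by blast
      moreover from this have "(F, v) \<in> C" using card_iff fin unfolding C_def by blast
      ultimately show "AB \<in> (\<lambda>(F, v). (F, ?B F v)) ` C" by (intro image_eqI[of _ _ "(F, v)"]) auto
    qed
  qed
  show "(F, v) \<in> C \<Longrightarrow> long_signature \<F> (F, ?B F v) = ({u \<in> F. u < v}, {least_vertex \<F>..v})"
    using diff[of F v] by (simp add: long_signature_def Let_def)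
qed

lemma prod_LSG:
  assumes "finite \<F>" "\<And>F. F \<in> \<F> \<Longrightarrow> finite F"
  shows "(\<Prod>(S, T)\<in>#LSG \<F>. f S T) =
    (\<Prod>(F, v)\<in>{(F, v). F \<in> \<F> \<and> v \<in> F \<and> v + 1 \<notin> F \<and> insert (v + 1) (F - {v}) \<notin> \<F>}.
      f {u \<in> F. u < v} {least_vertex \<F>..v})"
proof -
  let ?C = "{(F, v). F \<in> \<F> \<and> v \<in> F \<and> v + 1 \<notin> F \<and> insert (v + 1) (F - {v}) \<notin> \<F>}"
  let ?f = "\<lambda>AB. case long_signature \<F> AB of (S, T) \<Rightarrow> f S T"
  have "(\<Prod>(S, T)\<in>#LSG \<F>. f S T) = (\<Prod>AB\<in>critical_pairs \<F>. ?f AB)"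
    by (simp add: LSG_def image_mset.compositionality comp_def prod_unfold_prod_mset)
  also have "\<dots> = (\<Prod>Fv\<in>?C. ?f ((\<lambda>(F, v). (F, insert (v + 1) (F - {v}))) Fv))"
    using assms(2) by (intro prod.reindex_bij_betw[symmetric] critical_pairs_eq(1))
  also have "\<dots> = (\<Prod>(F, v)\<in>?C. f {u \<in> F. u < v} {least_vertex \<F>..v})"
  proof (rule prod.cong[OF refl])
    fix Fv assume Fv: "Fv \<in> ?C"
    obtain F v where "Fv = (F, v)" by (cases Fv)
    with Fv critical_pairs_eq(2)[of \<F> F v] assms(2)
    show "?f ((\<lambda>(F, v). (F, insert (v + 1) (F - {v}))) Fv) =
        (case Fv of (F, v) \<Rightarrow> f {u \<in> F. u < v} {least_vertex \<F>..v})" by simp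
  qed
  finally show ?thesis .
qed

text \<open>Adding \<open>c\<close> multiplies the prefix sum up to \<open>c\<close> and the weight
  of \<open>p \<union> S\<close> by the same factor, since in all lists involved \<open>c\<close>
  comes last, at position \<open>Suc (card S)\<close>. This is the condition \<open>ext\<close> of
  the telescoping.\<close>

lemma ratio_extend:
  fixes x :: "nat \<Rightarrow> int \<Rightarrow> 'a::field"
  assumes nz: "\<And>i j. x i j \<noteq> 0" and S: "finite S" "S \<subseteq> {p<..<c}" "p < c"
  shows "prefix_sum x p (insert c S) c / weight x (insert p (insert c S)) = prefix_sum x p S c / weight x (insert p S)"
proof -
  let ?s = "sorted_list_of_set S"
  have c: "sorted_list_of_set (insert c S) = ?s @ [c]"
    by (rule sorted_list_eq_iff_set) (use S in \<open>auto simp: sorted_wrt_append\<close>)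
  have "prefix_sum x p (insert c S) c = (\<Sum>j\<in>{p..c}. list_weight x (insort j ?s) * x (Suc (card S)) c)"
    unfolding prefix_sum_def c by (rule sum.cong) (auto simp: insort_snoc_le list_weight_snoc)
  also have "\<dots> = prefix_sum x p S c * x (Suc (card S)) c"
    by (simp add: prefix_sum_def sum_distrib_right)
  finally have n: "prefix_sum x p (insert c S) c = prefix_sum x p S c * x (Suc (card S)) c" .
  have "sorted_list_of_set (insert p (insert c S)) = (p # ?s) @ [c]"
    using S c by (subst sorted_list_insert_least) auto
  moreover have "sorted_list_of_set (insert p S) = p # ?s"
    using S by (intro sorted_list_insert_least) auto
  ultimately have "weight x (insert p (insert c S)) = weight x (insert p S) * x (Suc (card S)) c"
    by (simp only: list_weight_snoc) simp
  then show ?thesis using n nz by simp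
qed

theorem prod_ratio_LSG:
  assumes fin: "finite \<F>" "\<And>F. F \<in> \<F> \<Longrightarrow> finite F \<and> F \<subseteq> {p<..}"
    and shift: "\<And>F b. F \<in> \<F> \<Longrightarrow> b \<in> F \<Longrightarrow> b - 1 \<notin> F \<Longrightarrow> b \<noteq> p + 1 \<Longrightarrow> insert (b - 1) (F - {b}) \<in> \<F>"
    and least: "\<F> \<noteq> {} \<Longrightarrow> least_vertex \<F> = p + 1"
  shows "(\<Prod>F\<in>\<F>. \<Prod>v\<in>F. prefix_sum x_frac p {u \<in> F. u < v} v / prefix_sum x_frac p {u \<in> F. u < v} (v - 1)) =
      (\<Prod>(S, T)\<in>#LSG \<F>. (\<Sum>j\<in>insert p T. to_fract (X_mon (mset_set S + {#j#}))) / to_fract (X_mon (mset_set (insert p S))))"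
    and "(\<Prod>(S, T)\<in>#LSG \<F>. z_frac (mset_set S) (mset_set (insert p T)) / to_fract (X_mon {#p#})) =
      (\<Prod>(S, T)\<in>#LSG \<F>. (\<Sum>j\<in>insert p T. to_fract (X_mon (mset_set S + {#j#}))) / to_fract (X_mon (mset_set (insert p S))))"
proof -
  let ?C = "{(F, v). F \<in> \<F> \<and> v \<in> F \<and> v + 1 \<notin> F \<and> insert (v + 1) (F - {v}) \<notin> \<F>}"
  \<comment> \<open>The weight is independent of \<open>c\<close> and cancels in each quotient of
    values at \<open>v\<close> and \<open>v - 1\<close>; it is there to make \<open>ext\<close> and
    \<open>base\<close> hold.\<close>
  let ?f = "\<lambda>S c. prefix_sum x_frac p S c / weight x_frac (insert p S)"
  have wt_nz: "weight x_frac S \<noteq> 0" for S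
    unfolding list_weight_def using x_frac_nonzero by auto
  have X: "to_fract (X_mon (mset_set S)) = weight x_frac S" for S
    by (simp only: to_fract_X_mon sorted_list_of_mset_set)
  have finF: "finite F" if "F \<in> \<F>" for F using fin(2) that by blast
  have sum_term: "?f {u \<in> F. u < v} v = (\<Sum>j\<in>insert p {least_vertex \<F>..v}. to_fract (X_mon (mset_set {u \<in> F. u < v} + {#j#}))) /
      to_fract (X_mon (mset_set (insert p {u \<in> F. u < v})))"
    and z_term: "z_frac (mset_set {u \<in> F. u < v}) (mset_set (insert p {least_vertex \<F>..v})) / to_fract (X_mon {#p#}) = ?f {u \<in> F. u < v} v"
    if "F \<in> \<F>" "v \<in> F" for F v
  proof -
    let ?S = "{u \<in> F. u < v}"
    have S: "finite ?S" "\<And>u. u \<in> ?S \<Longrightarrow> p < u" and v: "p < v" using fin(2)[OF that(1)] that(2) by auto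
    have "\<F> \<noteq> {}" using that(1) by auto
    \<comment> \<open>The long signature starts at \<open>p + 1\<close>, so adding \<open>p\<close>
      gives exactly the range of the prefix sum.\<close>
    then have T: "insert p {least_vertex \<F>..v} = {p..v}" using least v by auto
    show t: "?f ?S v = (\<Sum>j\<in>insert p {least_vertex \<F>..v}. to_fract (X_mon (mset_set ?S + {#j#}))) /
      to_fract (X_mon (mset_set (insert p ?S)))"
      unfolding T X prefix_sum_eq_sum_X_mon[OF S(1)] ..
    have "z_frac (mset_set ?S) (mset_set {p..v}) = prefix_sum x_frac p ?S v / to_fract (raising (X_mon (mset_set ?S)))"
      by (simp only: z_frac_def prefix_sum_eq_sum_X_mon[OF S(1)] sum_unfold_sum_mset)
    then show "z_frac (mset_set ?S) (mset_set (insert p {least_vertex \<F>..v})) / to_fract (X_mon {#p#}) = ?f ?S v"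
      unfolding T by (simp only: divide_divide_eq_left to_fract_raising_X_mon[OF S] X)
  qed
  have "(\<Prod>F\<in>\<F>. \<Prod>v\<in>F. prefix_sum x_frac p {u \<in> F. u < v} v / prefix_sum x_frac p {u \<in> F. u < v} (v - 1)) =
      (\<Prod>F\<in>\<F>. \<Prod>v\<in>F. ?f {u \<in> F. u < v} v / ?f {u \<in> F. u < v} (v - 1))"
    using wt_nz by (intro prod.cong refl) simp
  also have "\<dots> = (\<Prod>(F, v)\<in>?C. ?f {u \<in> F. u < v} v)"
  proof (rule prod_telescope_critical[OF fin shift])
    show "?f S c \<noteq> 0" if "finite S" "p \<le> c" for S c
      using prefix_sum_x_frac_nonzero[OF that(2)] wt_nz by simp
    show "?f (insert c S) c = ?f S c" if "finite S" "S \<subseteq> {p<..<c}" "p < c" for S c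
      by (rule ratio_extend[OF x_frac_nonzero that])
    show "?f {} p = 1" using x_frac_nonzero[of 0 p] by (simp add: prefix_sum_def list_weight_def)
  qed
  also have "\<dots> = (\<Prod>(S, T)\<in>#LSG \<F>. (\<Sum>j\<in>insert p T. to_fract (X_mon (mset_set S + {#j#}))) / to_fract (X_mon (mset_set (insert p S))))"
    by (rule trans[OF _ prod_LSG[OF fin(1) finF, symmetric]], rule prod.cong[OF refl]) (use sum_term in auto)
  finally show "(\<Prod>F\<in>\<F>. \<Prod>v\<in>F. prefix_sum x_frac p {u \<in> F. u < v} v / prefix_sum x_frac p {u \<in> F. u < v} (v - 1)) =
      (\<Prod>(S, T)\<in>#LSG \<F>. (\<Sum>j\<in>insert p T. to_fract (X_mon (mset_set S + {#j#}))) / to_fract (X_mon (mset_set (insert p S))))" .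
  show "(\<Prod>(S, T)\<in>#LSG \<F>. z_frac (mset_set S) (mset_set (insert p T)) / to_fract (X_mon {#p#})) =
      (\<Prod>(S, T)\<in>#LSG \<F>. (\<Sum>j\<in>insert p T. to_fract (X_mon (mset_set S + {#j#}))) / to_fract (X_mon (mset_set (insert p S))))"
  proof -
    note prod_LSG[OF fin(1) finF, of "\<lambda>S T. z_frac (mset_set S) (mset_set (insert p T)) / to_fract (X_mon {#p#})"]
    also have "(\<Prod>(F, v)\<in>?C. z_frac (mset_set {u \<in> F. u < v}) (mset_set (insert p {least_vertex \<F>..v})) / to_fract (X_mon {#p#})) =
        (\<Prod>(F, v)\<in>?C. (\<Sum>j\<in>insert p {least_vertex \<F>..v}. to_fract (X_mon (mset_set {u \<in> F. u < v} + {#j#}))) /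
          to_fract (X_mon (mset_set (insert p {u \<in> F. u < v}))))"
      by (rule prod.cong[OF refl]) (use sum_term z_term in auto)
    also note prod_LSG[OF fin(1) finF, symmetric,
      of "\<lambda>S T. (\<Sum>j\<in>insert p T. to_fract (X_mon (mset_set S + {#j#}))) / to_fract (X_mon (mset_set (insert p S)))"]
    finally show ?thesis .
  qed
qed

section \<open>Reduced homology of shifted complexes\<close>

lemma lookup_boundary_frag_of: "Poly_Mapping.lookup (boundary (frag_of G)) H = incidence H G"
  by (cases "finite G") (auto simp: boundary_def incidence_def lookup_sum if_distrib when_def cong: if_cong intro!: sum.cong)

lemma lookup_boundary:
  assumes "finite A" "Poly_Mapping.keys c \<subseteq> A"
  shows "Poly_Mapping.lookup (boundary c) H = (\<Sum>G\<in>A. Poly_Mapping.lookup c G * incidence H G)"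
proof -
  have "boundary c = (\<Sum>G\<in>Poly_Mapping.keys c. frag_cmul (Poly_Mapping.lookup c G) (boundary (frag_of G)))"
    by (simp add: boundary_def frag_extend_def)
  then have "Poly_Mapping.lookup (boundary c) H = (\<Sum>G\<in>Poly_Mapping.keys c. Poly_Mapping.lookup c G * incidence H G)"
    by (simp add: lookup_sum lookup_boundary_frag_of)
  also have "\<dots> = (\<Sum>G\<in>A. Poly_Mapping.lookup c G * incidence H G)"
    using assms by (intro sum.mono_neutral_left) (auto simp: in_keys_iff)
  finally show ?thesis .
qed

lemma boundary_diff: "boundary (a - b) = boundary a - boundary b"
  by (simp add: boundary_def frag_extend_diff)

lemma boundary_add: "boundary (a + b) = boundary a + boundary b"
  by (simp add: boundary_def frag_extend_add)

lemma boundary_cmul: "boundary (frag_cmul k a) = frag_cmul k (boundary a)"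
  by (simp add: boundary_def frag_extend_cmul)

lemma boundary_0 [simp]: "boundary 0 = 0"
  by (simp add: boundary_def)

lemma boundary_sum: "boundary (\<Sum>i\<in>I. f i) = (\<Sum>i\<in>I. boundary (f i))"
  by (induction I rule: infinite_finite_induct) (auto simp: boundary_add)

lemma boundary_frag_of:
  "boundary (frag_of F) = (\<Sum>v\<in>F. frag_cmul ((- 1) ^ card {u \<in> F. u < v}) (frag_of (F - {v})))"
  by (simp add: boundary_def)

text \<open>Exchanging the two removed vertices reverses the sign, because removing the smaller one
  first lowers the position of the larger. So the double sum is its own negative, which forces zero
  for integer coefficients.\<close>

lemma boundary_boundary_frag_of: "boundary (boundary (frag_of F)) = 0"
proof (cases "finite F")
  case True
  let ?s = "\<lambda>v w. (- 1 :: int) ^ card {u \<in> F. u < v} * (- 1) ^ card {u \<in> F - {v}. u < w}"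
  have anti: "?s w v = - ?s v w" if "v \<in> F" "w \<in> F" "v < w" for v w
  proof -
    have "{u \<in> F. u < w} = insert v {u \<in> F - {v}. u < w}" using that by auto
    then have "card {u \<in> F. u < w} = Suc (card {u \<in> F - {v}. u < w})" using True by simp
    moreover have "{u \<in> F - {w}. u < v} = {u \<in> F. u < v}" using that by auto
    ultimately show ?thesis by simp
  qed
  have "boundary (boundary (frag_of F)) =
      (\<Sum>v\<in>F. \<Sum>w\<in>F - {v}. frag_cmul (?s v w) (frag_of (F - {v} - {w})))" (is "_ = ?S")
  proof -
    have "boundary (boundary (frag_of F)) =
        (\<Sum>v\<in>F. frag_cmul ((- 1) ^ card {u \<in> F. u < v}) (boundary (frag_of (F - {v}))))"
      unfolding boundary_frag_of[of F] boundary_sum boundary_cmul ..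
    then show ?thesis unfolding boundary_frag_of[of "F - _"] frag_cmul_sum frag_cmul_cmul o_def .
  qed
  also have "?S = (\<Sum>(v, w)\<in>Sigma F (\<lambda>v. F - {v}). frag_cmul (?s v w) (frag_of (F - {v} - {w})))"
    using True by (subst sum.Sigma) auto
  finally have S: "boundary (boundary (frag_of F)) = \<dots>" .
  also have "\<dots> = (\<Sum>(v, w)\<in>Sigma F (\<lambda>v. F - {v}). frag_cmul (?s w v) (frag_of (F - {w} - {v})))"
    by (rule sum.reindex_bij_witness[of _ "\<lambda>(v, w). (w, v)" "\<lambda>(v, w). (w, v)"]) auto
  also have "\<dots> = (\<Sum>(v, w)\<in>Sigma F (\<lambda>v. F - {v}). - frag_cmul (?s v w) (frag_of (F - {v} - {w})))"
  proof (rule sum.cong[OF refl])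
    fix vw assume "vw \<in> Sigma F (\<lambda>v. F - {v})"
    then obtain v w where vw: "vw = (v, w)" "v \<in> F" "w \<in> F" "v \<noteq> w" by auto
    have "?s w v = - ?s v w"
      using anti[of v w] anti[of w v] vw by (cases "v < w") auto
    moreover have "F - {w} - {v} = F - {v} - {w}" by blast
    ultimately show "(case vw of (v, w) \<Rightarrow> frag_cmul (?s w v) (frag_of (F - {w} - {v}))) =
        (case vw of (v, w) \<Rightarrow> - frag_cmul (?s v w) (frag_of (F - {v} - {w})))"
      using vw by simp
  qed
  also have "\<dots> = - boundary (boundary (frag_of F))"
    unfolding S by (simp add: case_prod_unfold sum_negf del: minus_frag_cmul)
  finally have "boundary (boundary (frag_of F)) = - boundary (boundary (frag_of F))" .
  then have "Poly_Mapping.lookup (boundary (boundary (frag_of F))) H =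
      - Poly_Mapping.lookup (boundary (boundary (frag_of F))) H" for H
    by (metis lookup_uminus)
  then show ?thesis by (intro poly_mapping_eqI) simp
qed (simp add: boundary_frag_of)

lemma boundary_boundary: "boundary (boundary c) = 0"
proof -
  have "boundary c = (\<Sum>G\<in>Poly_Mapping.keys c. frag_cmul (Poly_Mapping.lookup c G) (boundary (frag_of G)))"
    by (simp add: boundary_def frag_extend_def)
  then show ?thesis by (simp add: boundary_sum boundary_cmul boundary_boundary_frag_of)
qed

text \<open>By \<open>zero\<close> all faces of \<open>c\<close> contain \<open>p\<close>. Then
  \<open>G - {p}\<close> lies in the boundary of no other face of \<open>c\<close>, so the
  coefficient of \<open>G\<close> appears alone in \<open>boundary c\<close>.\<close>

lemma cycle_eq_0I:
  assumes fin: "\<And>G. G \<in> Poly_Mapping.keys c \<Longrightarrow> finite G"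
    and zero: "\<And>G. p \<notin> G \<Longrightarrow> Poly_Mapping.lookup c G = 0" and cyc: "boundary c = 0"
  shows "c = 0"
proof (rule ccontr)
  assume "c \<noteq> 0"
  then obtain G where G: "G \<in> Poly_Mapping.keys c" by (metis keys_eq_empty all_not_in_conv)
  have p: "p \<in> G'" if "G' \<in> Poly_Mapping.keys c" for G'
    using zero[of G'] that by (auto simp: in_keys_iff)
  let ?H = "G - {p}"
  have G_eq: "G = insert p ?H" using p[OF G] by auto
  have "incidence ?H G' = 0" if "G' \<in> Poly_Mapping.keys c" "G' \<noteq> G" for G'
  proof (rule ccontr)
    assume "incidence ?H G' \<noteq> 0"
    then obtain g where g: "G' = insert g ?H" by (rule incidence_nonzeroE)
    then have "g = p" using p[OF that(1)] by auto
    with g G_eq that(2) show False by simp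
  qed
  then have "0 = Poly_Mapping.lookup c G * incidence ?H G"
    using lookup_boundary[OF finite_keys order_refl, of c ?H] cyc sum.remove[OF finite_keys G, of "\<lambda>G. Poly_Mapping.lookup c G * incidence ?H G"]
    by simp
  moreover have "incidence ?H G \<noteq> 0"
    using incidence_insert[of ?H p] fin[OF G] G_eq by simp
  ultimately show False using G by (simp add: in_keys_iff)
qed

section \<open>Ranks of quotients of chain groups\<close>

lemma int_linear_dependence:
  fixes f :: "'b \<Rightarrow> 'c \<Rightarrow> int"
  assumes "finite J" "finite B" "card J < card B"
  shows "\<exists>c. (\<exists>b\<in>B. c b \<noteq> 0) \<and> (\<forall>j\<in>J. (\<Sum>b\<in>B. c b * f b j) = 0)"
  using assms
proof (induction J arbitrary: B f rule: finite_induct)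
  case empty
  then obtain b where "b \<in> B" by fastforce
  then show ?case by (intro exI[of _ "\<lambda>_. 1"]) auto
next
  case (insert j J)
  show ?case
  proof (cases "\<forall>b\<in>B. f b j = 0")
    case True
    have "card J < card B" using insert by simp
    from insert.IH[OF insert.prems(1) this, of f] obtain c
      where "\<exists>b\<in>B. c b \<noteq> 0" "\<forall>j\<in>J. (\<Sum>b\<in>B. c b * f b j) = 0" by blast
    then show ?thesis using True by (intro exI[of _ c]) simp
  next
    case False
    then obtain b0 where b0: "b0 \<in> B" "f b0 j \<noteq> 0" by blast
    \<comment> \<open>Fraction-free elimination with pivot \<open>b0\<close>: the family
      \<open>?g\<close> vanishes at \<open>j\<close>, and the coefficient of \<open>b0\<close> is
      chosen to turn a relation for \<open>?g\<close> into one for \<open>f\<close>.\<close>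
    let ?B = "B - {b0}" and ?g = "\<lambda>b i. f b0 j * f b i - f b j * f b0 i"
    have "finite ?B" "card J < card ?B" using insert b0 by auto
    from insert.IH[OF this, of ?g] obtain c b1
      where b1: "b1 \<in> ?B" "c b1 \<noteq> 0" and c: "\<forall>i\<in>J. (\<Sum>b\<in>?B. c b * ?g b i) = 0" by blast
    define c' where "c' b = (if b = b0 then - (\<Sum>b\<in>?B. c b * f b j) else f b0 j * c b)" for b
    have sum: "(\<Sum>b\<in>B. c' b * f b i) = (\<Sum>b\<in>?B. c b * ?g b i)" for i
    proof -
      have "(\<Sum>b\<in>B. c' b * f b i) = c' b0 * f b0 i + (\<Sum>b\<in>?B. c' b * f b i)"
        using b0(1) insert.prems(1) by (rule sum.remove[rotated])
      also have "(\<Sum>b\<in>?B. c' b * f b i) = (\<Sum>b\<in>?B. f b0 j * c b * f b i)"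
        by (rule sum.cong) (auto simp: c'_def)
      also have "c' b0 * f b0 i = (\<Sum>b\<in>?B. - (c b * f b j * f b0 i))"
        by (simp add: c'_def sum_distrib_right sum_negf)
      also have "\<dots> + (\<Sum>b\<in>?B. f b0 j * c b * f b i) = (\<Sum>b\<in>?B. c b * ?g b i)"
        unfolding sum.distrib[symmetric] by (rule sum.cong) (auto simp: algebra_simps)
      finally show ?thesis .
    qed
    have "\<forall>i\<in>insert j J. (\<Sum>b\<in>B. c' b * f b i) = 0"
      unfolding sum using c by simp
    moreover have "c' b1 \<noteq> 0" "b1 \<in> B" using b1 b0 by (auto simp: c'_def)
    ultimately show ?thesis by blast
  qed
qed

text \<open>Cycles modulo boundaries, detached from any complex; it is instantiated for the whole
  complex and for its trees, each in degrees \<open>d\<close> and \<open>d - 1\<close>.\<close>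

locale chain_quotient =
  fixes S :: "'b set" and Z B :: "('b \<Rightarrow>\<^sub>0 int) set"
  assumes Z: "subgroup Z (free_Abelian_group S)" and B: "subgroup B (free_Abelian_group S)" and BZ: "B \<subseteq> Z"
begin

definition "Zg = subgroup_generated (free_Abelian_group S) Z"

definition "cls z = B #>\<^bsub>Zg\<^esub> z"

lemma Z_keys: "z \<in> Z \<Longrightarrow> Poly_Mapping.keys z \<subseteq> S"
  using subsetD[OF subgroup.subset[OF Z], of z] by simp

lemma Zg_simps [simp]: "carrier Zg = Z" "x \<otimes>\<^bsub>Zg\<^esub> y = x + y" "\<one>\<^bsub>Zg\<^esub> = 0"
  unfolding Zg_def using subgroup.carrier_subgroup_generated_subgroup[OF Z] by auto

lemma comm_Zg: "comm_group Zg"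
  unfolding Zg_def using group.abelian_subgroup_generated[OF group_free_Abelian_group abelian_free_Abelian_group] .

sublocale Zg: comm_group Zg by (rule comm_Zg)

lemma Z_closed: "0 \<in> Z" "x \<in> Z \<Longrightarrow> y \<in> Z \<Longrightarrow> x + y \<in> Z" "x \<in> Z \<Longrightarrow> - x \<in> Z"
  using subgroup.one_closed[OF Z] subgroup.m_closed[OF Z, of x y] subgroup.m_inv_closed[OF Z, of x] Z_keys[of x]
  by auto

lemma B_closed: "0 \<in> B" "x \<in> B \<Longrightarrow> y \<in> B \<Longrightarrow> x + y \<in> B" "x \<in> B \<Longrightarrow> - x \<in> B"
  using subgroup.one_closed[OF B] subgroup.m_closed[OF B, of x y] subgroup.m_inv_closed[OF B, of x] Z_keys[of x] BZ
  by auto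

lemma inv_Zg: "x \<in> Z \<Longrightarrow> inv\<^bsub>Zg\<^esub> x = - x"
  by (rule Zg.inv_equality) (auto intro: Z_closed)

lemma subgroup_B: "subgroup B Zg"
  by (rule Zg.subgroupI) (use BZ B_closed inv_Zg in auto)

lemma normal_B: "B \<lhd> Zg"
  using subgroup_B by (rule Zg.subgroup_imp_normal)

sublocale B: normal B Zg by (rule normal_B)

sublocale Q: comm_group "Zg Mod B" by (rule Zg.abelian_FactGroup[OF subgroup_B])

lemma carrier_Q: "carrier (Zg Mod B) = cls ` Z"
  by (simp add: carrier_FactGroup cls_def)

lemma cls_mem: "z \<in> Z \<Longrightarrow> cls z \<in> carrier (Zg Mod B)"
  unfolding carrier_Q by blast

lemma cls_eq_iff:
  assumes "x \<in> Z" "y \<in> Z"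
  shows "cls x = cls y \<longleftrightarrow> x - y \<in> B"
proof -
  have "cls x = cls y \<longleftrightarrow> x \<in> cls y"
    using Zg.rcos_self[of x B] Zg.repr_independence[of x B y] assms subgroup_B
    unfolding cls_def by auto
  also have "\<dots> \<longleftrightarrow> (\<exists>b\<in>B. x = b + y)"
    by (auto simp: cls_def r_coset_def)
  also have "\<dots> \<longleftrightarrow> x - y \<in> B"
    by (metis add_diff_cancel_right' diff_add_cancel)
  finally show ?thesis .
qed

lemma cls_0: "cls 0 = B"
  unfolding cls_def using Zg.coset_mult_one[of B] subgroup.subset[OF subgroup_B] by simp

lemma Zg_pow: "x \<in> Z \<Longrightarrow> x [^]\<^bsub>Zg\<^esub> (k::int) = frag_cmul k x"
  using group.int_pow_subgroup_generated[OF group_free_Abelian_group, of x S Z k] Z_keys[of x] Zg_simps(1)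
  by (simp add: Zg_def)

lemma cls_pow: "x \<in> Z \<Longrightarrow> cls x [^]\<^bsub>Zg Mod B\<^esub> (k::int) = cls (frag_cmul k x)"
  using B.FactGroup_int_pow[of x k] Zg_pow[of x k] by (simp add: cls_def)

lemma cmul_closed: "x \<in> Z \<Longrightarrow> frag_cmul k x \<in> Z"
  using Zg.int_pow_closed[of x k] Zg_pow[of x k] by simp

lemma sum_closed: "(\<And>i. i \<in> I \<Longrightarrow> f i \<in> Z) \<Longrightarrow> (\<Sum>i\<in>I. f i) \<in> Z"
  by (induction I rule: infinite_finite_induct) (auto intro: Z_closed)

lemma finprod_cls:
  assumes "finite I" "\<And>i. i \<in> I \<Longrightarrow> z i \<in> Z"
  shows "finprod (Zg Mod B) (\<lambda>i. cls (z i) [^]\<^bsub>Zg Mod B\<^esub> (c i :: int)) I = cls (\<Sum>i\<in>I. frag_cmul (c i) (z i))"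
  using assms
proof (induction I rule: finite_induct)
  case empty
  then show ?case using cls_0 by simp
next
  case (insert i I)
  have "finprod (Zg Mod B) (\<lambda>i. cls (z i) [^]\<^bsub>Zg Mod B\<^esub> c i) (insert i I) =
      cls (z i) [^]\<^bsub>Zg Mod B\<^esub> c i \<otimes>\<^bsub>Zg Mod B\<^esub> finprod (Zg Mod B) (\<lambda>i. cls (z i) [^]\<^bsub>Zg Mod B\<^esub> c i) I"
    using insert by (intro Q.finprod_insert) (auto intro!: Q.int_pow_closed cls_mem)
  also have "\<dots> = cls (frag_cmul (c i) (z i)) <#>\<^bsub>Zg\<^esub> cls (\<Sum>i\<in>I. frag_cmul (c i) (z i))"
    using insert by (simp add: cls_pow)
  also have "\<dots> = cls (frag_cmul (c i) (z i) + (\<Sum>i\<in>I. frag_cmul (c i) (z i)))"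
    unfolding cls_def using insert by (subst B.rcos_sum) (auto intro!: cmul_closed sum_closed)
  finally show ?case using insert by simp
qed

lemma independent_family:
  assumes J: "finite J" "\<And>j. j \<in> J \<Longrightarrow> z j \<in> Z"
    and ind: "\<And>c. (\<Sum>j\<in>J. frag_cmul (c j) (z j)) \<in> B \<Longrightarrow> \<forall>j\<in>J. c j = 0"
  shows "\<exists>A\<subseteq>carrier (Zg Mod B). finite A \<and> card A = card J \<and> int_independent (Zg Mod B) A"
proof (intro exI[of _ "(\<lambda>j. cls (z j)) ` J"] conjI)
  have inj: "inj_on (\<lambda>j. cls (z j)) J"
  proof (rule inj_onI, rule ccontr)
    fix i j assume ij: "i \<in> J" "j \<in> J" "cls (z i) = cls (z j)" "i \<noteq> j"
    let ?c = "\<lambda>l. if l = i then 1 else if l = j then -1 else 0 :: int"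
    have "(\<Sum>l\<in>J. frag_cmul (?c l) (z l)) = (\<Sum>l\<in>J. (if l = i then z i else 0) - (if l = j then z j else 0))"
      using ij by (intro sum.cong) auto
    also have "\<dots> = z i - z j" using ij J by (simp add: sum_subtractf)
    also have "\<dots> \<in> B" using ij J cls_eq_iff by blast
    finally show False using ind[of ?c] ij by auto
  qed
  show "(\<lambda>j. cls (z j)) ` J \<subseteq> carrier (Zg Mod B)" using J carrier_Q by auto
  show "finite ((\<lambda>j. cls (z j)) ` J)" using J by simp
  show "card ((\<lambda>j. cls (z j)) ` J) = card J" using inj by (rule card_image)
  show "int_independent (Zg Mod B) ((\<lambda>j. cls (z j)) ` J)"
    unfolding int_independent_def
  proof (intro allI impI)
    fix c :: "('b \<Rightarrow>\<^sub>0 int) set \<Rightarrow> int"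
    assume c: "finprod (Zg Mod B) (\<lambda>b. b [^]\<^bsub>Zg Mod B\<^esub> c b) ((\<lambda>j. cls (z j)) ` J) = \<one>\<^bsub>Zg Mod B\<^esub>"
    have "finprod (Zg Mod B) (\<lambda>b. b [^]\<^bsub>Zg Mod B\<^esub> c b) ((\<lambda>j. cls (z j)) ` J) =
        finprod (Zg Mod B) (\<lambda>j. cls (z j) [^]\<^bsub>Zg Mod B\<^esub> c (cls (z j))) J"
      using inj by (intro Q.finprod_reindex) (auto intro!: Q.int_pow_closed cls_mem J)
    also have "\<dots> = cls (\<Sum>j\<in>J. frag_cmul (c (cls (z j))) (z j))"
      using J by (rule finprod_cls)
    finally have "cls (\<Sum>j\<in>J. frag_cmul (c (cls (z j))) (z j)) = cls 0"
      using c cls_0 by simp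
    then have "(\<Sum>j\<in>J. frag_cmul (c (cls (z j))) (z j)) \<in> B"
      using J by (subst (asm) cls_eq_iff) (auto intro!: sum_closed cmul_closed Z_closed)
    then show "\<forall>b\<in>(\<lambda>j. cls (z j)) ` J. c b = 0" using ind[of "\<lambda>j. c (cls (z j))"] by blast
  qed
qed

text \<open>The coordinates at \<open>J\<close> determine a cycle modulo \<open>B\<close>. More than
  \<open>card J\<close> classes have representatives with an integer relation at these coordinates,
  and the relation then holds between the classes.\<close>

lemma independent_card_le:
  assumes J: "finite J" and det: "\<And>z. z \<in> Z \<Longrightarrow> (\<And>j. j \<in> J \<Longrightarrow> Poly_Mapping.lookup z j = 0) \<Longrightarrow> z \<in> B"
    and A: "A \<subseteq> carrier (Zg Mod B)" "finite A" "int_independent (Zg Mod B) A"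
  shows "card A \<le> card J"
proof (rule ccontr)
  assume "\<not> card A \<le> card J"
  then have less: "card J < card A" by simp
  define rep where "rep = inv_into Z cls"
  have "a \<in> cls ` Z" if "a \<in> A" for a using that A(1) carrier_Q by auto
  then have rep: "rep a \<in> Z" "cls (rep a) = a" if "a \<in> A" for a
    using that by (auto simp: rep_def inv_into_into f_inv_into_f)
  obtain c where c: "\<exists>a\<in>A. c a \<noteq> 0" "\<forall>j\<in>J. (\<Sum>a\<in>A. c a * Poly_Mapping.lookup (rep a) j) = 0"
    using int_linear_dependence[OF J A(2) less, of "\<lambda>a. Poly_Mapping.lookup (rep a)"] by blast
  have "finprod (Zg Mod B) (\<lambda>a. a [^]\<^bsub>Zg Mod B\<^esub> c a) A =
      finprod (Zg Mod B) (\<lambda>a. cls (rep a) [^]\<^bsub>Zg Mod B\<^esub> c a) A"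
    using rep A by (intro Q.finprod_cong) (auto simp: simp_implies_def intro!: Q.int_pow_closed)
  also have "\<dots> = cls (\<Sum>a\<in>A. frag_cmul (c a) (rep a))"
    using A(2) rep(1) by (rule finprod_cls)
  also have "\<dots> = cls 0"
  proof -
    have mem: "(\<Sum>a\<in>A. frag_cmul (c a) (rep a)) \<in> Z"
      using rep(1) by (intro sum_closed cmul_closed)
    then have "(\<Sum>a\<in>A. frag_cmul (c a) (rep a)) \<in> B"
      using c(2) by (intro det) (auto simp: lookup_sum)
    then show ?thesis using mem cls_eq_iff[of _ 0] Z_closed by simp
  qed
  finally have "\<forall>a\<in>A. c a = 0"
    using A(3) cls_0 unfolding int_independent_def by simp
  then show False using c(1) by blast
qed

lemma abelian_rank_eqI:
  assumes J: "finite J" "\<And>j. j \<in> J \<Longrightarrow> z j \<in> Z"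
    and ind: "\<And>c. (\<Sum>j\<in>J. frag_cmul (c j) (z j)) \<in> B \<Longrightarrow> \<forall>j\<in>J. c j = 0"
    and det: "\<And>z. z \<in> Z \<Longrightarrow> (\<And>j. j \<in> J \<Longrightarrow> Poly_Mapping.lookup z j = 0) \<Longrightarrow> z \<in> B"
  shows "abelian_rank (Zg Mod B) = card J"
  unfolding abelian_rank_def
proof (rule Greatest_equality)
  show "\<exists>A\<subseteq>carrier (Zg Mod B). finite A \<and> card A = card J \<and> int_independent (Zg Mod B) A"
    by (rule independent_family[OF J ind])
  fix m assume "\<exists>A\<subseteq>carrier (Zg Mod B). finite A \<and> card A = m \<and> int_independent (Zg Mod B) A"
  then obtain A where "A \<subseteq> carrier (Zg Mod B)" "finite A" "card A = m" "int_independent (Zg Mod B) A" by auto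
  then show "m \<le> card J" using independent_card_le[OF J(1) det, of A] by simp
qed

text \<open>\<open>GREATEST\<close> has the intended value only for a bounded set of sizes:
  \<open>J\<close> supplies the bound, the family \<open>z\<close> the lower estimate.\<close>

lemma abelian_rank_ge:
  assumes J: "finite J" "\<And>z. z \<in> Z \<Longrightarrow> (\<And>j. j \<in> J \<Longrightarrow> Poly_Mapping.lookup z j = 0) \<Longrightarrow> z \<in> B"
    and I: "finite I" "\<And>i. i \<in> I \<Longrightarrow> z i \<in> Z"
    and ind: "\<And>c. (\<Sum>i\<in>I. frag_cmul (c i) (z i)) \<in> B \<Longrightarrow> \<forall>i\<in>I. c i = 0"
  shows "card I \<le> abelian_rank (Zg Mod B)"
  unfolding abelian_rank_def
proof (rule Greatest_le_nat[where b = "card J"])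
  show "\<exists>A\<subseteq>carrier (Zg Mod B). finite A \<and> card A = card I \<and> int_independent (Zg Mod B) A"
    by (rule independent_family[OF I ind])
  fix m assume "\<exists>A\<subseteq>carrier (Zg Mod B). finite A \<and> card A = m \<and> int_independent (Zg Mod B) A"
  then obtain A where "A \<subseteq> carrier (Zg Mod B)" "finite A" "card A = m" "int_independent (Zg Mod B) A" by auto
  then show "m \<le> card J" using independent_card_le[OF J, of A] by simp
qed

end

lemma simplicial_complexD:
  assumes "simplicial_complex V U" "F \<in> U"
  shows "finite F" "G \<subseteq> F \<Longrightarrow> G \<in> U"
  using assms finite_subset[of F V] by (auto simp: simplicial_complex_def)

lemma keys_boundary:
  assumes U: "simplicial_complex V U" and c: "Poly_Mapping.keys c \<subseteq> faces (i + 1) U"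
  shows "Poly_Mapping.keys (boundary c) \<subseteq> faces i U"
proof
  fix H assume "H \<in> Poly_Mapping.keys (boundary c)"
  then have "(\<Sum>G\<in>Poly_Mapping.keys c. Poly_Mapping.lookup c G * incidence H G) \<noteq> 0"
    using lookup_boundary[of "Poly_Mapping.keys c" c H] by (simp add: in_keys_iff)
  then obtain G where G: "G \<in> Poly_Mapping.keys c" "incidence H G \<noteq> 0"
    by (rule sum.not_neutral_contains_not_neutral) auto
  from G(2) obtain g where g: "g \<notin> H" "G = insert g H" by (rule incidence_nonzeroE)
  have "G \<in> U" "int (card G) - 1 = i + 1" using G(1) c by (auto simp: faces_def)
  moreover have "H \<subseteq> G" using g by auto
  ultimately have "H \<in> U" "finite H" using simplicial_complexD[OF U] finite_subset[of H G] by auto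
  then show "H \<in> faces i U" using g \<open>int (card G) - 1 = i + 1\<close> by (simp add: faces_def)
qed

lemma chain_quotient_homology:
  assumes U: "simplicial_complex V U"
  shows "chain_quotient (faces i U) (cycles i U) (boundaries i U)"
    and "chain_quotient.Zg (faces i U) (cycles i U) Mod boundaries i U = reduced_homology i U"
proof -
  interpret F: group "free_Abelian_group (faces i U)" by simp
  have Z: "subgroup (cycles i U) (free_Abelian_group (faces i U))"
  proof (rule F.subgroupI)
    show "inv\<^bsub>free_Abelian_group (faces i U)\<^esub> a \<in> cycles i U" if "a \<in> cycles i U" for a
      using that boundary_diff[of 0 a] by (auto simp: cycles_def chain_group_def)
    show "a \<otimes>\<^bsub>free_Abelian_group (faces i U)\<^esub> b \<in> cycles i U" if "a \<in> cycles i U" "b \<in> cycles i U" for a b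
      using that keys_add[of a b] by (auto simp: cycles_def chain_group_def boundary_add)
    have "0 \<in> cycles i U" by (simp add: cycles_def chain_group_def)
    then show "cycles i U \<noteq> {}" by blast
  qed (auto simp: cycles_def chain_group_def)
  have bound: "Poly_Mapping.keys (boundary c) \<subseteq> faces i U" if "Poly_Mapping.keys c \<subseteq> faces (i + 1) U" for c
    by (rule keys_boundary[OF U that])
  have B: "subgroup (boundaries i U) (free_Abelian_group (faces i U))"
  proof (rule F.subgroupI)
    show "boundaries i U \<subseteq> carrier (free_Abelian_group (faces i U))"
      using subsetD[OF bound] by (auto simp: boundaries_def chain_group_def)
    show "inv\<^bsub>free_Abelian_group (faces i U)\<^esub> a \<in> boundaries i U" if a: "a \<in> boundaries i U" for a
    proof -
      obtain c where c: "a = boundary c" "Poly_Mapping.keys c \<subseteq> faces (i + 1) U"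
        using a by (auto simp: boundaries_def chain_group_def)
      then have "inv\<^bsub>free_Abelian_group (faces i U)\<^esub> a = boundary (- c)"
        using bound boundary_diff[of 0 c] by simp
      then show ?thesis using c by (auto simp: boundaries_def chain_group_def)
    qed
    show "a \<otimes>\<^bsub>free_Abelian_group (faces i U)\<^esub> b \<in> boundaries i U"
      if ab: "a \<in> boundaries i U" "b \<in> boundaries i U" for a b
    proof -
      obtain c e where c: "a = boundary c" "Poly_Mapping.keys c \<subseteq> faces (i + 1) U"
        and e: "b = boundary e" "Poly_Mapping.keys e \<subseteq> faces (i + 1) U"
        using ab by (auto simp: boundaries_def chain_group_def)
      have "Poly_Mapping.keys (c + e) \<subseteq> faces (i + 1) U" using c e keys_add[of c e] by auto
      then show ?thesis using c e by (auto simp: boundaries_def chain_group_def boundary_add[symmetric])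
    qed
    have "0 \<in> boundaries i U"
      unfolding boundaries_def chain_group_def by (rule image_eqI[of _ _ 0]) auto
    then show "boundaries i U \<noteq> {}" by blast
  qed
  show "chain_quotient (faces i U) (cycles i U) (boundaries i U)"
  proof (rule chain_quotient.intro[OF Z B])
    show "boundaries i U \<subseteq> cycles i U"
      using subsetD[OF bound] by (auto simp: boundaries_def cycles_def chain_group_def boundary_boundary)
  qed
  then show "chain_quotient.Zg (faces i U) (cycles i U) Mod boundaries i U = reduced_homology i U"
    by (simp add: chain_quotient.Zg_def reduced_homology_def chain_group_def)
qed

section \<open>Shifted complexes and cones over their faces\<close>

locale shifted_cone =
  fixes K :: "int set set" and p q :: int and d :: nat
  assumes shifted: "shifted_complex p q K" and dim: "complex_dim K = int d"
begin

definition ridges :: "int set set" where "ridges = {H \<in> K. p \<notin> H \<and> card H = d}"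

definition del_facets :: "int set set" where "del_facets = {F \<in> K. p \<notin> F \<and> card F = Suc d}"

definition facets :: "int set set" where "facets = {F \<in> K. card F = Suc d}"

lemma complex: "simplicial_complex {p..q} K"
  using shifted by (simp add: shifted_complex_def)

lemma K_sub: "F \<in> K \<Longrightarrow> F \<subseteq> {p..q}"
  using complex by (auto simp: simplicial_complex_def)

lemma K_finite: "F \<in> K \<Longrightarrow> finite F"
  by (rule simplicial_complexD(1)[OF complex])

lemma K_down: "F \<in> K \<Longrightarrow> G \<subseteq> F \<Longrightarrow> G \<in> K"
  by (rule simplicial_complexD(2)[OF complex])

lemma finite_K: "finite K"
  using complex finite_subset[of K "Pow {p..q}"] by (auto simp: simplicial_complex_def)

lemma K_shift: "F \<in> K \<Longrightarrow> i \<in> {p..q} \<Longrightarrow> i < j \<Longrightarrow> i \<notin> F \<Longrightarrow> j \<in> F \<Longrightarrow> insert i (F - {j}) \<in> K"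
  using shifted K_sub[of F] unfolding shifted_complex_def by blast

lemma K_cone: "F \<in> K \<Longrightarrow> p \<notin> F \<Longrightarrow> v \<in> F \<Longrightarrow> insert p (F - {v}) \<in> K"
proof -
  assume F: "F \<in> K" "p \<notin> F" "v \<in> F"
  then have "v \<in> {p..q}" "v \<noteq> p" using K_sub[of F] by auto
  then show ?thesis using F by (intro K_shift) auto
qed

lemma K_card_le: "F \<in> K \<Longrightarrow> card F \<le> Suc d"
proof -
  assume "F \<in> K"
  then have "int (card F) - 1 \<le> complex_dim K"
    unfolding complex_dim_def using finite_K by (intro Max_ge) auto
  then show ?thesis using dim by simp
qed

lemma facets_nonempty: "facets \<noteq> {}"
proof -
  have "K \<noteq> {}" using complex by (auto simp: simplicial_complex_def)
  then have "complex_dim K \<in> (\<lambda>F. int (card F) - 1) ` K"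
    unfolding complex_dim_def using finite_K by (intro Max_in) auto
  then obtain F where "F \<in> K" "int (card F) - 1 = int d" using dim by auto
  then show ?thesis by (auto simp: facets_def)
qed

lemma faces_simps:
  "faces (int d) K = facets" "faces (int d) (deletion p K) = del_facets" "faces (int d + 1) K = {}"
  using K_card_le by (force simp: faces_def facets_def del_facets_def deletion_def)+

lemma finite_ridges: "finite ridges" and finite_del_facets: "finite del_facets" and finite_facets: "finite facets"
  using finite_K by (auto simp: ridges_def del_facets_def facets_def)

lemma p_less: "F \<in> K \<Longrightarrow> p \<notin> F \<Longrightarrow> v \<in> F \<Longrightarrow> p < v"
  using subsetD[OF K_sub, of F v] by (cases "v = p") auto

lemma K_sub_greater: "F \<in> K \<Longrightarrow> p \<notin> F \<Longrightarrow> F \<subseteq> {p<..q}"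
  using subsetD[OF K_sub, of F] p_less[of F] by auto

lemma ridges_sub: "H \<in> ridges \<Longrightarrow> H \<subseteq> {p<..q}"
  using K_sub_greater[of H] by (simp add: ridges_def)

lemma del_facets_sub: "F \<in> del_facets \<Longrightarrow> F \<subseteq> {p<..q}"
  using K_sub_greater[of F] by (simp add: del_facets_def)

lemma p_le_q: "p \<le> q"
proof -
  obtain F where F: "F \<in> K" "card F = Suc d" using facets_nonempty by (auto simp: facets_def)
  then obtain v where "v \<in> F" by fastforce
  then show ?thesis using K_sub[OF F(1)] by auto
qed

text \<open>The cone over \<open>F\<close> may fail to be a face of \<open>K\<close>, but its
  boundary always lies in \<open>K\<close>: besides \<open>F\<close>, its faces arise from
  \<open>F\<close> by shifting a vertex to \<open>p\<close>.\<close>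

lemma keys_boundary_cone:
  assumes F: "F \<in> K" "p \<notin> F" "card F = m"
  shows "Poly_Mapping.keys (boundary (frag_of (insert p F))) \<subseteq> faces (int m - 1) K"
proof
  fix H assume "H \<in> Poly_Mapping.keys (boundary (frag_of (insert p F)))"
  then have "incidence H (insert p F) \<noteq> 0" by (simp add: in_keys_iff lookup_boundary_frag_of)
  then obtain g where g: "g \<notin> H" "insert p F = insert g H" by (rule incidence_nonzeroE)
  have fin: "finite F" using F(1) by (rule K_finite)
  have finH: "finite H" using finite_subset[of H "insert p F"] fin g(2) by blast
  have "Suc (card H) = Suc m" using card_insert_disjoint[OF fin F(2)] card_insert_disjoint[OF finH g(1)] F(3) g(2) by simp
  moreover have "H \<in> K"
  proof (cases "g = p")
    case True
    then have "H = F" using g F(2) by (simp add: insert_ident)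
    then show ?thesis using F(1) by simp
  next
    case False
    have "g \<in> F" using equalityD2[OF g(2)] False by auto
    moreover have "H = insert p F - {g}" unfolding g(2) using g(1) by simp
    ultimately show ?thesis using K_cone[OF F(1,2), of g] False by (simp add: insert_Diff_if)
  qed
  ultimately show "H \<in> faces (int m - 1) K" by (simp add: faces_def)
qed

text \<open>Together with \<open>lookup_cone\<close> this provides, for each \<open>F\<close>, a
  cycle with value one at \<open>F\<close> and zero at all other faces without
  \<open>p\<close>.\<close>

lemma cone_cycle:
  assumes "F \<in> K" "p \<notin> F" "card F = m"
  shows "boundary (frag_of (insert p F)) \<in> cycles (int m - 1) K"
  using keys_boundary_cone[OF assms] by (simp add: cycles_def chain_group_def boundary_boundary)

lemma lookup_cone:
  assumes "F \<in> K" "p \<notin> F" "p \<notin> H"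
  shows "Poly_Mapping.lookup (boundary (frag_of (insert p F))) H = (if H = F then 1 else 0)"
  unfolding lookup_boundary_frag_of
proof (rule incidence_insert_least)
  show "p < v" if "v \<in> F" for v
    using p_less[OF assms(1,2) that] .
qed (use assms K_finite in auto)

lemma cycle_eq_0:
  assumes "z \<in> cycles i K" "\<And>F. F \<in> faces i K \<Longrightarrow> p \<notin> F \<Longrightarrow> Poly_Mapping.lookup z F = 0"
  shows "z = 0"
proof (rule cycle_eq_0I[where p = p])
  have keys: "Poly_Mapping.keys z \<subseteq> faces i K" "boundary z = 0"
    using assms(1) by (auto simp: cycles_def chain_group_def)
  show "finite G" if "G \<in> Poly_Mapping.keys z" for G
    using that keys K_finite by (auto simp: faces_def)
  show "Poly_Mapping.lookup z G = 0" if "p \<notin> G" for G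
  proof (cases "G \<in> Poly_Mapping.keys z")
    case True
    then show ?thesis using keys assms(2) that by blast
  qed (simp add: in_keys_iff)
  show "boundary z = 0" by (rule keys)
qed

lemma boundaries_top: "faces (i + 1) U = {} \<Longrightarrow> boundaries i U = {0}"
  by (auto simp: boundaries_def chain_group_def)

text \<open>There are no boundaries in top degree. The cone cycles are dual to the coordinates at
  \<open>del_facets\<close>, and these coordinates determine a cycle.\<close>

lemma betti_top: "betti (int d) K = card del_facets"
proof -
  interpret Q: chain_quotient "faces (int d) K" "cycles (int d) K" "boundaries (int d) K"
    by (rule chain_quotient_homology[OF complex])
  let ?z = "\<lambda>F. boundary (frag_of (insert p F))"
  have B: "boundaries (int d) K = {0}" using boundaries_top faces_simps(3) by blast
  have "abelian_rank (Q.Zg Mod boundaries (int d) K) = card del_facets"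
  proof (rule Q.abelian_rank_eqI[where z = ?z])
    show "finite del_facets" by (rule finite_del_facets)
    show "?z F \<in> cycles (int d) K" if "F \<in> del_facets" for F
      using cone_cycle[of F "Suc d"] that by (simp add: del_facets_def)
    show "\<forall>F\<in>del_facets. c F = 0" if c: "(\<Sum>F\<in>del_facets. frag_cmul (c F) (?z F)) \<in> boundaries (int d) K" for c
    proof
      fix F assume F: "F \<in> del_facets"
      have "Poly_Mapping.lookup (\<Sum>F'\<in>del_facets. frag_cmul (c F') (?z F')) F = (\<Sum>F'\<in>del_facets. if F = F' then c F' else 0)"
        unfolding lookup_sum lookup_frag_cmul using F
        by (intro sum.cong) (auto simp: lookup_cone del_facets_def)
      then show "c F = 0" using c F finite_del_facets unfolding B by simp
    qed
    show "z \<in> boundaries (int d) K"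
      if "z \<in> cycles (int d) K" "\<And>F. F \<in> del_facets \<Longrightarrow> Poly_Mapping.lookup z F = 0" for z
    proof -
      have "z = 0"
        using that(1) by (rule cycle_eq_0) (use that(2) in \<open>auto simp: del_facets_def faces_def\<close>)
      then show ?thesis by (simp add: B)
    qed
  qed
  then show ?thesis by (simp add: betti_def chain_quotient_homology(2)[OF complex])
qed

text \<open>If \<open>p \<union> H\<close> is missing, no other vertex \<open>g\<close> gives a face
  \<open>g \<union> H\<close>, since shifting \<open>g\<close> to \<open>p\<close> would produce it.
  So every boundary vanishes at \<open>H\<close>, while the cone cycle over \<open>H\<close> has
  coefficient one there and thus has infinite order in homology.\<close>

lemma ridges_cone:
  assumes betti: "betti (int d - 1) K = 0" and H: "H \<in> ridges"
  shows "insert p H \<in> K"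
proof (rule ccontr)
  assume neg: "insert p H \<notin> K"
  interpret Q: chain_quotient "faces (int d - 1) K" "cycles (int d - 1) K" "boundaries (int d - 1) K"
    by (rule chain_quotient_homology[OF complex])
  have HK: "H \<in> K" "p \<notin> H" "card H = d" using H by (auto simp: ridges_def)
  let ?z = "boundary (frag_of (insert p H))"
  have zero: "Poly_Mapping.lookup w H = 0" if "w \<in> boundaries (int d - 1) K" for w
  proof -
    from that obtain c where c: "w = boundary c" "Poly_Mapping.keys c \<subseteq> faces (int d) K"
      by (auto simp: boundaries_def chain_group_def)
    have "incidence H G = 0" if "G \<in> Poly_Mapping.keys c" for G
    proof (rule ccontr)
      assume "incidence H G \<noteq> 0"
      then obtain g where g: "g \<notin> H" "G = insert g H" by (rule incidence_nonzeroE)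
      have G: "G \<in> K" using that c(2) by (auto simp: faces_def)
      have "g \<noteq> p" using neg G g by auto
      then have "p \<notin> G" using g HK by auto
      then have "insert p (G - {g}) \<in> K" using K_cone[OF G] g(2) by blast
      moreover have "G - {g} = H" unfolding g(2) using g(1) by simp
      ultimately show False using neg by simp
    qed
    then show ?thesis unfolding c(1) by (subst lookup_boundary[OF finite_keys order_refl]) simp
  qed
  have "card {H} \<le> abelian_rank (Q.Zg Mod boundaries (int d - 1) K)"
  proof (rule Q.abelian_rank_ge[where J = "faces (int d - 1) K" and z = "\<lambda>_. ?z"])
    show "finite (faces (int d - 1) K)" using finite_K by (simp add: faces_def)
    show "z \<in> boundaries (int d - 1) K"
      if "z \<in> cycles (int d - 1) K" "\<And>F. F \<in> faces (int d - 1) K \<Longrightarrow> Poly_Mapping.lookup z F = 0" for z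
    proof -
      have "z = 0" using that by (intro cycle_eq_0) auto
      then show ?thesis using Q.B_closed(1) by simp
    qed
    show "?z \<in> cycles (int d - 1) K" using cone_cycle[OF HK] .
    show "\<forall>i\<in>{H}. c i = 0" if "(\<Sum>i\<in>{H}. frag_cmul (c i) ?z) \<in> boundaries (int d - 1) K" for c
      using zero[OF that] lookup_cone[OF HK(1,2,2)] by simp
  qed simp
  then show False using betti by (simp add: betti_def chain_quotient_homology(2)[OF complex])
qed

text \<open>Induction on the number of positions where \<open>F\<close> and \<open>G\<close> differ;
  each shift of \<open>F\<close> removes one of them.\<close>

lemma K_componentwise:
  assumes "F \<in> K" "finite G" "G \<subseteq> {p..q}" "card G = card F" "\<And>i. i < card F \<Longrightarrow> el G i \<le> el F i"
  shows "G \<in> K"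
  using assms
proof (induction "card {i. i < card F \<and> el G i \<noteq> el F i}" arbitrary: F)
  case 0
  have finF: "finite F" using 0(2) by (rule K_finite)
  have "el G i = el F i" if "i < card F" for i using 0(1) that by auto
  then have "el G ` {..<card G} = el F ` {..<card F}" using 0(5) by auto
  then have "G = F"
    using el_bij[OF 0(3)] el_bij[OF finF] by (simp add: bij_betw_def)
  then show ?case using 0(2) by simp
next
  case (Suc c)
  let ?D = "\<lambda>F. {i. i < card F \<and> el G i \<noteq> el F i}"
  have finF: "finite F" using Suc.prems(1) by (rule K_finite)
  have "?D F \<noteq> {}" using Suc.hyps(2) by (intro notI) simp
  \<comment> \<open>At the first differing position \<open>el G i\<close> exceeds the earlier
    vertices of \<open>F\<close>, which agree with those of \<open>G\<close>, and is below
    \<open>el F i\<close>. So it is not in \<open>F\<close>, and the exchange affects position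
    \<open>i\<close> only.\<close>
  define i where "i = Min (?D F)"
  have iD: "i \<in> ?D F" unfolding i_def using \<open>?D F \<noteq> {}\<close> by (intro Min_in) simp
  have imin: "el G j = el F j" if "j < i" for j
  proof -
    have "j \<notin> ?D F"
    proof
      assume "j \<in> ?D F"
      then have "i \<le> j" unfolding i_def by (intro Min_le) simp
      then show False using that by simp
    qed
    then show ?thesis using iD that by simp
  qed
  let ?g = "el G i" and ?f = "el F i"
  have i: "i < card F" "?g < ?f" using iD Suc.prems(5)[of i] by auto
  have g_above: "el F j < ?g" if "j < i" for j
    using imin[OF that] el_less[of j i G] that i Suc.prems(4) by simp
  have f_above: "?g < el F j" if "i \<le> j" "j < card F" for j
    using el_le[OF that] i by simp
  have gF: "?g \<notin> F"
  proof
    assume "?g \<in> F"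
    then obtain j where j: "j < card F" "?g = el F j"
      using bij_betw_imp_surj_on[OF el_bij[OF finF]] by blast
    show False using g_above[of j] f_above[of j] j by (cases "j < i") auto
  qed
  let ?F = "insert ?g (F - {?f})"
  have fF: "?f \<in> F" using i by (intro el_in)
  have F'K: "?F \<in> K"
    using Suc.prems(1) _ i(2) gF fF
    by (rule K_shift) (use el_in[of i G] i Suc.prems in auto)
  have cardF': "card ?F = card F" 
    using card_Suc_Diff1[OF finF fF] finF gF by (subst card_insert_disjoint) auto
  have elF': "el ?F j = (if j = i then ?g else el F j)" if "j < card F" for j
  proof (rule el_eqI[where n = "card F"])
    show "(if j = i then ?g else el F j) < (if l = i then ?g else el F l)" if "j < l" "l < card F" for j l
      using that g_above[of j] f_above[of l] el_less[of j l F] by auto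
    have inj: "inj_on (el F) {..<card F}" using el_bij[OF finF] by (simp add: bij_betw_def)
    have "(\<lambda>j. if j = i then ?g else el F j) ` {..<card F} = insert ?g (el F ` ({..<card F} - {i}))"
      using i by auto
    also have "el F ` ({..<card F} - {i}) = el F ` {..<card F} - {?f}"
      using inj i by (subst inj_on_image_set_diff[OF inj]) auto
    also have "el F ` {..<card F} = F" using el_bij[OF finF] by (simp add: bij_betw_def)
    finally show "(\<lambda>j. if j = i then ?g else el F j) ` {..<card F} = ?F" .
  qed (use finF cardF' that in auto)
  have "?D ?F = ?D F - {i}"
  proof (rule Set.set_eqI)
    fix x
    show "x \<in> ?D ?F \<longleftrightarrow> x \<in> ?D F - {i}"
    proof (cases "x < card F")
      case True
      show ?thesis unfolding mem_Collect_eq cardF' elF'[OF True] by simp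
    next
      case False
      then show ?thesis unfolding mem_Collect_eq cardF' by simp
    qed
  qed
  then have "c = card (?D ?F)" using Suc.hyps(2) iD by simp
  then show ?case
    using F'K Suc.prems(2,3)
  proof (rule Suc.hyps(1))
    show "card G = card ?F" using Suc.prems(4) cardF' by simp
    show "el G j \<le> el ?F j" if "j < card ?F" for j
      using elF'[of j] that cardF' Suc.prems(5)[of j] by auto
  qed
qed

end

section \<open>Spanning trees and determinants\<close>

lemma detf_eq_0_iff:
  fixes M :: "nat \<Rightarrow> nat \<Rightarrow> 'a::idom"
  shows "detf n M = 0 \<longleftrightarrow> (\<exists>t. (\<exists>j<n. t j \<noteq> 0) \<and> (\<forall>i<n. (\<Sum>j<n. M i j * t j) = 0))"
proof -
  let ?A = "mat n n (\<lambda>(i, j). M i j)"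
  have Av: "(?A *\<^sub>v v) $ i = (\<Sum>j<n. M i j * v $ j)" if "v \<in> carrier_vec n" "i < n" for v i
    using that by (simp add: scalar_prod_def lessThan_atLeast0)
  have "detf n M = 0 \<longleftrightarrow> (\<exists>v. v \<in> carrier_vec n \<and> v \<noteq> 0\<^sub>v n \<and> ?A *\<^sub>v v = 0\<^sub>v n)"
    by (rule det_0_iff_vec_prod_zero) simp
  also have "\<dots> \<longleftrightarrow> (\<exists>t. (\<exists>j<n. t j \<noteq> 0) \<and> (\<forall>i<n. (\<Sum>j<n. M i j * t j) = 0))"
  proof
    assume "\<exists>v. v \<in> carrier_vec n \<and> v \<noteq> 0\<^sub>v n \<and> ?A *\<^sub>v v = 0\<^sub>v n"
    then obtain v where v: "v \<in> carrier_vec n" "v \<noteq> 0\<^sub>v n" "?A *\<^sub>v v = 0\<^sub>v n" by blast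
    have "\<exists>j<n. v $ j \<noteq> 0"
    proof (rule ccontr)
      assume "\<not> ?thesis"
      then have "v = 0\<^sub>v n" using v(1) by (intro eq_vecI) auto
      with v(2) show False ..
    qed
    moreover have "\<forall>i<n. (\<Sum>j<n. M i j * v $ j) = 0"
      using Av[OF v(1)] v(3) by (metis index_zero_vec(1))
    ultimately show "\<exists>t. (\<exists>j<n. t j \<noteq> 0) \<and> (\<forall>i<n. (\<Sum>j<n. M i j * t j) = 0)"
      by (intro exI[of _ "\<lambda>j. v $ j"] conjI)
  next
    assume "\<exists>t. (\<exists>j<n. t j \<noteq> 0) \<and> (\<forall>i<n. (\<Sum>j<n. M i j * t j) = 0)"
    then obtain t j where t: "j < n" "t j \<noteq> 0" "\<forall>i<n. (\<Sum>j<n. M i j * t j) = 0" by blast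
    let ?v = "vec n t"
    have "?v $ j \<noteq> 0" using t by simp
    then have "?v \<noteq> 0\<^sub>v n" using index_zero_vec(1)[OF t(1)] by metis
    moreover have "?A *\<^sub>v ?v = 0\<^sub>v n"
    proof (rule eq_vecI)
      fix i assume "i < dim_vec (0\<^sub>v n)"
      then have i: "i < n" by simp
      have "(\<Sum>j<n. M i j * ?v $ j) = (\<Sum>j<n. M i j * t j)" by (rule sum.cong) auto
      then show "(?A *\<^sub>v ?v) $ i = 0\<^sub>v n $ i" using Av[of ?v i] t(3) i by simp
    qed simp
    ultimately show "\<exists>v. v \<in> carrier_vec n \<and> v \<noteq> 0\<^sub>v n \<and> ?A *\<^sub>v v = 0\<^sub>v n"
      by (intro exI[of _ ?v]) simp
  qed
  finally show ?thesis .
qed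

locale acyclic_shifted_cone = shifted_cone +
  fixes h :: "nat \<Rightarrow> int set" and n :: nat
  assumes betti: "betti (int d - 1) K = 0" and h: "bij_betw h {..<n} ridges"
begin

lemma card_ridges: "card ridges = n"
  using bij_betw_same_card[OF h] by simp

lemma h_in: "i < n \<Longrightarrow> h i \<in> ridges"
  using h by (auto simp: bij_betw_def)

lemma facets_split: "facets = insert p ` ridges \<union> del_facets" "insert p ` ridges \<inter> del_facets = {}"
proof -
  have "F \<in> facets \<longleftrightarrow> F \<in> insert p ` ridges \<union> del_facets" for F
  proof (cases "p \<in> F")
    case True
    show ?thesis
    proof
      assume "F \<in> facets"
      then have F: "F \<in> K" "card F = Suc d" by (auto simp: facets_def)
      have "F - {p} \<in> ridges"
        using K_down[OF F(1), of "F - {p}"] F(2) True K_finite[OF F(1)] by (auto simp: ridges_def)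
      moreover have "F = insert p (F - {p})" using True by auto
      ultimately show "F \<in> insert p ` ridges \<union> del_facets" by blast
    next
      assume "F \<in> insert p ` ridges \<union> del_facets"
      then obtain H where H: "H \<in> ridges" "F = insert p H" using True by (auto simp: del_facets_def)
      then show "F \<in> facets"
        using ridges_cone[OF betti H(1)] K_finite[of H] by (auto simp: facets_def ridges_def)
    qed
  next
    case False
    then show ?thesis by (auto simp: facets_def del_facets_def)
  qed
  then show "facets = insert p ` ridges \<union> del_facets" by blast
  show "insert p ` ridges \<inter> del_facets = {}" by (auto simp: del_facets_def)
qed

lemma inj_cone: "inj_on (insert p) ridges"
proof (rule inj_onI)
  fix H H' assume "H \<in> ridges" "H' \<in> ridges" "insert p H = insert p H'"
  then show "H = H'" using insert_ident[of p H H'] by (simp add: ridges_def)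
qed

text \<open>With \<open>betti_top\<close> this makes \<open>n\<close>, the number of rows, the
  prescribed number of facets of a spanning tree; hence the matrices are square.\<close>

lemma card_facets: "card facets = n + card del_facets"
  unfolding facets_split(1) using facets_split(2) finite_ridges finite_del_facets
  by (simp add: card_Un_disjoint card_image[OF inj_cone] card_ridges)

text \<open>Ensures that a tree has a facet and thus dimension \<open>d\<close>. The removed vertex
  is \<open>p\<close> if \<open>p\<close> is present, so that the remaining face avoids
  \<open>p\<close>.\<close>

lemma n_pos: "0 < n"
proof -
  obtain F where F: "F \<in> K" "card F = Suc d" using facets_nonempty by (auto simp: facets_def)
  have fin: "finite F" using F(1) by (rule K_finite)
  obtain v where v: "v \<in> F" "p \<in> F \<Longrightarrow> v = p"
    using F(2) by (cases "p \<in> F") fastforce+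
  have "F - {v} \<in> ridges"
    using K_down[OF F(1), of "F - {v}"] v F(2) fin by (auto simp: ridges_def)
  then show ?thesis using card_ridges finite_ridges by (auto simp: card_gt_0_iff)
qed

text \<open>The facets in \<open>T\<close> together with the full skeleton below them, which every
  spanning tree contains.\<close>

definition tree :: "int set set \<Rightarrow> int set set" where
  "tree T = T \<union> {F \<in> K. card F \<le> d}"

lemma tree_complex:
  assumes "T \<subseteq> facets"
  shows "simplicial_complex {p..q} (tree T)"
  unfolding simplicial_complex_def
proof (intro conjI ballI allI impI)
  have TK: "F \<in> K" if "F \<in> tree T" for F using that assms by (auto simp: tree_def facets_def)
  show "tree T \<subseteq> Pow {p..q}" using TK K_sub by blast
  have "{} \<in> K" using complex by (auto simp: simplicial_complex_def)
  then show "{} \<in> tree T" by (simp add: tree_def)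
  fix F G assume F: "F \<in> tree T" "G \<subseteq> F"
  show "G \<in> tree T"
  proof (cases "G = F")
    case False
    then have "card G < card F" using F K_finite[OF TK[OF F(1)]] by (intro psubset_card_mono) auto
    then have "card G \<le> d" using K_card_le[OF TK[OF F(1)]] by simp
    then show ?thesis using K_down[OF TK[OF F(1)] F(2)] by (simp add: tree_def)
  qed (use F in simp)
qed simp

lemma tree_faces:
  assumes T: "T \<subseteq> facets"
  shows "faces (int d) (tree T) = T" "i < int d \<Longrightarrow> faces i (tree T) = faces i K"
    "faces (int d + 1) (tree T) = {}"
proof -
  have mem: "F \<in> faces i (tree T) \<longleftrightarrow> int (card F) - 1 = i \<and> (F \<in> T \<or> F \<in> K \<and> card F \<le> d)" for i F
    by (auto simp: faces_def tree_def)
  have TK: "F \<in> K \<and> card F = Suc d" if "F \<in> T" for F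
    using subsetD[OF T that] by (simp add: facets_def)
  have "F \<in> faces (int d) (tree T) \<longleftrightarrow> F \<in> T" for F
    unfolding mem using TK[of F] by (cases "F \<in> T") simp_all
  then show "faces (int d) (tree T) = T" by blast
  have "F \<in> faces i (tree T) \<longleftrightarrow> F \<in> faces i K" if "i < int d" for F
    using TK[of F] that by (cases "F \<in> T") (auto simp: faces_def tree_def)
  then show "i < int d \<Longrightarrow> faces i (tree T) = faces i K" by blast
  have "F \<notin> faces (int d + 1) (tree T)" for F
    unfolding mem using TK[of F] by (cases "F \<in> T") simp_all
  then show "faces (int d + 1) (tree T) = {}" by blast
qed

lemma ridge_faces: "F \<in> faces (int d - 1) K \<and> p \<notin> F \<longleftrightarrow> F \<in> ridges"
  by (auto simp: faces_def ridges_def)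

lemma cycle_ridges_eq_0:
  assumes z: "z \<in> cycles (int d - 1) K" "\<And>i. i < n \<Longrightarrow> Poly_Mapping.lookup z (h i) = 0"
  shows "z = 0"
proof (rule cycle_eq_0[OF z(1)])
  fix F assume "F \<in> faces (int d - 1) K" "p \<notin> F"
  then have "F \<in> ridges" using ridge_faces by blast
  then obtain i where "i < n" "F = h i" using h by (auto simp: bij_betw_def)
  then show "Poly_Mapping.lookup z F = 0" using z(2) by simp
qed

context
  fixes T :: "int set set" and e :: "nat \<Rightarrow> int set"
  assumes T: "T \<subseteq> facets" and e: "bij_betw e {..<n} T"
begin

abbreviation "M \<equiv> \<lambda>i j. incidence (h i) (e j)"

lemma lookup_boundary_tree:
  assumes "Poly_Mapping.keys c \<subseteq> T"
  shows "Poly_Mapping.lookup (boundary c) H = (\<Sum>j<n. incidence H (e j) * Poly_Mapping.lookup c (e j))"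
proof -
  have "finite T" using T finite_facets finite_subset by blast
  then have "Poly_Mapping.lookup (boundary c) H = (\<Sum>G\<in>T. Poly_Mapping.lookup c G * incidence H G)"
    using assms by (rule lookup_boundary)
  also have "\<dots> = (\<Sum>j<n. Poly_Mapping.lookup c (e j) * incidence H (e j))"
    by (rule sum.reindex_bij_betw[OF e, symmetric])
  finally show ?thesis by (simp only: mult.commute)
qed

lemma boundary_tree_cycle:
  assumes "Poly_Mapping.keys c \<subseteq> T"
  shows "boundary c \<in> cycles (int d - 1) K"
proof -
  have "Poly_Mapping.keys c \<subseteq> faces (int d - 1 + 1) K"
    using assms T by (simp add: faces_simps)
  then have "Poly_Mapping.keys (boundary c) \<subseteq> faces (int d - 1) K"
    by (rule keys_boundary[OF complex])
  then show ?thesis by (simp add: cycles_def chain_group_def boundary_boundary)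
qed

definition chain :: "(nat \<Rightarrow> int) \<Rightarrow> int set \<Rightarrow>\<^sub>0 int" where
  "chain t = (\<Sum>j<n. frag_cmul (t j) (frag_of (e j)))"

lemma lookup_chain: "j < n \<Longrightarrow> Poly_Mapping.lookup (chain t) (e j) = t j"
proof -
  assume j: "j < n"
  have "Poly_Mapping.lookup (chain t) (e j) = (\<Sum>l<n. if l = j then t l else 0)"
    unfolding chain_def lookup_sum lookup_frag_cmul using j e
    by (intro sum.cong) (auto simp: bij_betw_def inj_on_def when_def)
  then show ?thesis using j by simp
qed

lemma keys_chain: "Poly_Mapping.keys (chain t) \<subseteq> T"
proof -
  have "Poly_Mapping.keys (frag_cmul (t j) (frag_of (e j))) \<subseteq> T" if "j \<in> {..<n}" for j
    using e that by (auto simp: bij_betw_def)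
  then have "chain t \<in> carrier (free_Abelian_group T)"
    unfolding chain_def by (intro sum_closed_free_Abelian_group) auto
  then show ?thesis by simp
qed

text \<open>A kernel vector is a chain on \<open>T\<close> whose boundary vanishes at all ridges.
  This boundary is a cycle of \<open>K\<close>, so it is zero by
  \<open>cycle_ridges_eq_0\<close>.\<close>

lemma det_nonzero_iff: "detf n M \<noteq> 0 \<longleftrightarrow> cycles (int d) (tree T) = {0}"
proof -
  have Z: "c \<in> cycles (int d) (tree T) \<longleftrightarrow> Poly_Mapping.keys c \<subseteq> T \<and> boundary c = 0" for c
    by (simp add: cycles_def chain_group_def tree_faces[OF T])
  have "detf n M = 0 \<longleftrightarrow> (\<exists>c\<in>cycles (int d) (tree T). c \<noteq> 0)"
  proof
    assume "detf n M = 0"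
    then obtain t j where t: "j < n" "t j \<noteq> 0" "\<forall>i<n. (\<Sum>j<n. M i j * t j) = 0"
      unfolding detf_eq_0_iff by blast
    have "boundary (chain t) = 0"
    proof (rule cycle_ridges_eq_0[OF boundary_tree_cycle[OF keys_chain]])
      fix i assume "i < n"
      then show "Poly_Mapping.lookup (boundary (chain t)) (h i) = 0"
        using t(3) by (simp add: lookup_boundary_tree[OF keys_chain] lookup_chain)
    qed
    moreover have "chain t \<noteq> 0" using lookup_chain[OF t(1), of t] t(2) by auto
    ultimately show "\<exists>c\<in>cycles (int d) (tree T). c \<noteq> 0"
      using Z keys_chain by blast
  next
    assume "\<exists>c\<in>cycles (int d) (tree T). c \<noteq> 0"
    then obtain c where c: "Poly_Mapping.keys c \<subseteq> T" "boundary c = 0" "c \<noteq> 0" using Z by blast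
    then obtain G where "G \<in> Poly_Mapping.keys c" by (metis keys_eq_empty all_not_in_conv)
    then obtain j where "j < n" "Poly_Mapping.lookup c (e j) \<noteq> 0"
      using c(1) e by (auto simp: bij_betw_def in_keys_iff)
    moreover have "\<forall>i<n. (\<Sum>j<n. M i j * Poly_Mapping.lookup c (e j)) = 0"
      using lookup_boundary_tree[OF c(1)] c(2) by simp
    ultimately show "detf n M = 0"
      unfolding detf_eq_0_iff by (intro exI[of _ "\<lambda>j. Poly_Mapping.lookup c (e j)"]) blast
  qed
  moreover have "0 \<in> cycles (int d) (tree T)" by (simp add: Z)
  ultimately show ?thesis by blast
qed

lemma trivial_top_homology: "trivial_group (reduced_homology (int d) (tree T)) \<longleftrightarrow> detf n M \<noteq> 0"
proof -
  let ?U = "tree T"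
  interpret Q: chain_quotient "faces (int d) ?U" "cycles (int d) ?U" "boundaries (int d) ?U"
    by (rule chain_quotient_homology[OF tree_complex[OF T]])
  have B: "boundaries (int d) ?U = {0}" by (rule boundaries_top) (rule tree_faces(3)[OF T])
  have "trivial_group (reduced_homology (int d) ?U) \<longleftrightarrow> Q.cls ` cycles (int d) ?U = {Q.cls 0}"
    unfolding trivial_group_def chain_quotient_homology(2)[OF tree_complex[OF T], symmetric]
    using Q.carrier_Q Q.cls_0 Q.Q.is_group by simp
  also have "\<dots> \<longleftrightarrow> cycles (int d) ?U = {0}"
  proof
    assume eq: "Q.cls ` cycles (int d) ?U = {Q.cls 0}"
    have "z = 0" if "z \<in> cycles (int d) ?U" for z
    proof -
      have "Q.cls z = Q.cls 0" using eq that by blast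
      then show ?thesis using Q.cls_eq_iff[OF that Q.Z_closed(1)] B by simp
    qed
    then show "cycles (int d) ?U = {0}" using Q.Z_closed(1) by blast
  qed simp
  finally show ?thesis using det_nonzero_iff by simp
qed

text \<open>The coordinates at the ridges identify the \<open>(d - 1)\<close>-cycles with integer
  vectors of length \<open>n\<close>, and the boundaries with the column lattice of
  \<open>M\<close>. A transversal of this lattice therefore enumerates the homology classes.\<close>

lemma order_homology:
  assumes det: "detf n M \<noteq> 0"
  shows "finite (carrier (reduced_homology (int d - 1) (tree T)))"
    and "int (Coset.order (reduced_homology (int d - 1) (tree T))) = \<bar>detf n M\<bar>"
proof -
  let ?U = "tree T" and ?z = "\<lambda>i. boundary (frag_of (insert p (h i)))"
  interpret Q: chain_quotient "faces (int d - 1) ?U" "cycles (int d - 1) ?U" "boundaries (int d - 1) ?U"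
    by (rule chain_quotient_homology[OF tree_complex[OF T]])
  \<comment> \<open>Cycles in this degree depend only on the \<open>(d - 1)\<close>-faces, which the
    tree shares with \<open>K\<close>.\<close>
  have ZK: "cycles (int d - 1) ?U = cycles (int d - 1) K"
    by (simp add: cycles_def chain_group_def tree_faces[OF T])
  \<comment> \<open>The inverse of the coordinate map: combinations of cone cycles realise every
    integer vector.\<close>
  define \<zeta> where "\<zeta> v = (\<Sum>i<n. frag_cmul (v i) (?z i))" for v
  have \<zeta>_Z: "\<zeta> v \<in> cycles (int d - 1) ?U" for v
    unfolding \<zeta>_def
  proof (rule Q.sum_closed, rule Q.cmul_closed)
    fix i assume "i \<in> {..<n}"
    then show "?z i \<in> cycles (int d - 1) ?U"
      unfolding ZK using h_in[of i] by (intro cone_cycle) (auto simp: ridges_def)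
  qed
  have lookup_\<zeta>: "Poly_Mapping.lookup (\<zeta> v) (h i) = v i" if "i < n" for v i
  proof -
    have "Poly_Mapping.lookup (\<zeta> v) (h i) = (\<Sum>l<n. if l = i then v l else 0)"
      unfolding \<zeta>_def lookup_sum lookup_frag_cmul
    proof (rule sum.cong[OF refl])
      fix l assume "l \<in> {..<n}"
      then have l: "l < n" by simp
      have "Poly_Mapping.lookup (?z l) (h i) = (if h i = h l then 1 else 0)"
        using h_in[OF l] h_in[OF that] by (intro lookup_cone) (auto simp: ridges_def)
      moreover have "h i = h l \<longleftrightarrow> l = i" using h l that by (auto simp: bij_betw_def inj_on_def)
      ultimately show "v l * Poly_Mapping.lookup (?z l) (h i) = (if l = i then v l else 0)" by simp
    qed
    then show ?thesis using that by simp
  qed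
  have B_iff: "z \<in> boundaries (int d - 1) ?U \<longleftrightarrow> (\<exists>t. \<forall>i<n. Poly_Mapping.lookup z (h i) = (\<Sum>j<n. M i j * t j))"
    if z: "z \<in> cycles (int d - 1) ?U" for z
  proof
    assume "z \<in> boundaries (int d - 1) ?U"
    then obtain c where "z = boundary c" "Poly_Mapping.keys c \<subseteq> T"
      by (auto simp: boundaries_def chain_group_def tree_faces[OF T])
    then show "\<exists>t. \<forall>i<n. Poly_Mapping.lookup z (h i) = (\<Sum>j<n. M i j * t j)"
      by (intro exI[of _ "\<lambda>j. Poly_Mapping.lookup c (e j)"]) (simp add: lookup_boundary_tree)
  next
    assume "\<exists>t. \<forall>i<n. Poly_Mapping.lookup z (h i) = (\<Sum>j<n. M i j * t j)"
    then obtain t where t: "\<forall>i<n. Poly_Mapping.lookup z (h i) = (\<Sum>j<n. M i j * t j)" ..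
    have bU: "boundary (chain t) \<in> cycles (int d - 1) ?U"
      unfolding ZK by (rule boundary_tree_cycle[OF keys_chain])
    have "z - boundary (chain t) = 0"
    proof (rule cycle_ridges_eq_0)
      show "z - boundary (chain t) \<in> cycles (int d - 1) K"
        using Q.Z_closed(2)[OF z Q.Z_closed(3)[OF bU]] unfolding ZK by simp
      show "Poly_Mapping.lookup (z - boundary (chain t)) (h i) = 0" if "i < n" for i
        using t that by (simp add: lookup_minus lookup_boundary_tree[OF keys_chain] lookup_chain)
    qed
    then have "z = boundary (chain t)" by simp
    moreover have "chain t \<in> carrier (chain_group (int d - 1 + 1) ?U)"
      using keys_chain by (simp add: chain_group_def tree_faces[OF T])
    ultimately show "z \<in> boundaries (int d - 1) ?U" unfolding boundaries_def by (rule image_eqI)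
  qed
  obtain R where R: "finite R" "int (card R) = \<bar>detf n M\<bar>" "transversal n M R"
    using ex_transversal[OF det] by blast
  have uniq: "\<exists>!r. r \<in> R \<and> (\<exists>t. \<forall>i<n. v i - r i = (\<Sum>j<n. M i j * t j))" for v
    using R(3) unfolding transversal_def by blast
  have cls_eq: "Q.cls z = Q.cls (\<zeta> r) \<longleftrightarrow>
      (\<exists>t. \<forall>i<n. Poly_Mapping.lookup z (h i) - r i = (\<Sum>j<n. M i j * t j))"
    if z: "z \<in> cycles (int d - 1) ?U" for z r
  proof -
    have "z - \<zeta> r \<in> cycles (int d - 1) ?U"
      using Q.Z_closed(2)[OF z Q.Z_closed(3)[OF \<zeta>_Z]] by simp
    then have "Q.cls z = Q.cls (\<zeta> r) \<longleftrightarrow>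
        (\<exists>t. \<forall>i<n. Poly_Mapping.lookup (z - \<zeta> r) (h i) = (\<Sum>j<n. M i j * t j))"
      using Q.cls_eq_iff[OF z \<zeta>_Z] B_iff by blast
    also have "\<dots> \<longleftrightarrow> (\<exists>t. \<forall>i<n. Poly_Mapping.lookup z (h i) - r i = (\<Sum>j<n. M i j * t j))"
      by (simp add: lookup_minus lookup_\<zeta>)
    finally show ?thesis .
  qed
  have "bij_betw (\<lambda>r. Q.cls (\<zeta> r)) R (carrier (Q.Zg Mod boundaries (int d - 1) ?U))"
    unfolding bij_betw_def
  proof
    show "inj_on (\<lambda>r. Q.cls (\<zeta> r)) R"
    proof (rule inj_onI)
      fix r s assume rs: "r \<in> R" "s \<in> R" "Q.cls (\<zeta> r) = Q.cls (\<zeta> s)"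
      have "\<exists>t. \<forall>i<n. r i - s i = (\<Sum>j<n. M i j * t j)"
        using rs(3) unfolding cls_eq[OF \<zeta>_Z] by (simp add: lookup_\<zeta>)
      moreover have "\<exists>t. \<forall>i<n. r i - r i = (\<Sum>j<n. M i j * t j)"
        by (rule exI[of _ "\<lambda>_. 0"]) simp
      ultimately show "r = s" using uniq[of r] rs(1,2) by blast
    qed
    show "(\<lambda>r. Q.cls (\<zeta> r)) ` R = carrier (Q.Zg Mod boundaries (int d - 1) ?U)"
    proof (intro equalityI subsetI)
      fix y assume "y \<in> carrier (Q.Zg Mod boundaries (int d - 1) ?U)"
      then obtain z where z: "z \<in> cycles (int d - 1) ?U" "y = Q.cls z" using Q.carrier_Q by auto
      obtain r where "r \<in> R" "\<exists>t. \<forall>i<n. Poly_Mapping.lookup z (h i) - r i = (\<Sum>j<n. M i j * t j)"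
        using uniq[of "\<lambda>i. Poly_Mapping.lookup z (h i)"] by blast
      then have "y = Q.cls (\<zeta> r)" unfolding z(2) cls_eq[OF z(1)] by simp
      then show "y \<in> (\<lambda>r. Q.cls (\<zeta> r)) ` R" using \<open>r \<in> R\<close> by blast
    qed (use \<zeta>_Z Q.cls_mem in auto)
  qed
  then have "finite (carrier (Q.Zg Mod boundaries (int d - 1) ?U))"
    "card (carrier (Q.Zg Mod boundaries (int d - 1) ?U)) = card R"
    using R(1) by (auto simp: bij_betw_finite[symmetric] bij_betw_same_card[symmetric])
  then show "finite (carrier (reduced_homology (int d - 1) ?U))"
    "int (Coset.order (reduced_homology (int d - 1) ?U)) = \<bar>detf n M\<bar>"
    unfolding chain_quotient_homology(2)[OF tree_complex[OF T]] Coset.order_def using R(2) by simp_all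
qed

end

text \<open>The face count leaves exactly \<open>n\<close> facets. For such a set trivial top
  homology is equivalent to a nonzero determinant, which in turn makes the homology in degree
  \<open>d - 1\<close> finite.\<close>

lemma spanning_trees_eq:
  assumes e: "\<And>T. T \<subseteq> facets \<Longrightarrow> card T = n \<Longrightarrow> bij_betw (e T) {..<n} T"
  shows "spanning_trees (int d) K =
    tree ` {T. T \<subseteq> facets \<and> card T = n \<and> detf n (\<lambda>i j. incidence (h i) (e T j)) \<noteq> 0}"
proof (intro equalityI subsetI)
  fix U assume "U \<in> spanning_trees (int d) K"
  then have U: "U \<subseteq> K" "\<And>i. i < int d \<Longrightarrow> faces i U = faces i K"
      "trivial_group (reduced_homology (int d) U)"
      "int (card (faces (int d) U)) = int (card (faces (int d) K)) - int (betti (int d) K) + int (betti (int d - 1) K)"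
    by (auto simp: spanning_trees_def)
  let ?T = "faces (int d) U"
  have T: "?T \<subseteq> facets" using U(1) by (auto simp: faces_def facets_def)
  have card: "card ?T = n"
    using U(4) unfolding faces_simps betti_top betti card_facets by simp
  have mem: "F \<in> U \<longleftrightarrow> F \<in> tree ?T" if F: "F \<in> K" for F
  proof (cases "card F \<le> d")
    case True
    then have "F \<in> faces (int (card F) - 1) U \<longleftrightarrow> F \<in> faces (int (card F) - 1) K"
      using U(2)[of "int (card F) - 1"] by simp
    then show ?thesis using F True by (simp add: faces_def tree_def)
  next
    case False
    then have "card F = Suc d" using K_card_le[OF F] by simp
    then show ?thesis by (simp add: tree_def faces_def)
  qed
  have "tree ?T \<subseteq> K" using T by (auto simp: tree_def facets_def)
  then have eq: "U = tree ?T" using mem U(1) by blast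
  have "detf n (\<lambda>i j. incidence (h i) (e ?T j)) \<noteq> 0"
    using trivial_top_homology[OF T e[OF T card]] U(3) eq by simp
  then show "U \<in> tree ` {T. T \<subseteq> facets \<and> card T = n \<and> detf n (\<lambda>i j. incidence (h i) (e T j)) \<noteq> 0}"
    using eq T card by (intro image_eqI[of _ _ ?T]) auto
next
  fix U assume "U \<in> tree ` {T. T \<subseteq> facets \<and> card T = n \<and> detf n (\<lambda>i j. incidence (h i) (e T j)) \<noteq> 0}"
  then obtain T where T: "T \<subseteq> facets" "card T = n" "detf n (\<lambda>i j. incidence (h i) (e T j)) \<noteq> 0"
    and U: "U = tree T" by blast
  note eT = e[OF T(1,2)]
  have "T \<noteq> {}" using n_pos T(2) by auto
  then obtain F where F: "F \<in> T" "card F = Suc d" using T(1) by (auto simp: facets_def)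
  have UK: "U \<subseteq> K" using T(1) by (auto simp: U tree_def facets_def)
  have "complex_dim U = int d"
    unfolding complex_dim_def
  proof (rule Max_eqI)
    show "finite ((\<lambda>F. int (card F) - 1) ` U)" using finite_subset[OF UK finite_K] by simp
    show "y \<le> int d" if "y \<in> (\<lambda>F. int (card F) - 1) ` U" for y
      using that UK K_card_le by fastforce
    show "int d \<in> (\<lambda>F. int (card F) - 1) ` U"
      using F by (intro image_eqI[of _ _ F]) (auto simp: U tree_def)
  qed
  moreover have "int (card (faces (int d) U)) =
      int (card (faces (int d) K)) - int (betti (int d) K) + int (betti (int d - 1) K)"
    unfolding U tree_faces[OF T(1)] faces_simps betti_top betti card_facets using T(2) by simp
  ultimately show "U \<in> spanning_trees (int d) K"
    unfolding spanning_trees_def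
    using UK tree_complex[OF T(1)] tree_faces(2)[OF T(1)] trivial_top_homology[OF T(1) eT]
      order_homology(1)[OF T(1) eT] T(3) by (auto simp: U)
qed

text \<open>Squaring removes the absolute value in \<open>order_homology\<close>. Sets of
  \<open>n\<close> facets that give no tree have determinant zero, so the sum may run over all of
  them, as Cauchy-Binet requires.\<close>

theorem fine_tau_eq_sum_det:
  assumes e: "\<And>T. T \<subseteq> facets \<Longrightarrow> card T = n \<Longrightarrow> bij_betw (e T) {..<n} T"
  shows "fine_tau (int d) K =
    (\<Sum>T | T \<subseteq> facets \<and> card T = n. of_int ((detf n (\<lambda>i j. incidence (h i) (e T j)))\<^sup>2) * (\<Prod>F\<in>T. X_mon (mset_set F)))"
proof -
  let ?D = "\<lambda>T. detf n (\<lambda>i j. incidence (h i) (e T j))"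
  let ?Ts = "{T. T \<subseteq> facets \<and> card T = n \<and> ?D T \<noteq> 0}"
  have inj: "inj_on tree ?Ts"
    by (rule inj_onI) (metis (mono_tags, lifting) mem_Collect_eq tree_faces(1))
  have "fine_tau (int d) K = (\<Sum>T\<in>?Ts. of_nat (Coset.order (reduced_homology (int d - 1) (tree T))) ^ 2 *
      (\<Prod>F\<in>faces (int d) (tree T). X_mon (mset_set F)))"
  proof -
    have "spanning_trees (int d) K = tree ` ?Ts" by (rule spanning_trees_eq) (rule e)
    then show ?thesis unfolding fine_tau_def by (simp only: sum.reindex[OF inj] o_def)
  qed
  also have "\<dots> = (\<Sum>T\<in>?Ts. of_int ((?D T)\<^sup>2) * (\<Prod>F\<in>T. X_mon (mset_set F)))"
  proof (rule sum.cong[OF refl])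
    fix T assume "T \<in> ?Ts"
    then have T: "T \<subseteq> facets" "card T = n" "?D T \<noteq> 0" by auto
    have "(of_nat (Coset.order (reduced_homology (int d - 1) (tree T))) :: indet_poly) ^ 2 =
        of_int (int (Coset.order (reduced_homology (int d - 1) (tree T))) ^ 2)"
      by simp
    also have "\<dots> = of_int ((?D T)\<^sup>2)"
      unfolding order_homology(2)[OF T(1) e[OF T(1,2)] T(3)] by simp
    finally show "of_nat (Coset.order (reduced_homology (int d - 1) (tree T))) ^ 2 *
        (\<Prod>F\<in>faces (int d) (tree T). X_mon (mset_set F)) = of_int ((?D T)\<^sup>2) * (\<Prod>F\<in>T. X_mon (mset_set F))"
      unfolding tree_faces(1)[OF T(1)] by simp
  qed
  also have "\<dots> = (\<Sum>T | T \<subseteq> facets \<and> card T = n. of_int ((?D T)\<^sup>2) * (\<Prod>F\<in>T. X_mon (mset_set F)))"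
    using finite_facets by (intro sum.mono_neutral_left) auto
  finally show ?thesis .
qed

end

section \<open>The tree sum as a Laplacian determinant, and the closed formula\<close>

lemma of_int_detf: "(of_int (detf n M) :: 'a::comm_ring_1) = detf n (\<lambda>i j. of_int (M i j))"
  by (simp add: detf_def)

lemma detf_mult_cols: "detf n (\<lambda>i j. M i j * c j) = detf n M * (\<Prod>j<n. c j)"
proof -
  have "(\<Prod>i = 0..<n. M i (s i) * c (s i)) = (\<Prod>i = 0..<n. M i (s i)) * (\<Prod>j<n. c j)"
    if "s permutes {0..<n}" for s
    using prod.permute[OF that, of c] by (simp add: prod.distrib lessThan_atLeast0 o_def)
  then show ?thesis
    unfolding detf_def sum_distrib_right by (intro sum.cong) (auto simp: mult.assoc)
qed

lemma to_fract_of_int: "to_fract (of_int k :: 'a::idom) = of_int k"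
proof -
  have "to_fract (of_nat m :: 'a) = of_nat m" for m by (induction m) auto
  then show ?thesis by (cases k rule: int_cases2) simp_all
qed

context acyclic_shifted_cone
begin

theorem to_fract_fine_tau: "to_fract (fine_tau (int d) K) = detf n (\<lambda>i j. laplacian x_frac facets (h i) (h j))"
proof -
  have "\<exists>e. bij_betw e {..<n} T" if "T \<subseteq> facets" "card T = n" for T
    using ex_bij_betw_nat_finite[of T] finite_subset[OF that(1) finite_facets] that(2)
    by (auto simp: lessThan_atLeast0)
  then obtain e where e: "\<And>T. T \<subseteq> facets \<Longrightarrow> card T = n \<Longrightarrow> bij_betw (e T) {..<n} T"
    by metis
  let ?D = "\<lambda>T. detf n (\<lambda>i j. incidence (h i) (e T j))"
  \<comment> \<open>All weights go into the left factor, where they scale columns.\<close>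
  let ?A = "\<lambda>i G. of_int (incidence (h i) G) * weight x_frac G" and ?B = "\<lambda>G j. of_int (incidence (h j) G) :: indet_poly fract"
  have "detf n (\<lambda>i j. laplacian x_frac facets (h i) (h j)) = detf n (\<lambda>i j. \<Sum>G\<in>facets. ?A i G * ?B G j)"
    by (rule detf_cong) (simp add: laplacian_def mult_ac)
  also have "\<dots> = (\<Sum>T | T \<subseteq> facets \<and> card T = n. detf n (\<lambda>i j. ?A i (e T j)) * detf n (\<lambda>i j. ?B (e T i) j))"
    by (rule cauchy_binet[OF finite_facets]) (use e in \<open>simp add: lessThan_atLeast0\<close>)
  also have "\<dots> = (\<Sum>T | T \<subseteq> facets \<and> card T = n.
      to_fract (of_int ((?D T)\<^sup>2) * (\<Prod>F\<in>T. X_mon (mset_set F))))"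
  proof (rule sum.cong[OF refl])
    fix T assume "T \<in> {T. T \<subseteq> facets \<and> card T = n}"
    then have T: "bij_betw (e T) {..<n} T" using e by simp
    have "detf n (\<lambda>i j. ?A i (e T j)) = of_int (?D T) * (\<Prod>j<n. weight x_frac (e T j))"
      unfolding detf_mult_cols of_int_detf ..
    also have "(\<Prod>j<n. weight x_frac (e T j)) = (\<Prod>F\<in>T. weight x_frac F)"
      by (rule prod.reindex_bij_betw[OF T])
    also have "\<dots> = to_fract (\<Prod>F\<in>T. X_mon (mset_set F))"
      unfolding to_fract_prod to_fract_X_mon sorted_list_of_mset_set ..
    finally have A: "detf n (\<lambda>i j. ?A i (e T j)) = of_int (?D T) * to_fract (\<Prod>F\<in>T. X_mon (mset_set F))" .
    have B: "detf n (\<lambda>i j. ?B (e T i) j) = of_int (?D T)"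
      unfolding of_int_detf using detf_transpose[of n "\<lambda>i j. ?B (e T j) i"] by simp
    have "to_fract (of_int ((?D T)\<^sup>2) * (\<Prod>F\<in>T. X_mon (mset_set F))) =
        of_int (?D T) ^ 2 * to_fract (\<Prod>F\<in>T. X_mon (mset_set F))"
      by (simp only: to_fract_mult to_fract_of_int flip: of_int_power)
    then show "detf n (\<lambda>i j. ?A i (e T j)) * detf n (\<lambda>i j. ?B (e T i) j) =
        to_fract (of_int ((?D T)\<^sup>2) * (\<Prod>F\<in>T. X_mon (mset_set F)))"
      unfolding A B by (simp only: power2_eq_square mult_ac)
  qed
  also have "\<dots> = to_fract (fine_tau (int d) K)"
  proof -
    have "fine_tau (int d) K = (\<Sum>T | T \<subseteq> facets \<and> card T = n. of_int ((?D T)\<^sup>2) * (\<Prod>F\<in>T. X_mon (mset_set F)))"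
      by (rule fine_tau_eq_sum_det) (rule e)
    then show ?thesis by simp
  qed
  finally show ?thesis ..
qed

text \<open>By \<open>ridges_cone\<close> every ridge can be coned off, so the rows of the matrix
  are exactly the faces of the link over which the theorem takes its first product.\<close>

lemma faces_link: "faces (int d - 1) (link p K) = ridges"
proof -
  have "F \<in> faces (int d - 1) (link p K) \<longleftrightarrow> F \<in> ridges" for F
    using ridges_cone[OF betti, of F] K_down[of "insert p F" F]
    by (auto simp: faces_def link_def ridges_def)
  then show ?thesis by blast
qed

text \<open>For \<open>b = p + 1\<close> the shift would introduce \<open>p\<close> and leave the
  deletion.\<close>

lemma del_facets_shift: "F \<in> del_facets \<Longrightarrow> b \<in> F \<Longrightarrow> b - 1 \<notin> F \<Longrightarrow> b \<noteq> p + 1 \<Longrightarrow> insert (b - 1) (F - {b}) \<in> del_facets"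
proof -
  assume F: "F \<in> del_facets" "b \<in> F" "b - 1 \<notin> F" "b \<noteq> p + 1"
  have b: "p < b" "b \<le> q" using del_facets_sub[OF F(1)] F(2) by auto
  have FK: "F \<in> K" "p \<notin> F" "card F = Suc d" using F(1) by (auto simp: del_facets_def)
  have "insert (b - 1) (F - {b}) \<in> K" using FK b F by (intro K_shift) auto
  moreover have "card (insert (b - 1) (F - {b})) = Suc d"
    using K_finite[OF FK(1)] F FK(3) card_Suc_Diff1[OF K_finite[OF FK(1)] F(2)]
    by (subst card_insert_disjoint) auto
  ultimately show ?thesis using FK(2) b F(4) by (auto simp: del_facets_def)
qed

text \<open>If \<open>p + 1\<close> is not yet a vertex of a facet, any vertex of it can be shifted
  there within the deletion. So the second components of long signatures are intervals starting
  right after \<open>p\<close>.\<close>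

lemma least_vertex_del_facets:
  assumes "del_facets \<noteq> {}"
  shows "least_vertex del_facets = p + 1"
  unfolding least_vertex_def
proof (rule Min_eqI)
  have sub: "\<Union> del_facets \<subseteq> {p<..q}" using del_facets_sub by blast
  show "finite (\<Union> del_facets)" using sub by (rule finite_subset) simp
  show "p + 1 \<le> v" if "v \<in> \<Union> del_facets" for v using subsetD[OF sub that] by simp
  obtain F where F: "F \<in> del_facets" using assms by blast
  then obtain v where v: "v \<in> F" unfolding del_facets_def by fastforce
  have FK: "F \<in> K" "p \<notin> F" "card F = Suc d" using F by (auto simp: del_facets_def)
  show "p + 1 \<in> \<Union> del_facets"
  proof (cases "p + 1 \<in> F")
    case False
    have "p < v" "v \<le> q" using del_facets_sub[OF F] v by auto
    then have pv: "p + 1 < v" using False v by (cases "v = p + 1") auto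
    have "insert (p + 1) (F - {v}) \<in> K" using FK False v pv \<open>v \<le> q\<close> by (intro K_shift) auto
    moreover have "card (insert (p + 1) (F - {v})) = Suc d"
      using K_finite[OF FK(1)] False FK(3) card_Suc_Diff1[OF K_finite[OF FK(1)] v]
      by (subst card_insert_disjoint) auto
    ultimately have "insert (p + 1) (F - {v}) \<in> del_facets" using FK(2) by (auto simp: del_facets_def)
    then show ?thesis by blast
  qed (use F in blast)
qed

theorem to_fract_fine_tau_product:
  "to_fract (fine_tau (int d) K) = (\<Prod>H\<in>ridges. to_fract (X_mon (mset_set (insert p H)))) *
    (\<Prod>F\<in>del_facets. \<Prod>v\<in>F. prefix_sum x_frac p {u \<in> F. u < v} v / prefix_sum x_frac p {u \<in> F. u < v} (v - 1))"
proof -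
  have "to_fract (fine_tau (int d) K) =
      detf n (\<lambda>i j. laplacian x_frac (insert p ` ridges \<union> del_facets) (h i) (h j))"
    unfolding to_fract_fine_tau facets_split(1) ..
  also have "\<dots> = (\<Prod>H\<in>ridges. weight x_frac (insert p H)) *
    (\<Prod>F\<in>del_facets. \<Prod>v\<in>F. prefix_sum x_frac p {u \<in> F. u < v} v / prefix_sum x_frac p {u \<in> F. u < v} (v - 1))"
  proof (rule det_laplacian_order_ideal[OF p_le_q finite_ridges _ h x_frac_nonzero prefix_sum_x_frac_nonzero finite_del_facets])
    show "H \<subseteq> {p<..q} \<and> card H = d" if "H \<in> ridges" for H
      using ridges_sub[OF that] that by (simp add: ridges_def)
    show "G \<subseteq> {p<..q} \<and> card G = Suc d \<and> (\<forall>v\<in>G. G - {v} \<in> ridges)" if G: "G \<in> del_facets" for G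
    proof -
      have GK: "G \<in> K" "p \<notin> G" "card G = Suc d" using G by (auto simp: del_facets_def)
      have "G - {v} \<in> ridges" if "v \<in> G" for v
        using K_down[OF GK(1), of "G - {v}"] GK K_finite[OF GK(1)] that by (auto simp: ridges_def)
      then show ?thesis using del_facets_sub[OF G] GK(3) by blast
    qed
    show "G \<in> insert p ` ridges \<union> del_facets"
      if "F \<in> del_facets" "G \<subseteq> {p..q}" "card G = Suc d" "\<And>i. i < Suc d \<Longrightarrow> el G i \<le> el F i" for F G
    proof -
      have F: "F \<in> K" "card F = Suc d" using that(1) by (auto simp: del_facets_def)
      have "finite G" using that(2) by (rule finite_subset) simp
      from K_componentwise[OF F(1) this that(2)] have "G \<in> K" using that(3,4) F(2) by simp
      then show ?thesis unfolding facets_split(1)[symmetric] using that(3) by (simp add: facets_def)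
    qed
  qed
  finally show ?thesis unfolding to_fract_X_mon sorted_list_of_mset_set .
qed

end

theorem theorem1p6:
  fixes K :: "int set set" and p q :: int and d :: nat
  assumes "shifted_complex p q K"
    and "complex_dim K = int d"
    and "betti (int d - 1) K = 0"
  shows
    "to_fract (fine_tau (int d) K) =
       (\<Prod>F\<in>faces (int d - 1) (link p K). to_fract (X_mon (mset_set (insert p F)))) *
       (\<Prod>(S, T)\<in>#LSG (faces (int d) (deletion p K)).
          z_frac (mset_set S) (mset_set (insert p T)) / to_fract (X_mon {#p#}))
     \<and>
     (\<Prod>F\<in>faces (int d - 1) (link p K). to_fract (X_mon (mset_set (insert p F)))) *
       (\<Prod>(S, T)\<in>#LSG (faces (int d) (deletion p K)).
          z_frac (mset_set S) (mset_set (insert p T)) / to_fract (X_mon {#p#})) =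
     (\<Prod>F\<in>faces (int d - 1) (link p K). to_fract (X_mon (mset_set (insert p F)))) *
       (\<Prod>(S, T)\<in>#LSG (faces (int d) (deletion p K)).
          (\<Sum>j\<in>insert p T. to_fract (X_mon (mset_set S + {#j#}))) /
            to_fract (X_mon (mset_set (insert p S))))"
proof -
  interpret shifted_cone K p q d by unfold_locales (rule assms(1,2))+
  obtain h where h: "bij_betw h {..<card ridges} ridges"
    using ex_bij_betw_nat_finite[OF finite_ridges] by (auto simp: lessThan_atLeast0)
  interpret acyclic_shifted_cone K p q d h "card ridges"
    by unfold_locales (rule assms(3) h)+
  have fin: "finite F \<and> F \<subseteq> {p<..}" if "F \<in> del_facets" for F
    using del_facets_sub[OF that] finite_subset[of F "{p<..q}"] by auto
  show ?thesis
    unfolding faces_simps faces_link to_fract_fine_tau_product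
  proof (intro conjI arg_cong2[where f = "(*)"] refl)
    show "(\<Prod>F\<in>del_facets. \<Prod>v\<in>F. prefix_sum x_frac p {u \<in> F. u < v} v / prefix_sum x_frac p {u \<in> F. u < v} (v - 1)) =
      (\<Prod>(S, T)\<in>#LSG del_facets. z_frac (mset_set S) (mset_set (insert p T)) / to_fract (X_mon {#p#}))"
      by (rule trans[OF prod_ratio_LSG(1) prod_ratio_LSG(2)[symmetric]])
        (rule finite_del_facets | erule fin | (rule del_facets_shift; assumption) | erule least_vertex_del_facets)+
    show "(\<Prod>(S, T)\<in>#LSG del_facets. z_frac (mset_set S) (mset_set (insert p T)) / to_fract (X_mon {#p#})) =
      (\<Prod>(S, T)\<in>#LSG del_facets. (\<Sum>j\<in>insert p T. to_fract (X_mon (mset_set S + {#j#}))) /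
        to_fract (X_mon (mset_set (insert p S))))"
      by (rule prod_ratio_LSG(2))
        (rule finite_del_facets | erule fin | (rule del_facets_shift; assumption) | erule least_vertex_del_facets)+
  qed
qed

end
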